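(* Let $f$ be a meromorphic quasi-modular form and let $l\ge0$ be an integer. Then, as meromorphic functions of $s$, $$\Lambda(D^l f,s)=\frac{(s-l)_l}{(2\pi)^l}\Lambda(f,s-l)\qquad\text{and}\qquad L(D^lf,s)=L(f,s-l),$$ where $(a)_l=a(a+1)\cdots(a+l-1)$.
   Context: $\mathcal H$ is the upper half-plane, $q=e^{2\pi i\tau}$, $D=\frac{1}{2\pi i}\frac{d}{d\tau}$. A meromorphic quasi-modular form of weight $k$ is a meromorphic $f$ on $\mathcal H$ with functions $f_0,\dots,f_p$ meromorphic on $\mathcal H$ and at infinity (Fourier expansions $\sum_{n\ge-n_0}a(n)q^n$) such that $(c\tau+d)^{-k}f(\frac{a\tau+b}{c\tau+d})=\sum_{r=0}^pf_r(\tau)(c/(c\tau+d))^r$ for all $\begin{pmatrix}a&b\\c&d\end{pmatrix}\in SL_2(\mathbb Z)$. Regularized integrals: for $g$ analytic with at most linear exponential growth for large $t$, $\int_{t_0}^{\infty,*}g(t)dt$ is the value at $w=0$ of the analytic continuation of $\int_{t_0}^\infty e^{-wt}g(t)dt$; $\int_0^{t_0,*}g(t)dt:=\int_{1/t_0}^{\infty,*}t^{-2}g(1/t)dt$; if $g$ is meromorphic near $[a,b]$ with a single pole $c\in(a,b)$, $\int_a^{b,*}g(t)dt$ is the constant term at $s=0$ of the Laurent expansion of the meromorphic continuation of $\int_a^b|t-c|^sg(t)dt$; for $g$ with finitely many poles in $(0,\infty)$, $\int_0^{\infty,*}$ is obtained by splitting $(0,\infty)$ into intervals $(0,a_1),\dots,(a_n,\infty)$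 with each inner interval containing exactly one pole and no poles elsewhere, and summing. The complete $L$-function is $\Lambda(f,s)=\int_0^{\infty,*}f(it)t^{s-1}dt$ and the Dirichlet $L$-function is $L(f,s)=\frac{(2\pi)^s}{\Gamma(s)}\Lambda(f,s)$. *)

theory Defs
  imports "HOL-Complex_Analysis.Complex_Analysis"
begin

section \<open>Meromorphic quasi-modular forms\<close>

abbreviation upper_half_plane :: "complex set" (\<open>\<H>\<close>) where
  "\<H> \<equiv> {\<tau>. Im \<tau> > 0}"

definition meromorphic_at_ii_inf :: "(complex \<Rightarrow> complex) \<Rightarrow> bool" where
  "meromorphic_at_ii_inf f \<longleftrightarrow>
     (\<exists>(a :: int \<Rightarrow> complex) (n\<^sub>0 :: int) (Y :: real). \<forall>\<tau>. Im \<tau> > Y \<longrightarrow>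
        ((\<lambda>n. a n * exp (2 * of_real pi * \<i> * of_int n * \<tau>)) has_sum f \<tau>) {-n\<^sub>0..})"

text \<open>
  Meromorphic functions are total functions here, with irrelevant values at their poles. Hence the
  transformation law is an identity of meromorphic functions: it holds outside a subset of
  \<open>\<H>\<close> without limit points in \<open>\<H>\<close>.
\<close>
definition meromorphic_quasimodular_form :: "int \<Rightarrow> (complex \<Rightarrow> complex) \<Rightarrow> bool" where
  "meromorphic_quasimodular_form k f \<longleftrightarrow>
     f meromorphic_on \<H> \<and>
     (\<exists>(p :: nat) (F :: nat \<Rightarrow> complex \<Rightarrow> complex).
        (\<forall>r\<le>p. F r meromorphic_on \<H> \<and> meromorphic_at_ii_inf (F r)) \<and>
        (\<forall>a b c d :: int. a * d - b * c = 1 \<longrightarrow>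
           (\<forall>\<^sub>\<approx>\<tau>\<in>\<H>.
              (of_int c * \<tau> + of_int d) powi (-k) *
                f ((of_int a * \<tau> + of_int b) / (of_int c * \<tau> + of_int d)) =
              (\<Sum>r\<le>p. F r \<tau> * (of_int c / (of_int c * \<tau> + of_int d)) ^ r))))"

definition D_op :: "(complex \<Rightarrow> complex) \<Rightarrow> complex \<Rightarrow> complex" where
  "D_op f = (\<lambda>\<tau>. deriv f \<tau> / (2 * of_real pi * \<i>))"


section \<open>Regularized integrals\<close>

text \<open>
  \<open>has_reg_integral_inf \<sigma> g t\<^sub>0 v\<close>: the regularized integral of \<open>g\<close> over \<open>(t\<^sub>0, \<infinity>)\<close> is \<open>v\<close>, that is,
  the Laplace integral \<open>G w\<close>, which converges for \<open>Re w\<close> large, continues analytically to \<open>w = 0\<close>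
  with value \<open>v\<close>.

  For \<open>g t = exp (2 * pi * n * t) * t powr (s - 1)\<close> with \<open>n > 0\<close> the continuation is
  essentially an incomplete Gamma function, with a branch point at \<open>w = 2 * pi * n\<close>, so its value
  at \<open>0\<close> depends on the side on which the branch point is passed: \<open>\<sigma> = 1\<close> is continuation through
  the upper and \<open>\<sigma> = -1\<close> through the lower half of the \<open>w\<close>-plane (\<open>\<sigma> = 1\<close> amounts to principal
  branches). If \<open>g\<close> has a nonzero constant Fourier term, \<open>w = 0\<close> is itself a
  branch point, and the value there is understood as a limit.
\<close>
definition has_reg_integral_inf :: "real \<Rightarrow> (real \<Rightarrow> complex) \<Rightarrow> real \<Rightarrow> complex \<Rightarrow> bool" where
  "has_reg_integral_inf \<sigma> g t\<^sub>0 v \<longleftrightarrow>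
     (\<exists>(G :: complex \<Rightarrow> complex) (C :: real).
        (\<forall>w. Re w > C \<longrightarrow> ((\<lambda>t. exp (- w * of_real t) * g t) has_integral G w) {t\<^sub>0..}) \<and>
        G holomorphic_on {w. Re w > C \<or> \<sigma> * Im w > 0} \<and>
        (G \<longlongrightarrow> v) (at 0 within {w. \<sigma> * Im w > 0}))"

definition has_reg_integral_zero :: "real \<Rightarrow> (real \<Rightarrow> complex) \<Rightarrow> real \<Rightarrow> complex \<Rightarrow> bool" where
  "has_reg_integral_zero \<sigma> g t\<^sub>0 v \<longleftrightarrow>
     has_reg_integral_inf \<sigma> (\<lambda>t. g (1 / t) / of_real (t ^ 2)) (1 / t\<^sub>0) v"

definition has_reg_integral_pole ::
    "(real \<Rightarrow> complex) \<Rightarrow> real \<Rightarrow> real \<Rightarrow> real \<Rightarrow> complex \<Rightarrow> bool" where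
  "has_reg_integral_pole g a b c v \<longleftrightarrow>
     (\<exists>(G :: complex \<Rightarrow> complex) (M :: real).
        G meromorphic_on UNIV \<and>
        (\<forall>u. Re u > M \<longrightarrow>
           ((\<lambda>t. of_real \<bar>t - c\<bar> powr u * g t) has_integral G u) {a..b}) \<and>
        v = fls_nth (laurent_expansion G 0) 0)"


section \<open>The complete and the Dirichlet L-function\<close>

definition mellin_integrand :: "(complex \<Rightarrow> complex) \<Rightarrow> complex \<Rightarrow> real \<Rightarrow> complex" where
  "mellin_integrand f s t = f (\<i> * of_real t) * of_real t powr (s - 1)"

text \<open>
  The points \<open>as ! 0 < \<dots> < as ! n\<close> split \<open>(0, \<infinity>)\<close>; the pole of \<open>t \<mapsto> f (\<i> t)\<close> in the
  \<open>j\<close>-th inner interval is \<open>cs ! j\<close>, and there are no other poles on \<open>(0, \<infinity>)\<close>.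
\<close>
definition pole_splitting :: "(complex \<Rightarrow> complex) \<Rightarrow> real list \<Rightarrow> real list \<Rightarrow> bool" where
  "pole_splitting f as cs \<longleftrightarrow>
     (let P = {t :: real. t > 0 \<and> is_pole f (\<i> * of_real t)} in
        length as = Suc (length cs) \<and>
        0 < hd as \<and> P \<inter> {0<..hd as} = {} \<and>
        (\<forall>j<length cs. as ! j < cs ! j \<and> cs ! j < as ! Suc j \<and>
                       P \<inter> {as ! j..as ! Suc j} = {cs ! j}) \<and>
        P \<inter> {last as..} = {})"

text \<open>
  \<open>\<Lambda>(f,s)\<close> as a meromorphic function of \<open>s\<close>. The regularized integrals over the inner intervals
  exist for every \<open>s\<close>. Because of possible constant Fourier terms, the one at \<open>\<infinity>\<close> is in general
  only defined for \<open>Re s\<close> small and the one at \<open>0\<close> only for \<open>Re s\<close> large (for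
  instance, the integral of \<open>t powr (s - 1)\<close> over \<open>(t\<^sub>0, \<infinity>)\<close> is \<open>- t\<^sub>0 powr s / s\<close> for \<open>Re s < 0\<close>).
  Each of the two is continued meromorphically in \<open>s\<close> before the pieces are added up.
\<close>
definition is_complete_L ::
    "real \<Rightarrow> (complex \<Rightarrow> complex) \<Rightarrow> (complex \<Rightarrow> complex) \<Rightarrow> bool" where
  "is_complete_L \<sigma> f \<Lambda> \<longleftrightarrow>
     \<Lambda> nicely_meromorphic_on UNIV \<and>
     (\<exists>as cs \<Lambda>\<^sub>0 \<Lambda>\<^sub>1 I.
        pole_splitting f as cs \<and>
        \<Lambda>\<^sub>0 meromorphic_on UNIV \<and>
        (\<exists>M :: real. \<forall>s. Re s > M \<longrightarrow>
           has_reg_integral_zero \<sigma> (mellin_integrand f s) (hd as) (\<Lambda>\<^sub>0 s)) \<and>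
        \<Lambda>\<^sub>1 meromorphic_on UNIV \<and>
        (\<exists>M :: real. \<forall>s. Re s < M \<longrightarrow>
           has_reg_integral_inf \<sigma> (mellin_integrand f s) (last as) (\<Lambda>\<^sub>1 s)) \<and>
        (\<forall>j<length cs. \<forall>s.
           has_reg_integral_pole (mellin_integrand f s) (as ! j) (as ! Suc j) (cs ! j) (I j s)) \<and>
        (\<forall>\<^sub>\<approx>s. \<Lambda> s = \<Lambda>\<^sub>0 s + (\<Sum>j<length cs. I j s) + \<Lambda>\<^sub>1 s))"

text \<open>
  Being nicely meromorphic (value \<open>0\<close> at poles, no removable singularities) singles out one
  representative of the meromorphic function \<open>\<Lambda>(f,s)\<close>.
\<close>
definition complete_L :: "real \<Rightarrow> (complex \<Rightarrow> complex) \<Rightarrow> complex \<Rightarrow> complex" where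
  "complete_L \<sigma> f = (THE \<Lambda>. is_complete_L \<sigma> f \<Lambda>)"

definition dirichlet_L :: "real \<Rightarrow> (complex \<Rightarrow> complex) \<Rightarrow> complex \<Rightarrow> complex" where
  "dirichlet_L \<sigma> f s = of_real (2 * pi) powr s / Gamma s * complete_L \<sigma> f s"

end

theory Submission
  imports Defs
begin

text \<open>
  Since \<open>D f (\<i> t) = - (1 / 2 \<pi>) d/dt f (\<i> t)\<close>, the relation between the \<open>L\<close>-functions of \<open>D f\<close> and of
  \<open>f\<close> is integration by parts in every regularized piece of the Mellin integral. It can be
  carried out once the pieces are known to exist, to be unique and to depend meromorphically on \<open>s\<close>.

  Near \<open>\<infinity>\<close>, the Laplace integral is continued by turning the ray of integration: on a vertical line
  the \<open>q\<close>-expansion is bounded, so the integral along the vertical ray converges for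
  \<open>\<sigma> Im w > 0\<close>. Its value at \<open>w = 0\<close> is continued in \<open>s\<close> term by term, by turning the ray once more
  until the exponentially growing terms decay. The piece at \<open>0\<close> has the same shape, by the
  transformation law for \<open>\<tau> \<mapsto> - 1 / \<tau>\<close>. Across a pole, the regularized integral is the mean of the
  contour integrals passing the pole on either side. A different splitting of \<open>(0, \<infinity>)\<close> changes
  neighbouring pieces by opposite ordinary integrals, so the sum does not depend on it.
\<close>

section \<open>Parameter integrals\<close>

text \<open>\<open>complete_L\<close> is a definite description, so nothing can be said about it
  before some \<open>\<Lambda>\<close> is shown to exist and to be the only one; most of the work
  goes into this. The argument runs in a class closed under \<open>D_op\<close>, the
  \<open>tame_form\<close>s, which keeps from quasi-modularity only the expansions of f (i t) and f
  (i / t) at infinity. A meromorphic f may have arbitrary values at removable singularities;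
  \<open>remove_sings\<close> repairs them, and the change is invisible because it affects only
  countably many points of the axis. The regularized integrals at 0 and at infinity need not exist
  for a common s. Hence every relation is proved piece by piece, in the half-plane of that piece,
  and continued in s before the pieces are added. Integration by parts at infinity presupposes a
  regularized integral of the derivative, which is why closure under \<open>D_op\<close> comes
  first. The identity itself is obtained for Re w large, where the Laplace integrals converge, and
  is carried to w = 0 by the identity theorem.\<close>

lemma holomorphic_integral_exp:
  fixes \<phi> \<psi> :: "real \<Rightarrow> complex"
  assumes "continuous_on {a..b} \<phi>" "continuous_on {a..b} \<psi>"
  shows "(\<lambda>p. integral {a..b} (\<lambda>t. exp (p * \<phi> t) * \<psi> t)) holomorphic_on UNIV"
proof -
  have c: "continuous_on (UNIV \<times> {a..b}) (\<lambda>(x, t). \<phi> t * exp (x * \<phi> t) * \<psi> t)"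
    unfolding case_prod_unfold
    by (intro continuous_intros continuous_on_compose2[OF assms(1)]
        continuous_on_compose2[OF assms(2)]) auto
  have "(\<lambda>p. integral (cbox a b) (\<lambda>t. exp (p * \<phi> t) * \<psi> t)) holomorphic_on UNIV"
  proof (rule leibniz_rule_holomorphic[where fx = "\<lambda>x t. \<phi> t * exp (x * \<phi> t) * \<psi> t"])
    show "((\<lambda>x. exp (x * \<phi> t) * \<psi> t) has_field_derivative \<phi> t * exp (x * \<phi> t) * \<psi> t)
        (at x within UNIV)" for x t
      by (auto intro!: derivative_eq_intros)
    show "(\<lambda>t. exp (p * \<phi> t) * \<psi> t) integrable_on cbox a b" for p
      unfolding cbox_interval using assms
      by (intro integrable_continuous_interval continuous_intros)
  qed (use c in auto)
  then show ?thesis by (simp add: cbox_interval)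
qed

text \<open>Dominated convergence for the truncated integrands. It also supplies integrability on
  the half-line from integrability on compact intervals.\<close>

lemma integral_truncation_tendsto:
  fixes F :: "real \<Rightarrow> 'a :: euclidean_space"
  assumes loc: "\<And>n :: nat. F integrable_on {a..a + real n}"
    and b: "b integrable_on {a..}" and bd: "\<And>t. t \<ge> a \<Longrightarrow> norm (F t) \<le> b t"
  shows "F integrable_on {a..}"
    and "(\<lambda>n. integral {a..a + real n} F) \<longlonglongrightarrow> integral {a..} F"
proof -
  define f where "f = (\<lambda>(n :: nat) t. if t \<in> {a..a + real n} then F t else 0)"
  have i: "f n integrable_on {a..}" for n
  proof -
    have "{a..a + real n} \<inter> {a..} = {a..a + real n}" by auto
    then show ?thesis unfolding f_def by (subst integrable_restrict_Int) (simp add: loc)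
  qed
  have ii: "integral {a..} (f n) = integral {a..a + real n} F" for n
  proof -
    have "{a..a + real n} \<inter> {a..} = {a..a + real n}" by auto
    then show ?thesis unfolding f_def by (subst integral_restrict_Int) simp
  qed
  have le: "norm (f n t) \<le> b t" if "t \<in> {a..}" for n t
    using bd[of t] that norm_ge_zero[of "F t"] by (auto simp: f_def simp del: norm_ge_zero)
  have conv: "(\<lambda>n. f n t) \<longlonglongrightarrow> F t" if "t \<in> {a..}" for t
  proof (rule tendsto_eventually)
    have "\<forall>\<^sub>F n in sequentially. t \<le> a + real n"
      using filterlim_real_sequentially unfolding filterlim_at_top
      by (rule allE[of _ "t - a"]) (auto elim!: eventually_mono)
    then show "\<forall>\<^sub>F n in sequentially. f n t = F t"
      by eventually_elim (use that in \<open>auto simp: f_def\<close>)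
  qed
  note dc = dominated_convergence[OF i b le conv]
  from dc(1) show "F integrable_on {a..}" .
  from dc(2) show "(\<lambda>n. integral {a..a + real n} F) \<longlonglongrightarrow> integral {a..} F"
    by (simp add: ii)
qed

lemma norm_integral_tail_le:
  fixes F :: "real \<Rightarrow> complex"
  assumes F: "F integrable_on {a..}" and b: "b integrable_on {a..}"
    and bd: "\<And>t. t \<ge> a \<Longrightarrow> norm (F t) \<le> b t"
    and locF: "F integrable_on {a..a + real n}" and locb: "b integrable_on {a..a + real n}"
  shows "norm (integral {a..} F - integral {a..a + real n} F)
      \<le> integral {a..} b - integral {a..a + real n} b"
proof -
  define Fn where "Fn = (\<lambda>t. if t \<in> {a..a + real n} then F t else 0)"
  define bn where "bn = (\<lambda>t. if t \<in> {a..a + real n} then b t else 0)"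
  have e: "{a..a + real n} \<inter> {a..} = {a..a + real n}" by auto
  have iF: "Fn integrable_on {a..}" "integral {a..} Fn = integral {a..a + real n} F"
    unfolding Fn_def by (subst integrable_restrict_Int integral_restrict_Int, simp add: locF e)+
  have ib: "bn integrable_on {a..}" "integral {a..} bn = integral {a..a + real n} b"
    unfolding bn_def by (subst integrable_restrict_Int integral_restrict_Int, simp add: locb e)+
  have "norm (integral {a..} (\<lambda>t. F t - Fn t)) \<le> integral {a..} (\<lambda>t. b t - bn t)"
    by (intro integral_norm_bound_integral integrable_diff F b iF ib)
       (use bd in \<open>auto simp: Fn_def bn_def\<close>)
  then show ?thesis
    using F b iF ib by (simp add: integral_diff)
qed

text \<open>The error of the truncation is at most the tail of \<open>b\<close>, which is the same
  for all parameters.\<close>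

lemma uniform_limit_integral_truncation:
  fixes F :: "'p \<Rightarrow> real \<Rightarrow> complex"
  assumes cF: "\<And>p. p \<in> S \<Longrightarrow> continuous_on {a..} (F p)" and cb: "continuous_on {a..} b"
    and b: "b integrable_on {a..}" and bd: "\<And>p t. p \<in> S \<Longrightarrow> t \<ge> a \<Longrightarrow> norm (F p t) \<le> b t"
  shows "uniform_limit S (\<lambda>n p. integral {a..a + real n} (F p)) (\<lambda>p. integral {a..} (F p))
     sequentially"
proof (rule uniform_limitI)
  fix e :: real assume "e > 0"
  have locb: "b integrable_on {a..a + real n}" for n
    by (intro integrable_continuous_interval continuous_on_subset[OF cb]) auto
  show "\<forall>\<^sub>F n in sequentially. \<forall>p\<in>S. dist (integral {a..a + real n} (F p)) (integral {a..} (F p)) < e"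
  proof (cases "S = {}")
    case False
    then obtain p0 where "p0 \<in> S" by auto
    have nb: "norm (b t) \<le> b t" if "t \<ge> a" for t
      using bd[OF \<open>p0 \<in> S\<close> that] norm_ge_zero[of "F p0 t"]
      by (simp del: norm_ge_zero)
    have "(\<lambda>n. integral {a..a + real n} b) \<longlonglongrightarrow> integral {a..} b"
      by (rule integral_truncation_tendsto(2)[OF locb b nb])
    then have "\<forall>\<^sub>F n in sequentially. dist (integral {a..a + real n} b) (integral {a..} b) < e"
      using \<open>e > 0\<close> by (rule tendstoD)
    then show ?thesis
    proof eventually_elim
      case (elim n)
      show ?case
      proof
        fix p assume p: "p \<in> S"
        have locF: "F p integrable_on {a..a + real n}" for n
          by (intro integrable_continuous_interval continuous_on_subset[OF cF[OF p]]) auto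
        have "norm (integral {a..} (F p) - integral {a..a + real n} (F p))
            \<le> integral {a..} b - integral {a..a + real n} b"
          by (intro norm_integral_tail_le integral_truncation_tendsto(1)[OF locF b] bd p b locF locb)
        with elim show "dist (integral {a..a + real n} (F p)) (integral {a..} (F p)) < e"
          by (simp add: dist_norm norm_minus_commute abs_if split: if_splits)
      qed
    qed
  qed auto
qed

text \<open>Meant for a closed half-disc \<open>S\<close>: it gives the limit of a Laplace integral
  at the boundary point w = 0 of its half-plane of holomorphy.\<close>

lemma continuous_on_integral_exp_to_inf:
  fixes \<phi> \<psi> :: "real \<Rightarrow> complex"
  assumes c: "continuous_on {a..} \<phi>" "continuous_on {a..} \<psi>" and cb: "continuous_on {a..} b"
    and b: "b integrable_on {a..}"
    and bd: "\<And>p t. p \<in> S \<Longrightarrow> t \<ge> a \<Longrightarrow> norm (exp (p * \<phi> t) * \<psi> t) \<le> b t"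
  shows "continuous_on S (\<lambda>p. integral {a..} (\<lambda>t. exp (p * \<phi> t) * \<psi> t))"
proof -
  have "uniform_limit S (\<lambda>n p. integral {a..a + real n} (\<lambda>t. exp (p * \<phi> t) * \<psi> t))
     (\<lambda>p. integral {a..} (\<lambda>t. exp (p * \<phi> t) * \<psi> t)) sequentially"
    by (intro uniform_limit_integral_truncation[OF _ cb b] bd) (auto intro!: continuous_intros c)
  moreover have "continuous_on S (\<lambda>p. integral {a..a + real n} (\<lambda>t. exp (p * \<phi> t) * \<psi> t))" for n
    by (rule continuous_on_subset[OF holomorphic_on_imp_continuous_on[OF holomorphic_integral_exp]])
       (auto intro!: continuous_on_subset[OF c(1)] continuous_on_subset[OF c(2)])
  ultimately show ?thesis
    by (intro uniform_limit_theorem[where F = sequentially]) auto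
qed

text \<open>The kernel exp (p \<phi>) \<psi> covers both the Laplace weight exp (- w t) and the
  Mellin weight t powr (s - 1) = exp (s Ln t) / t. The dominating function may depend on a bound
  \<open>K\<close> for the parameter, since the powers of t have no common one.\<close>

lemma holomorphic_integral_exp_to_inf:
  fixes \<phi> \<psi> :: "real \<Rightarrow> complex"
  assumes c: "continuous_on {a..} \<phi>" "continuous_on {a..} \<psi>" and S: "open S"
    and dom: "\<And>K. \<exists>b. continuous_on {a..} b \<and> b integrable_on {a..} \<and>
       (\<forall>p t. p \<in> S \<longrightarrow> norm p < K \<longrightarrow> t \<ge> a \<longrightarrow> norm (exp (p * \<phi> t) * \<psi> t) \<le> b t)"
  shows "(\<lambda>p. integral {a..} (\<lambda>t. exp (p * \<phi> t) * \<psi> t)) holomorphic_on S"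
proof (rule holomorphic_uniform_sequence[OF S])
  show "(\<lambda>p. integral {a..a + real n} (\<lambda>t. exp (p * \<phi> t) * \<psi> t)) holomorphic_on S" for n
    by (rule holomorphic_on_subset[OF holomorphic_integral_exp])
       (auto intro!: continuous_on_subset[OF c(1)] continuous_on_subset[OF c(2)])
  fix x assume x: "x \<in> S"
  then obtain d where d: "d > 0" "cball x d \<subseteq> S"
    using S open_contains_cball by blast
  obtain b where b: "continuous_on {a..} b" "b integrable_on {a..}"
    "\<And>p t. p \<in> S \<Longrightarrow> norm p < norm x + d + 1 \<Longrightarrow> t \<ge> a \<Longrightarrow> norm (exp (p * \<phi> t) * \<psi> t) \<le> b t"
    using dom[of "norm x + d + 1"] by blast
  have np: "norm p < norm x + d + 1" if "p \<in> cball x d" for p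
    using that norm_triangle_ineq2[of p x] by (simp add: dist_norm norm_minus_commute)
  have "uniform_limit (cball x d) (\<lambda>n p. integral {a..a + real n} (\<lambda>t. exp (p * \<phi> t) * \<psi> t))
     (\<lambda>p. integral {a..} (\<lambda>t. exp (p * \<phi> t) * \<psi> t)) sequentially"
    by (intro uniform_limit_integral_truncation[OF _ b(1,2)] b(3) np)
       (use d in \<open>auto intro!: continuous_intros c\<close>)
  with d show "\<exists>d>0. cball x d \<subseteq> S \<and>
      uniform_limit (cball x d) (\<lambda>n p. integral {a..a + real n} (\<lambda>t. exp (p * \<phi> t) * \<psi> t))
     (\<lambda>p. integral {a..} (\<lambda>t. exp (p * \<phi> t) * \<psi> t)) sequentially"
    by blast
qed

text \<open>On the convex set \<open>\<Omega>\<close> the integrand has a primitive H, and each ray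
  integral is a limit of H along its ray minus H (t0). The points with parameter n on the two rays
  are joined by a segment of length n |\<alpha> - \<beta>| on which the integrand is O(n powr (- 1 -
  \<delta>)), so the two limits coincide.\<close>

lemma ray_rotation:
  fixes h :: "complex \<Rightarrow> complex" and t\<^sub>0 \<delta> :: real
  assumes t0: "t\<^sub>0 > 0" and del: "\<delta> > 0"
    and hol: "h holomorphic_on \<Omega>" and \<Omega>: "open \<Omega>" "convex \<Omega>"
    and cone: "\<And>x y. x \<ge> 0 \<Longrightarrow> y \<ge> 0 \<Longrightarrow> of_real t\<^sub>0 + of_real x * \<alpha> + of_real y * \<beta> \<in> \<Omega>"
    and bd: "\<And>x y. x \<ge> 0 \<Longrightarrow> y \<ge> 0 \<Longrightarrow>
       norm (h (of_real t\<^sub>0 + of_real x * \<alpha> + of_real y * \<beta>)) \<le> B * (t\<^sub>0 + x + y) powr (- 1 - \<delta>)"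
  shows "\<alpha> * integral {t\<^sub>0..} (\<lambda>t. h (of_real t\<^sub>0 + of_real (t - t\<^sub>0) * \<alpha>)) =
         \<beta> * integral {t\<^sub>0..} (\<lambda>t. h (of_real t\<^sub>0 + of_real (t - t\<^sub>0) * \<beta>))"
proof -
  obtain H where H: "\<And>z. z \<in> \<Omega> \<Longrightarrow> (H has_field_derivative h z) (at z)"
    using holomorphic_convex_primitive'[OF \<Omega>(2,1) hol] \<Omega>(1) by (metis at_within_open)
  have ib: "(\<lambda>t. B * t powr (- 1 - \<delta>)) integrable_on {t\<^sub>0..}"
    by (rule has_integral_integrable, rule has_integral_mult_right, rule has_integral_powr_to_inf)
       (use t0 del in auto)
  have ray: "(\<lambda>n. H (of_real t\<^sub>0 + of_nat n * \<gamma>)) \<longlonglongrightarrow> H (of_real t\<^sub>0) +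
      \<gamma> * integral {t\<^sub>0..} (\<lambda>t. h (of_real t\<^sub>0 + of_real (t - t\<^sub>0) * \<gamma>))"
    if m: "\<And>x. x \<ge> 0 \<Longrightarrow> of_real t\<^sub>0 + of_real x * \<gamma> \<in> \<Omega>"
     and n: "\<And>x. x \<ge> 0 \<Longrightarrow> norm (h (of_real t\<^sub>0 + of_real x * \<gamma>)) \<le> B * (t\<^sub>0 + x) powr (- 1 - \<delta>)"
    for \<gamma>
  proof -
    have ch: "continuous_on {t\<^sub>0..} (\<lambda>t. h (of_real t\<^sub>0 + of_real (t - t\<^sub>0) * \<gamma>))"
      by (rule continuous_on_compose2[OF holomorphic_on_imp_continuous_on[OF hol]])
         (auto intro!: continuous_intros m simp flip: of_real_diff)
    have I: "((\<lambda>t. \<gamma> * h (of_real t\<^sub>0 + of_real (t - t\<^sub>0) * \<gamma>)) has_integral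
        (H (of_real t\<^sub>0 + of_real (t\<^sub>0 + real k - t\<^sub>0) * \<gamma>) - H (of_real t\<^sub>0 + of_real (t\<^sub>0 - t\<^sub>0) * \<gamma>)))
        {t\<^sub>0..t\<^sub>0 + real k}" for k
    proof (rule fundamental_theorem_of_calculus)
      fix t assume "t \<in> {t\<^sub>0..t\<^sub>0 + real k}"
      then have "(H has_field_derivative h (of_real t\<^sub>0 + of_real (t - t\<^sub>0) * \<gamma>))
          (at (of_real t\<^sub>0 + of_real (t - t\<^sub>0) * \<gamma>))"
        by (intro H m) auto
      then have d: "(H has_field_derivative h (of_real t\<^sub>0 + of_real (t - t\<^sub>0) * \<gamma>))
          (at (of_real t\<^sub>0 + of_real (t - t\<^sub>0) * \<gamma>) within X)" for X
        by (rule has_field_derivative_at_within)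
      have v: "((\<lambda>t. of_real t\<^sub>0 + of_real (t - t\<^sub>0) * \<gamma>) has_vector_derivative \<gamma>)
          (at t within {t\<^sub>0..t\<^sub>0 + real k})"
        by (rule has_vector_derivative_real_field | rule derivative_eq_intros refl | simp)+
      from field_vector_diff_chain_within[OF v d]
      have "((H \<circ> (\<lambda>t. of_real t\<^sub>0 + of_real (t - t\<^sub>0) * \<gamma>)) has_vector_derivative
          \<gamma> * h (of_real t\<^sub>0 + of_real (t - t\<^sub>0) * \<gamma>)) (at t within {t\<^sub>0..t\<^sub>0 + real k})" .
      then show "((\<lambda>t. H (of_real t\<^sub>0 + of_real (t - t\<^sub>0) * \<gamma>)) has_vector_derivative
          \<gamma> * h (of_real t\<^sub>0 + of_real (t - t\<^sub>0) * \<gamma>)) (at t within {t\<^sub>0..t\<^sub>0 + real k})"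
        by (simp add: o_def)
    qed auto
    have e: "H (of_real t\<^sub>0 + of_nat k * \<gamma>) = H (of_real t\<^sub>0) +
       \<gamma> * integral {t\<^sub>0..t\<^sub>0 + real k} (\<lambda>t. h (of_real t\<^sub>0 + of_real (t - t\<^sub>0) * \<gamma>))" for k
      using integral_unique[OF I[of k]] by (simp add: algebra_simps)
    have "(\<lambda>k. integral {t\<^sub>0..t\<^sub>0 + real k} (\<lambda>t. h (of_real t\<^sub>0 + of_real (t - t\<^sub>0) * \<gamma>))) \<longlonglongrightarrow>
        integral {t\<^sub>0..} (\<lambda>t. h (of_real t\<^sub>0 + of_real (t - t\<^sub>0) * \<gamma>))"
    proof (rule integral_truncation_tendsto(2)[OF _ ib])
      show "(\<lambda>t. h (of_real t\<^sub>0 + of_real (t - t\<^sub>0) * \<gamma>)) integrable_on {t\<^sub>0..t\<^sub>0 + real k}" for k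
        by (intro integrable_continuous_interval continuous_on_subset[OF ch]) auto
      show "norm (h (of_real t\<^sub>0 + of_real (t - t\<^sub>0) * \<gamma>)) \<le> B * t powr (- 1 - \<delta>)" if "t \<ge> t\<^sub>0" for t
        using n[of "t - t\<^sub>0"] that by simp
    qed
    then show ?thesis unfolding e by (intro tendsto_intros)
  qed
  have A: "(\<lambda>n. H (of_real t\<^sub>0 + of_nat n * \<alpha>)) \<longlonglongrightarrow> H (of_real t\<^sub>0) +
      \<alpha> * integral {t\<^sub>0..} (\<lambda>t. h (of_real t\<^sub>0 + of_real (t - t\<^sub>0) * \<alpha>))"
    by (rule ray) (use cone[of _ 0] bd[of _ 0] in auto)
  have Bt: "(\<lambda>n. H (of_real t\<^sub>0 + of_nat n * \<beta>)) \<longlonglongrightarrow> H (of_real t\<^sub>0) +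
      \<beta> * integral {t\<^sub>0..} (\<lambda>t. h (of_real t\<^sub>0 + of_real (t - t\<^sub>0) * \<beta>))"
    by (rule ray) (use cone[of 0] bd[of 0] in auto)
  have B0: "B \<ge> 0"
  proof -
    have "0 \<le> B * (t\<^sub>0 + 0 + 0) powr (- 1 - \<delta>)"
      using bd[of 0 0] norm_ge_zero[of "h (of_real t\<^sub>0)"] by (simp del: norm_ge_zero)
    with t0 show ?thesis by (simp add: zero_le_mult_iff)
  qed
  have dist: "norm (H (of_real t\<^sub>0 + of_nat n * \<alpha>) - H (of_real t\<^sub>0 + of_nat n * \<beta>)) \<le>
      B * norm (\<alpha> - \<beta>) * (t\<^sub>0 + real n) powr (- \<delta>)" for n
  proof -
    have "norm (H (of_real t\<^sub>0 + of_nat n * \<alpha>) - H (of_real t\<^sub>0 + of_nat n * \<beta>)) \<le>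
       (B * (t\<^sub>0 + real n) powr (- 1 - \<delta>)) * norm ((of_real t\<^sub>0 + of_nat n * \<alpha>) - (of_real t\<^sub>0 + of_nat n * \<beta>))"
    proof (rule field_differentiable_bound[where S = "closed_segment (of_real t\<^sub>0 + of_nat n * \<beta>) (of_real t\<^sub>0 + of_nat n * \<alpha>)" and f' = h])
      fix z assume "z \<in> closed_segment (of_real t\<^sub>0 + of_nat n * \<beta>) (of_real t\<^sub>0 + of_nat n * \<alpha>)"
      then obtain u where u: "0 \<le> u" "u \<le> 1"
        "z = (1 - u) *\<^sub>R (of_real t\<^sub>0 + of_nat n * \<beta>) + u *\<^sub>R (of_real t\<^sub>0 + of_nat n * \<alpha>)"
        by (auto simp: closed_segment_def)
      \<comment> \<open>With x = u n and y = (1 - u) n the sum x + y equals n on the whole segment,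
        so a single bound for the integrand serves there.\<close>
      have z: "z = of_real t\<^sub>0 + of_real (u * real n) * \<alpha> + of_real ((1 - u) * real n) * \<beta>"
        unfolding u(3) by (simp add: scaleR_conv_of_real algebra_simps)
      have "norm (h z) \<le> B * (t\<^sub>0 + u * real n + (1 - u) * real n) powr (- 1 - \<delta>)"
        unfolding z by (rule bd) (use u in auto)
      moreover have "t\<^sub>0 + u * real n + (1 - u) * real n = t\<^sub>0 + real n" by (simp add: algebra_simps)
      ultimately show "norm (h z) \<le> B * (t\<^sub>0 + real n) powr (- 1 - \<delta>)"
        by (simp only:)
      show "(H has_field_derivative h z) (at z within closed_segment (of_real t\<^sub>0 + of_nat n * \<beta>) (of_real t\<^sub>0 + of_nat n * \<alpha>))"
        unfolding z by (rule has_field_derivative_at_within, rule H, rule cone) (use u in auto)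
    qed auto
    also have "norm ((of_real t\<^sub>0 + of_nat n * \<alpha>) - (of_real t\<^sub>0 + of_nat n * \<beta>)) = real n * norm (\<alpha> - \<beta>)"
      by (simp add: right_diff_distrib[symmetric] norm_mult)
    also have "(B * (t\<^sub>0 + real n) powr (- 1 - \<delta>)) * (real n * norm (\<alpha> - \<beta>)) \<le>
       (B * (t\<^sub>0 + real n) powr (- 1 - \<delta>)) * ((t\<^sub>0 + real n) * norm (\<alpha> - \<beta>))"
      using t0 B0 by (intro mult_left_mono mult_right_mono) auto
    also have "\<dots> = B * norm (\<alpha> - \<beta>) * ((t\<^sub>0 + real n) powr (- 1 - \<delta>) * (t\<^sub>0 + real n) powr 1)"
      using t0 by simp
    also have "\<dots> = B * norm (\<alpha> - \<beta>) * (t\<^sub>0 + real n) powr (- \<delta>)"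
      by (subst powr_add[symmetric]) simp
    finally show ?thesis .
  qed
  have "(\<lambda>n. (t\<^sub>0 + real n) powr (- \<delta>)) \<longlonglongrightarrow> 0"
    by (rule tendsto_neg_powr) (use del in \<open>auto intro!: filterlim_tendsto_add_at_top filterlim_real_sequentially\<close>)
  from tendsto_mult_left[OF this, of "B * norm (\<alpha> - \<beta>)"]
  have lim: "(\<lambda>n. B * norm (\<alpha> - \<beta>) * (t\<^sub>0 + real n) powr (- \<delta>)) \<longlonglongrightarrow> 0"
    by simp
  have "(\<lambda>n. H (of_real t\<^sub>0 + of_nat n * \<alpha>) - H (of_real t\<^sub>0 + of_nat n * \<beta>)) \<longlonglongrightarrow> 0"
    by (rule Lim_null_comparison[OF always_eventually lim]) (use dist in blast)
  from LIMSEQ_unique[OF this tendsto_diff[OF A Bt]] show ?thesis by simp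
qed

section \<open>Regularized integrals at infinity\<close>

lemma has_reg_integral_inf_cong:
  assumes "\<And>t. t \<ge> t\<^sub>0 \<Longrightarrow> g t = h t"
  shows "has_reg_integral_inf \<sigma> g t\<^sub>0 v \<longleftrightarrow> has_reg_integral_inf \<sigma> h t\<^sub>0 v"
proof -
  have "((\<lambda>t. exp (- w * of_real t) * g t) has_integral I) {t\<^sub>0..} \<longleftrightarrow>
        ((\<lambda>t. exp (- w * of_real t) * h t) has_integral I) {t\<^sub>0..}" for w I
    by (rule has_integral_cong) (use assms in auto)
  then show ?thesis unfolding has_reg_integral_inf_def by simp
qed

lemma has_reg_integral_inf_add:
  assumes "has_reg_integral_inf \<sigma> g t\<^sub>0 v" "has_reg_integral_inf \<sigma> h t\<^sub>0 u"
  shows "has_reg_integral_inf \<sigma> (\<lambda>t. g t + h t) t\<^sub>0 (v + u)"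
proof -
  from assms(1) obtain G C where G:
    "\<And>w. Re w > C \<Longrightarrow> ((\<lambda>t. exp (- w * of_real t) * g t) has_integral G w) {t\<^sub>0..}"
    "G holomorphic_on {w. Re w > C \<or> \<sigma> * Im w > 0}" "(G \<longlongrightarrow> v) (at 0 within {w. \<sigma> * Im w > 0})"
    unfolding has_reg_integral_inf_def by blast
  from assms(2) obtain H D where H:
    "\<And>w. Re w > D \<Longrightarrow> ((\<lambda>t. exp (- w * of_real t) * h t) has_integral H w) {t\<^sub>0..}"
    "H holomorphic_on {w. Re w > D \<or> \<sigma> * Im w > 0}" "(H \<longlongrightarrow> u) (at 0 within {w. \<sigma> * Im w > 0})"
    unfolding has_reg_integral_inf_def by blast
  show ?thesis unfolding has_reg_integral_inf_def
  proof (intro exI[of _ "\<lambda>w. G w + H w"] exI[of _ "max C D"] conjI allI impI)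
    fix w :: complex assume "Re w > max C D"
    then show "((\<lambda>t. exp (- w * of_real t) * (g t + h t)) has_integral G w + H w) {t\<^sub>0..}"
      using has_integral_add[OF G(1) H(1)] by (simp add: distrib_left)
  next
    show "(\<lambda>w. G w + H w) holomorphic_on {w. Re w > max C D \<or> \<sigma> * Im w > 0}"
      by (intro holomorphic_intros holomorphic_on_subset[OF G(2)] holomorphic_on_subset[OF H(2)]) auto
  qed (intro tendsto_add G H)
qed

lemma has_reg_integral_inf_cmult:
  assumes "has_reg_integral_inf \<sigma> g t\<^sub>0 v"
  shows "has_reg_integral_inf \<sigma> (\<lambda>t. c * g t) t\<^sub>0 (c * v)"
proof -
  from assms(1) obtain G C where G:
    "\<And>w. Re w > C \<Longrightarrow> ((\<lambda>t. exp (- w * of_real t) * g t) has_integral G w) {t\<^sub>0..}"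
    "G holomorphic_on {w. Re w > C \<or> \<sigma> * Im w > 0}" "(G \<longlongrightarrow> v) (at 0 within {w. \<sigma> * Im w > 0})"
    unfolding has_reg_integral_inf_def by blast
  show ?thesis unfolding has_reg_integral_inf_def
  proof (intro exI[of _ "\<lambda>w. c * G w"] exI[of _ C] conjI allI impI)
    fix w :: complex assume "Re w > C"
    then show "((\<lambda>t. exp (- w * of_real t) * (c * g t)) has_integral c * G w) {t\<^sub>0..}"
      using has_integral_mult_right[OF G(1), of w c] by (simp add: mult_ac)
  qed (intro holomorphic_intros G tendsto_mult tendsto_const)+
qed

lemma connected_reg_domain:
  assumes "\<sigma> \<in> {1, -1 :: real}"
  shows "connected {w. Re w > C \<or> \<sigma> * Im w > 0}" "open {w. Re w > C \<or> \<sigma> * Im w > 0}"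
proof -
  have e: "{w. Re w > C \<or> \<sigma> * Im w > 0} = {w. Re w > C} \<union> {w. \<sigma> * Im w > 0}" by auto
  have c: "convex {w. Re w > C}" "convex {w. \<sigma> * Im w > 0}"
    using assms convex_halfspace_Im_gt[of 0] convex_halfspace_Im_lt[of 0]
    by (auto simp: convex_halfspace_Re_gt)
  have "Complex (C + 1) \<sigma> \<in> {w. Re w > C} \<inter> {w. \<sigma> * Im w > 0}" using assms by auto
  then show "connected {w. Re w > C \<or> \<sigma> * Im w > 0}"
    unfolding e by (intro connected_Un convex_connected c) blast
  show "open {w. Re w > C \<or> \<sigma> * Im w > 0}"
    unfolding e by (intro open_Un open_Collect_less continuous_intros)
qed

lemma reg_domain_nontrivial:
  assumes "\<sigma> \<in> {1, -1 :: real}"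
  shows "at 0 within {w. \<sigma> * Im w > 0} \<noteq> (bot :: complex filter)"
proof -
  have "(0 :: complex) islimpt {w. \<sigma> * Im w > 0}"
    unfolding islimpt_approachable
  proof (intro allI impI)
    fix e :: real assume "e > 0"
    then show "\<exists>x'\<in>{w. \<sigma> * Im w > 0}. x' \<noteq> 0 \<and> dist x' 0 < e"
      using assms by (intro bexI[of _ "Complex 0 (\<sigma> * e / 2)"]) (auto simp: complex_eq_iff cmod_def)
  qed
  then show ?thesis by (simp add: trivial_limit_within)
qed

text \<open>The two half-planes overlap, so their union is connected and the identity theorem
  applies. This is how facts about convergent Laplace integrals reach the half-plane that touches w
  = 0.\<close>

lemma reg_domain_identity:
  assumes "\<sigma> \<in> {1, -1 :: real}" and G: "G holomorphic_on {w. Re w > C \<or> \<sigma> * Im w > 0}"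
    and 0: "\<And>w. Re w > C' \<Longrightarrow> G w = 0" and w: "\<sigma> * Im w > 0"
  shows "G w = 0"
proof (rule analytic_continuation_open[where s = "{w. Re w > max C C'}" and
      s' = "{w. Re w > C \<or> \<sigma> * Im w > 0}" and f = G and g = "\<lambda>_. 0"])
  show "{w. Re w > max C C'} \<noteq> {}"
  proof -
    have "of_real (max C C' + 1) \<in> {w. Re w > max C C'}" by (auto simp: max_def)
    then show ?thesis by blast
  qed
  show "open {w. Re w > max C C'}" by (intro open_Collect_less continuous_intros)
qed (use assms connected_reg_domain[OF assms(1)] in auto)

lemma has_reg_integral_inf_unique:
  assumes \<sigma>: "\<sigma> \<in> {1, -1}"
    and "has_reg_integral_inf \<sigma> g t\<^sub>0 v" "has_reg_integral_inf \<sigma> g t\<^sub>0 u"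
  shows "v = u"
proof -
  from assms(2) obtain G C where G:
    "\<And>w. Re w > C \<Longrightarrow> ((\<lambda>t. exp (- w * of_real t) * g t) has_integral G w) {t\<^sub>0..}"
    "G holomorphic_on {w. Re w > C \<or> \<sigma> * Im w > 0}" "(G \<longlongrightarrow> v) (at 0 within {w. \<sigma> * Im w > 0})"
    unfolding has_reg_integral_inf_def by blast
  from assms(3) obtain H D where H:
    "\<And>w. Re w > D \<Longrightarrow> ((\<lambda>t. exp (- w * of_real t) * g t) has_integral H w) {t\<^sub>0..}"
    "H holomorphic_on {w. Re w > D \<or> \<sigma> * Im w > 0}" "(H \<longlongrightarrow> u) (at 0 within {w. \<sigma> * Im w > 0})"
    unfolding has_reg_integral_inf_def by blast
  have "G w - H w = 0" if "\<sigma> * Im w > 0" for w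
  proof (rule reg_domain_identity[OF \<sigma> _ _ that])
    show "(\<lambda>w. G w - H w) holomorphic_on {w. Re w > max C D \<or> \<sigma> * Im w > 0}"
      by (intro holomorphic_intros holomorphic_on_subset[OF G(2)] holomorphic_on_subset[OF H(2)]) auto
    show "G w - H w = 0" if "Re w > max C D" for w
      using has_integral_unique[OF G(1) H(1)] that by simp
  qed
  then have "\<forall>\<^sub>F w in at 0 within {w. \<sigma> * Im w > 0}. G w - H w = 0"
    by (auto simp: eventually_at_filter intro!: always_eventually)
  from tendsto_cong[OF this] tendsto_diff[OF G(3) H(3)]
  have "((\<lambda>_. 0) \<longlongrightarrow> v - u) (at 0 within {w. \<sigma> * Im w > 0})" by simp
  from tendsto_unique[OF reg_domain_nontrivial[OF \<sigma>] this tendsto_const] show ?thesis by simp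
qed

text \<open>A compact interval contributes an entire function of w, whose value at w = 0 is the
  ordinary integral.\<close>

lemma has_reg_integral_inf_extend:
  assumes g: "has_reg_integral_inf \<sigma> g T v" and c: "continuous_on {t\<^sub>0..T} g" and le: "t\<^sub>0 \<le> T"
  shows "has_reg_integral_inf \<sigma> g t\<^sub>0 (v + integral {t\<^sub>0..T} g)"
proof -
  from g obtain G C where G:
    "\<And>w. Re w > C \<Longrightarrow> ((\<lambda>t. exp (- w * of_real t) * g t) has_integral G w) {T..}"
    "G holomorphic_on {w. Re w > C \<or> \<sigma> * Im w > 0}" "(G \<longlongrightarrow> v) (at 0 within {w. \<sigma> * Im w > 0})"
    unfolding has_reg_integral_inf_def by blast
  define H where "H = (\<lambda>w. integral {t\<^sub>0..T} (\<lambda>t. exp (w * - of_real t) * g t))"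
  have H: "H holomorphic_on UNIV"
    unfolding H_def by (intro holomorphic_integral_exp c continuous_intros)
  have H0: "H 0 = integral {t\<^sub>0..T} g" by (simp add: H_def)
  show ?thesis unfolding has_reg_integral_inf_def
  proof (intro exI[of _ "\<lambda>w. G w + H w"] exI[of _ C] conjI allI impI)
    fix w :: complex assume w: "Re w > C"
    have "(\<lambda>t. exp (w * - of_real t) * g t) integrable_on {t\<^sub>0..T}"
      by (intro integrable_continuous_interval continuous_intros c)
    then have "((\<lambda>t. exp (- w * of_real t) * g t) has_integral H w) {t\<^sub>0..T}"
      unfolding H_def by (simp add: has_integral_integral)
    from has_integral_Un[OF G(1)[OF w] this]
    have "((\<lambda>t. exp (- w * of_real t) * g t) has_integral G w + H w) ({T..} \<union> {t\<^sub>0..T})"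
      by (rule _) (rule negligible_subset[of "{T}"], auto)
    moreover have "{T..} \<union> {t\<^sub>0..T} = {t\<^sub>0..}" using le by auto
    ultimately show "((\<lambda>t. exp (- w * of_real t) * g t) has_integral G w + H w) {t\<^sub>0..}" by simp
  next
    show "(\<lambda>w. G w + H w) holomorphic_on {w. Re w > C \<or> \<sigma> * Im w > 0}"
      by (intro holomorphic_intros G holomorphic_on_subset[OF H]) auto
  next
    have "isCont H 0" using holomorphic_on_imp_continuous_on[OF H] by (simp add: continuous_on_eq_continuous_at)
    then have "(H \<longlongrightarrow> H 0) (at 0 within {w. \<sigma> * Im w > 0})"
      unfolding isCont_def by (rule tendsto_within_subset) auto
    then show "((\<lambda>w. G w + H w) \<longlongrightarrow> v + integral {t\<^sub>0..T} g) (at 0 within {w. \<sigma> * Im w > 0})"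
      unfolding H0 by (intro tendsto_add G)
  qed
qed

text \<open>The Laplace integrals are gauge integrals that may converge conditionally, so the limit
  is taken from the definition of the integral and not from dominated convergence.\<close>

lemma has_integral_to_inf_truncation:
  fixes f :: "real \<Rightarrow> complex"
  assumes "(f has_integral I) {a..}"
  shows "(\<lambda>n. integral {a..a + real n} f) \<longlonglongrightarrow> I"
proof (rule tendstoI)
  fix e :: real assume "e > 0"
  with assms obtain B where B: "B > 0" "\<And>c d. ball 0 B \<subseteq> cbox c d \<Longrightarrow>
     norm (integral (cbox c d) (\<lambda>x. if x \<in> {a..} then f x else 0) - I) < e"
    unfolding has_integral_alt' by blast
  have "\<forall>\<^sub>F n in sequentially. real n \<ge> B + \<bar>a\<bar>"
    using filterlim_real_sequentially unfolding filterlim_at_top by blast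
  then show "\<forall>\<^sub>F n in sequentially. dist (integral {a..a + real n} f) I < e"
  proof eventually_elim
    case (elim n)
    \<comment> \<open>The left end of the box is free; it is put to the left of a so that the box
      meets the half-line exactly in the truncated interval.\<close>
    have "ball 0 B \<subseteq> cbox (- (B + \<bar>a\<bar>)) (a + real n)"
      using elim B(1) by (auto simp: dist_real_def)
    from B(2)[OF this]
    have z: "norm (integral (cbox (- (B + \<bar>a\<bar>)) (a + real n)) (\<lambda>x. if x \<in> {a..} then f x else 0) - I) < e" .
    have "{a..} \<inter> cbox (- (B + \<bar>a\<bar>)) (a + real n) = {a..a + real n}"
      using B(1) by auto
    with z show ?case
      by (subst (asm) integral_restrict_Int) (simp add: dist_norm)
  qed
qed

text \<open>The product exp (- w t) g(t) t powr (s - 1) is differentiated. The exponential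
  contributes w times the Laplace integral of g(t) t powr (s - 1); this term disappears at w = 0,
  but the regularized integral \<open>v\<close> has to exist for it to have a limit.\<close>

lemma has_reg_integral_inf_by_parts:
  fixes g g' :: "real \<Rightarrow> complex"
  assumes \<sigma>: "\<sigma> \<in> {1, -1}" and t0: "t\<^sub>0 > 0"
    and der: "\<And>t. t \<ge> t\<^sub>0 \<Longrightarrow> (g has_vector_derivative g' t) (at t)"
    and v: "has_reg_integral_inf \<sigma> (\<lambda>t. g t * of_real t powr (s - 1)) t\<^sub>0 v"
    and v1: "has_reg_integral_inf \<sigma> (\<lambda>t. g t * of_real t powr (s - 2)) t\<^sub>0 v1"
    and v': "has_reg_integral_inf \<sigma> (\<lambda>t. g' t * of_real t powr (s - 1)) t\<^sub>0 v'"
  shows "v' = - g t\<^sub>0 * of_real t\<^sub>0 powr (s - 1) - (s - 1) * v1"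
proof -
  from v obtain G C where G:
    "\<And>w. Re w > C \<Longrightarrow> ((\<lambda>t. exp (- w * of_real t) * (g t * of_real t powr (s - 1))) has_integral G w) {t\<^sub>0..}"
    "G holomorphic_on {w. Re w > C \<or> \<sigma> * Im w > 0}" "(G \<longlongrightarrow> v) (at 0 within {w. \<sigma> * Im w > 0})"
    unfolding has_reg_integral_inf_def by blast
  from v1 obtain G1 C1 where G1:
    "\<And>w. Re w > C1 \<Longrightarrow> ((\<lambda>t. exp (- w * of_real t) * (g t * of_real t powr (s - 2))) has_integral G1 w) {t\<^sub>0..}"
    "G1 holomorphic_on {w. Re w > C1 \<or> \<sigma> * Im w > 0}" "(G1 \<longlongrightarrow> v1) (at 0 within {w. \<sigma> * Im w > 0})"
    unfolding has_reg_integral_inf_def by blast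
  from v' obtain G' C' where G':
    "\<And>w. Re w > C' \<Longrightarrow> ((\<lambda>t. exp (- w * of_real t) * (g' t * of_real t powr (s - 1))) has_integral G' w) {t\<^sub>0..}"
    "G' holomorphic_on {w. Re w > C' \<or> \<sigma> * Im w > 0}" "(G' \<longlongrightarrow> v') (at 0 within {w. \<sigma> * Im w > 0})"
    unfolding has_reg_integral_inf_def by blast
  define M where "M = max C (max C1 C')"
  define H where "H = (\<lambda>w t. exp (- w * of_real t) * (g t * of_real t powr (s - 1)))"
  \<comment> \<open>\<open>E w\<close> is the boundary value at infinity of the differentiated
    product, written in terms of the continued integrals. The claim is \<open>E 0 = 0\<close> in the
    limit.\<close>
  define E where "E = (\<lambda>w. H w t\<^sub>0 + (G' w + (s - 1) * G1 w - w * G w))"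
  have Hlim: "(\<lambda>n. H w (t\<^sub>0 + real n)) \<longlonglongrightarrow> E w" if w: "Re w > M" for w
  proof -
    define h where "h = (\<lambda>t. exp (- w * of_real t) * (g' t * of_real t powr (s - 1)) +
       (s - 1) * (exp (- w * of_real t) * (g t * of_real t powr (s - 2))) -
       w * (exp (- w * of_real t) * (g t * of_real t powr (s - 1))))"
    have "(h has_integral (G' w + (s - 1) * G1 w - w * G w)) {t\<^sub>0..}"
      unfolding h_def using w
      by (intro has_integral_diff has_integral_add has_integral_mult_right G G1 G') (auto simp: M_def)
    from has_integral_to_inf_truncation[OF this]
    have L: "(\<lambda>n. integral {t\<^sub>0..t\<^sub>0 + real n} h) \<longlonglongrightarrow> G' w + (s - 1) * G1 w - w * G w" .
    have I: "(h has_integral (H w (t\<^sub>0 + real n) - H w t\<^sub>0)) {t\<^sub>0..t\<^sub>0 + real n}" for n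
    proof (rule fundamental_theorem_of_calculus)
      fix t assume t: "t \<in> {t\<^sub>0..t\<^sub>0 + real n}"
      then have tp: "t > 0" using t0 by simp
      have e: "((\<lambda>t. exp (- w * of_real t)) has_vector_derivative (- w * exp (- w * of_real t))) (at t)"
      proof (rule has_vector_derivative_real_field)
        show "((\<lambda>z. exp (- w * z)) has_field_derivative - w * exp (- w * of_real t)) (at (of_real t))"
          by (auto intro!: derivative_eq_intros)
      qed
      have p: "((\<lambda>t. of_real t powr (s - 1)) has_vector_derivative ((s - 1) * of_real t powr (s - 2))) (at t)"
      proof (rule has_vector_derivative_real_field)
        show "((\<lambda>z. z powr (s - 1)) has_field_derivative (s - 1) * of_real t powr (s - 2)) (at (of_real t))"
          using tp by (auto intro!: derivative_eq_intros simp: diff_diff_eq)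
      qed
      have "(H w has_vector_derivative (exp (- w * of_real t) * (g t * ((s - 1) * of_real t powr (s - 2)) + g' t * of_real t powr (s - 1))
         + (- w * exp (- w * of_real t)) * (g t * of_real t powr (s - 1)))) (at t)"
        unfolding H_def
        by (intro has_vector_derivative_mult e p der) (use t in auto)
      from has_vector_derivative_at_within[OF this]
      show "(H w has_vector_derivative h t) (at t within {t\<^sub>0..t\<^sub>0 + real n})"
        by (rule has_vector_derivative_eq_rhs) (simp add: h_def algebra_simps)
    qed auto
    have "H w (t\<^sub>0 + real n) = H w t\<^sub>0 + integral {t\<^sub>0..t\<^sub>0 + real n} h" for n
      using integral_unique[OF I[of n]] by simp
    with tendsto_add[OF tendsto_const L, of "H w t\<^sub>0"] show ?thesis
      unfolding E_def by simp
  qed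
  \<comment> \<open>No growth bound on g is at hand. The boundary value exists already at w - 1, and
    passing to w multiplies by exp (- t), which forces the limit 0; hence the abscissa
    \<open>M + 1\<close>.\<close>
  have E0: "E w = 0" if w: "Re w > M + 1" for w
  proof -
    have "H w t = exp (- of_real t) * H (w - 1) t" for t
    proof -
      have "exp (- w * of_real t) = exp (- of_real t) * exp (- (w - 1) * of_real t)"
        by (simp add: algebra_simps flip: exp_add)
      then show ?thesis unfolding H_def by (simp only: mult.assoc)
    qed
    moreover have "(\<lambda>n. exp (- complex_of_real (t\<^sub>0 + real n)) * H (w - 1) (t\<^sub>0 + real n)) \<longlonglongrightarrow> 0 * E (w - 1)"
    proof (intro tendsto_mult Hlim)
      have "(\<lambda>n. exp (- (t\<^sub>0 + real n))) \<longlonglongrightarrow> 0"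
        by (rule filterlim_compose[OF exp_at_bot filterlim_compose[OF filterlim_uminus_at_bot_at_top
                 filterlim_tendsto_add_at_top[OF tendsto_const filterlim_real_sequentially]]])
      then have "(\<lambda>n. complex_of_real (exp (- (t\<^sub>0 + real n)))) \<longlonglongrightarrow> of_real 0" by (rule tendsto_of_real)
      moreover have "exp (- complex_of_real (t\<^sub>0 + real n)) = of_real (exp (- (t\<^sub>0 + real n)))" for n
        by (metis exp_of_real of_real_minus)
      ultimately show "(\<lambda>n. exp (- complex_of_real (t\<^sub>0 + real n))) \<longlonglongrightarrow> 0"
        by (simp only: of_real_0)
    qed (use w in simp)
    ultimately have "(\<lambda>n. H w (t\<^sub>0 + real n)) \<longlonglongrightarrow> 0" by simp
    with Hlim[of w] w show ?thesis using LIMSEQ_unique by force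
  qed
  have "E w = 0" if "\<sigma> * Im w > 0" for w
  proof (rule reg_domain_identity[OF \<sigma> _ E0 that])
    show "E holomorphic_on {w. Re w > M \<or> \<sigma> * Im w > 0}"
      unfolding E_def H_def
      by (intro holomorphic_intros holomorphic_on_subset[OF G(2)]
         holomorphic_on_subset[OF G1(2)] holomorphic_on_subset[OF G'(2)]) (auto simp: M_def)
  qed
  then have ev: "\<forall>\<^sub>F w in at 0 within {w. \<sigma> * Im w > 0}. E w = 0"
    by (auto simp: eventually_at_filter intro!: always_eventually)
  have "(E \<longlongrightarrow> H 0 t\<^sub>0 + (v' + (s - 1) * v1 - 0 * v)) (at 0 within {w. \<sigma> * Im w > 0})"
    unfolding E_def H_def by (intro tendsto_intros G G1 G')
  then have "((\<lambda>_. 0) \<longlongrightarrow> H 0 t\<^sub>0 + (v' + (s - 1) * v1 - 0 * v)) (at 0 within {w. \<sigma> * Im w > 0})"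
    by (rule iffD1[OF tendsto_cong[OF ev]])
  from tendsto_unique[OF reg_domain_nontrivial[OF \<sigma>] this tendsto_const]
  show ?thesis by (simp add: H_def algebra_simps add_eq_0_iff)
qed

section \<open>Growth of complex powers and the Laplace integral on the vertical ray\<close>

lemma norm_powr_le:
  assumes "z \<noteq> 0"
  shows "norm (z powr s) \<le> norm z powr Re s * exp (pi * \<bar>Im s\<bar>)"
proof -
  have "\<bar>Im s * Im (Ln z)\<bar> \<le> \<bar>Im s\<bar> * pi"
    unfolding abs_mult using mpi_less_Im_Ln[OF assms] Im_Ln_le_pi[OF assms]
    by (intro mult_left_mono) auto
  then have "exp (Re s * ln (norm z) - Im s * Im (Ln z)) \<le> exp (Re s * ln (norm z) + pi * \<bar>Im s\<bar>)"
    by (simp add: mult.commute abs_le_iff)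
  also have "\<dots> = norm z powr Re s * exp (pi * \<bar>Im s\<bar>)"
    using assms by (simp add: exp_add powr_def)
  finally show ?thesis using assms by (simp add: powr_def)
qed

text \<open>The third comes from the cone between the vertical and the diagonal ray used for growing
  exponentials: there t0 + x + y is the sum of t0 - y, x + y and y, each at most |z|.\<close>

lemma norm_powr_le_decay:
  fixes s :: complex
  assumes "x > 0" "norm z \<ge> x / 3" "Re s \<le> 0"
  shows "norm (z powr s) \<le> 3 powr (- Re s) * exp (pi * \<bar>Im s\<bar>) * x powr Re s"
proof -
  have "z \<noteq> 0" using assms by auto
  have "norm z powr Re s \<le> (x / 3) powr Re s"
    using assms powr_mono2'[of "Re s" "x / 3" "norm z"] by simp
  also have "\<dots> = 3 powr (- Re s) * x powr Re s"
    using assms by (simp add: powr_divide powr_minus_divide)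
  finally have "norm z powr Re s * exp (pi * \<bar>Im s\<bar>) \<le> 3 powr (- Re s) * x powr Re s * exp (pi * \<bar>Im s\<bar>)"
    by (rule mult_right_mono) simp
  from order_trans[OF norm_powr_le[OF \<open>z \<noteq> 0\<close>, of s] this] show ?thesis by (simp only: mult_ac)
qed

lemma powr_integrable_to_inf:
  assumes "t\<^sub>0 > 0" "e < -1"
  shows "(\<lambda>t::real. B * t powr e) integrable_on {t\<^sub>0..}"
  by (rule has_integral_integrable, rule has_integral_mult_right, rule has_integral_powr_to_inf)
     (use assms in auto)

lemma exp_integrable_to_inf:
  assumes "d > 0"
  shows "(\<lambda>t::real. B * exp (- d * t)) integrable_on {t\<^sub>0..}"
  by (rule has_integral_integrable, rule has_integral_mult_right, rule has_integral_exp_minus_to_infinity)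
     (use assms in auto)

text \<open>
  On the downward ray (for \<open>\<sigma> = 1\<close>) the function \<open>F\<close> is bounded, so that the Laplace integral along
  it converges on the whole half-plane \<open>\<sigma> Im w > 0\<close>, and up to its boundary if \<open>Re s < 0\<close>.
\<close>
lemma has_reg_integral_inf_vertical:
  fixes F :: "complex \<Rightarrow> complex"
  assumes \<sigma>: "\<sigma> \<in> {1, -1}" and T: "0 \<le> T" "T < t\<^sub>0" and K: "K \<ge> 0"
    and F: "F holomorphic_on {z. Re z > T}"
    and bd: "\<And>z. Re z \<ge> t\<^sub>0 \<Longrightarrow> norm (F z) \<le> B * exp (K * Re z)"
    and s: "Re s < 0"
  defines "z \<equiv> \<lambda>t. of_real t\<^sub>0 + of_real (t - t\<^sub>0) * (- of_real \<sigma> * \<i>)"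
  shows "has_reg_integral_inf \<sigma> (\<lambda>t. F (of_real t) * of_real t powr (s - 1)) t\<^sub>0
     ((- of_real \<sigma> * \<i>) * integral {t\<^sub>0..} (\<lambda>t. F (z t) * z t powr (s - 1)))"
proof -
  have t0: "t\<^sub>0 > 0" using T by simp
  have ss: "\<sigma> * \<sigma> = 1" using \<sigma> by auto
  \<comment> \<open>The constant of \<open>norm_powr_le_decay\<close> for the exponent s -
    1.\<close>
  define A where "A = 3 powr (1 - Re s) * exp (pi * \<bar>Im s\<bar>)"
  have A0: "A \<ge> 0" by (simp add: A_def)
  have B0: "B \<ge> 0"
  proof -
    have "0 \<le> B * exp (K * t\<^sub>0)" using bd[of "of_real t\<^sub>0"] norm_ge_zero order_trans
      by (metis Re_complex_of_real order_refl)
    then show ?thesis by (simp add: zero_le_mult_iff)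
  qed
  have pw: "norm (u powr (s - 1)) \<le> A * x powr (Re s - 1)" if "x > 0" "norm u \<ge> x / 3" for u x
    using norm_powr_le_decay[OF that, of "s - 1"] s by (simp add: A_def)
  have Rez: "Re (z t) = t\<^sub>0" and Imz: "Im (z t) = - \<sigma> * (t - t\<^sub>0)" for t
    by (simp_all add: z_def)
  have cone: "norm (of_real t\<^sub>0 + of_real x * 1 + of_real y * (- of_real \<sigma> * \<i>)) \<ge> (t\<^sub>0 + x + y) / 3"
    if "x \<ge> 0" "y \<ge> 0" for x y
  proof -
    let ?u = "of_real t\<^sub>0 + of_real x * 1 + of_real y * (- of_real \<sigma> * \<i>)"
    have "t\<^sub>0 + x \<le> norm ?u" using abs_Re_le_cmod[of ?u] that t0 by simp
    moreover have "y \<le> norm ?u" using abs_Im_le_cmod[of ?u] that \<sigma> by auto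
    ultimately show ?thesis using that t0 by simp
  qed
  have zn: "norm (z t) \<ge> t / 3" if "t \<ge> t\<^sub>0" for t
    using cone[of 0 "t - t\<^sub>0"] that by (simp add: z_def)
  have cz: "continuous_on X z" for X unfolding z_def by (intro continuous_intros)
  have hp: "(\<lambda>z. z powr (s - 1)) holomorphic_on {z. Re z > T}"
    using T by (intro holomorphic_intros) (auto simp: complex_nonpos_Reals_iff)
  define \<psi> where "\<psi> = (\<lambda>t. F (z t) * z t powr (s - 1))"
  have c\<psi>: "continuous_on {t\<^sub>0..} \<psi>"
    unfolding \<psi>_def using T
    by (intro continuous_on_mult continuous_on_compose2[OF holomorphic_on_imp_continuous_on[OF F] cz]
         continuous_on_compose2[OF holomorphic_on_imp_continuous_on[OF hp] cz]) (auto simp: Rez)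
  have \<psi>b: "norm (\<psi> t) \<le> B * exp (K * t\<^sub>0) * (A * t powr (Re s - 1))" if "t \<ge> t\<^sub>0" for t
    unfolding \<psi>_def norm_mult using bd[of "z t"] pw[of t "z t"] zn[OF that] that t0 B0 Rez[of t]
    by (intro mult_mono) auto
  \<comment> \<open>\<open>Gv\<close> runs along the vertical ray, without the direction factor -
    \<sigma> i; \<open>Gr\<close> is the Laplace integral on the real ray.\<close>
  define Gv where "Gv = (\<lambda>w. integral {t\<^sub>0..} (\<lambda>t. exp (w * - z t) * \<psi> t))"
  define Gr where "Gr = (\<lambda>w. integral {t\<^sub>0..} (\<lambda>t. exp (w * - of_real t) * (F (of_real t) * of_real t powr (s - 1))))"
  have vb: "norm (exp (w * - z t) * \<psi> t) \<le> exp (L * t\<^sub>0) * (B * exp (K * t\<^sub>0) * A) * t powr (Re s - 1)"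
    if "\<sigma> * Im w \<ge> 0" "norm w \<le> L" "t \<ge> t\<^sub>0" for w t L
  proof -
    \<comment> \<open>The direction - \<sigma> i is chosen for this formula: the coefficient of t is
      - \<sigma> Im w, so the exponential stays bounded for \<sigma> Im w \<ge> 0, whatever the sign
      of Re w. The growth of F enters only through its bound at the fixed real part t0.\<close>
    have "Re (w * - z t) = - Re w * t\<^sub>0 - \<sigma> * Im w * (t - t\<^sub>0)"
      by (simp add: Rez Imz algebra_simps)
    also have "\<dots> \<le> L * t\<^sub>0"
    proof -
      have "- Re w * t\<^sub>0 \<le> L * t\<^sub>0"
        using abs_Re_le_cmod[of w] that(2) t0 by (intro mult_right_mono) auto
      moreover have "\<sigma> * Im w * (t - t\<^sub>0) \<ge> 0" by (rule mult_nonneg_nonneg) (use that in auto)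
      ultimately show ?thesis by linarith
    qed
    finally have "norm (exp (w * - z t)) \<le> exp (L * t\<^sub>0)" by simp
    then have "norm (exp (w * - z t) * \<psi> t) \<le> exp (L * t\<^sub>0) * (B * exp (K * t\<^sub>0) * (A * t powr (Re s - 1)))"
      unfolding norm_mult using \<psi>b[OF that(3)] by (intro mult_mono) auto
    then show ?thesis by (simp add: mult_ac)
  qed
  have cb: "continuous_on {t\<^sub>0..} (\<lambda>t. c * t powr (Re s - 1))" for c
    using t0 by (intro continuous_intros) auto
  have Gvh: "Gv holomorphic_on {w. \<sigma> * Im w > 0}"
    unfolding Gv_def
  proof (rule holomorphic_integral_exp_to_inf)
    show "open {w. \<sigma> * Im w > 0}" by (intro open_Collect_less continuous_intros)
    show "\<exists>b. continuous_on {t\<^sub>0..} b \<and> b integrable_on {t\<^sub>0..} \<and>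
       (\<forall>p t. p \<in> {w. 0 < \<sigma> * Im w} \<longrightarrow> norm p < L \<longrightarrow> t\<^sub>0 \<le> t \<longrightarrow> norm (exp (p * - z t) * \<psi> t) \<le> b t)" for L
      using s t0 vb[of _ L]
      by (intro exI[of _ "\<lambda>t. exp (L * t\<^sub>0) * (B * exp (K * t\<^sub>0) * A) * t powr (Re s - 1)"] conjI cb
         powr_integrable_to_inf) auto
  qed (intro continuous_intros cz c\<psi>)+
  \<comment> \<open>The closed half-plane brings in w = 0, and the unit disc keeps |w| bounded, as
    \<open>vb\<close> requires. For the limit at 0 the restriction to the disc makes no
    difference.\<close>
  have "continuous_on ({w. \<sigma> * Im w \<ge> 0} \<inter> ball 0 1) Gv"
    unfolding Gv_def
  proof (rule continuous_on_integral_exp_to_inf[OF _ c\<psi> cb powr_integrable_to_inf])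
    show "norm (exp (w * - z t) * \<psi> t) \<le> exp (1 * t\<^sub>0) * (B * exp (K * t\<^sub>0) * A) * t powr (Re s - 1)"
      if "w \<in> {w. \<sigma> * Im w \<ge> 0} \<inter> ball 0 1" "t \<ge> t\<^sub>0" for w t
      by (rule vb) (use that in auto)
  qed (use s t0 in \<open>auto intro!: continuous_intros cz\<close>)
  then have "(Gv \<longlongrightarrow> Gv 0) (at 0 within ({w. \<sigma> * Im w \<ge> 0} \<inter> ball 0 1))"
    by (auto simp: continuous_on_def)
  then have "(Gv \<longlongrightarrow> Gv 0) (at 0 within ({w. \<sigma> * Im w > 0} \<inter> ball 0 1))"
    by (rule tendsto_within_subset) auto
  moreover have "at 0 within ({w. \<sigma> * Im w > 0} \<inter> ball 0 1) = at 0 within {w. \<sigma> * Im w > 0}"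
    by (rule at_within_nhd[of _ "ball 0 1"]) auto
  ultimately have Gv0: "(Gv \<longlongrightarrow> Gv 0) (at 0 within {w. \<sigma> * Im w > 0})" by simp
  have rb: "norm (exp (w * - of_real t) * (F (of_real t) * of_real t powr (s - 1))) \<le> B * A * t powr (Re s - 1)"
    if "Re w > K" "t \<ge> t\<^sub>0" for w t
  proof -
    have "norm (exp (w * - of_real t)) \<le> exp (- K * t)"
      using that t0 by simp
    moreover have "norm (F (of_real t)) \<le> B * exp (K * t)" using bd[of "of_real t"] that by simp
    ultimately have "norm (exp (w * - of_real t)) * norm (F (of_real t)) \<le> exp (- K * t) * (B * exp (K * t))"
      by (intro mult_mono) auto
    also have "\<dots> = B" by (simp flip: exp_add)
    finally have "norm (exp (w * - of_real t)) * norm (F (of_real t)) * norm (of_real t powr (s - 1)) \<le> B * (A * t powr (Re s - 1))"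
      using pw[of t "of_real t"] that t0 B0 by (intro mult_mono) auto
    then show ?thesis by (simp add: norm_mult mult_ac)
  qed
  have cF: "continuous_on {t\<^sub>0..} (\<lambda>t. F (of_real t) * of_real t powr (s - 1))"
    using T
    by (intro continuous_on_mult continuous_on_compose2[OF holomorphic_on_imp_continuous_on[OF F]]
         continuous_on_compose2[OF holomorphic_on_imp_continuous_on[OF hp]] continuous_intros) auto
  have Grh: "Gr holomorphic_on {w. Re w > K}"
    unfolding Gr_def
  proof (rule holomorphic_integral_exp_to_inf[OF _ cF])
    show "open {w. Re w > K}" by (intro open_Collect_less continuous_intros)
    show "\<exists>b. continuous_on {t\<^sub>0..} b \<and> b integrable_on {t\<^sub>0..} \<and>
       (\<forall>p t. p \<in> {w. Re w > K} \<longrightarrow> norm p < L \<longrightarrow> t\<^sub>0 \<le> t \<longrightarrow>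
         norm (exp (p * - of_real t) * (F (of_real t) * of_real t powr (s - 1))) \<le> b t)" for L
      using s t0 rb
      by (intro exI[of _ "\<lambda>t. B * A * t powr (Re s - 1)"] conjI cb powr_integrable_to_inf) auto
  qed (intro continuous_intros)
  have Gri: "((\<lambda>t. exp (- w * of_real t) * (F (of_real t) * of_real t powr (s - 1))) has_integral Gr w) {t\<^sub>0..}"
    if "Re w > K" for w
  proof -
    have "(\<lambda>t. exp (w * - of_real t) * (F (of_real t) * of_real t powr (s - 1))) integrable_on {t\<^sub>0..}"
      by (rule integral_truncation_tendsto(1)[OF _ powr_integrable_to_inf[of t\<^sub>0 "Re s - 1" "B * A"]])
         (use rb[OF that] t0 s in \<open>auto intro!: integrable_continuous_interval continuous_intros continuous_on_subset[OF cF]\<close>)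
    then show ?thesis unfolding Gr_def by (simp add: has_integral_integral)
  qed
  have eq: "Gr w = (- of_real \<sigma> * \<i>) * Gv w" if w: "Re w > K" "\<sigma> * Im w > 0" for w
  proof -
    have "1 * integral {t\<^sub>0..} (\<lambda>t. (\<lambda>u. exp (w * - u) * (F u * u powr (s - 1))) (of_real t\<^sub>0 + of_real (t - t\<^sub>0) * 1)) =
       (- of_real \<sigma> * \<i>) * integral {t\<^sub>0..} (\<lambda>t. (\<lambda>u. exp (w * - u) * (F u * u powr (s - 1)))
          (of_real t\<^sub>0 + of_real (t - t\<^sub>0) * (- of_real \<sigma> * \<i>)))"
    proof (rule ray_rotation[OF t0, where \<delta> = "- Re s" and \<Omega> = "{z. Re z > T}" and B = "B * A"])
      show "(\<lambda>u. exp (w * - u) * (F u * u powr (s - 1))) holomorphic_on {z. Re z > T}"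
        by (intro holomorphic_intros F hp)
      show "open {z. Re z > T}" by (intro open_Collect_less continuous_intros)
      fix x y :: real assume xy: "x \<ge> 0" "y \<ge> 0"
      let ?u = "of_real t\<^sub>0 + of_real x * 1 + of_real y * (- of_real \<sigma> * \<i>)"
      have Reu: "Re ?u = t\<^sub>0 + x" and Imu: "Im ?u = - \<sigma> * y" by simp_all
      have "Re (w * - ?u) = - Re w * (t\<^sub>0 + x) - (\<sigma> * Im w) * y"
        by (simp add: algebra_simps)
      also have "\<dots> \<le> - K * (t\<^sub>0 + x)"
      proof -
        have "K * (t\<^sub>0 + x) \<le> Re w * (t\<^sub>0 + x)" using w xy t0 by (intro mult_right_mono) auto
        moreover have "(\<sigma> * Im w) * y \<ge> 0" by (rule mult_nonneg_nonneg) (use w xy in auto)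
        ultimately show ?thesis by simp
      qed
      finally have "norm (exp (w * - ?u)) \<le> exp (- K * (t\<^sub>0 + x))" by (simp only: norm_exp_eq_Re exp_le_cancel_iff)
      moreover have "norm (F ?u) \<le> B * exp (K * (t\<^sub>0 + x))" using bd[of ?u] xy unfolding Reu by simp
      ultimately have "norm (exp (w * - ?u)) * norm (F ?u) \<le> exp (- K * (t\<^sub>0 + x)) * (B * exp (K * (t\<^sub>0 + x)))"
        by (intro mult_mono) auto
      also have "\<dots> = B" by (simp flip: exp_add)
      finally have "norm (exp (w * - ?u)) * norm (F ?u) * norm (?u powr (s - 1)) \<le> B * (A * (t\<^sub>0 + x + y) powr (Re s - 1))"
        using pw[of "t\<^sub>0 + x + y" ?u] cone[OF xy] t0 B0 xy by (intro mult_mono) auto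
      then show "norm (exp (w * - ?u) * (F ?u * ?u powr (s - 1))) \<le> B * A * (t\<^sub>0 + x + y) powr (- 1 - - Re s)"
        by (simp add: norm_mult mult_ac)
      show "?u \<in> {z. Re z > T}" using Reu T xy by simp
    qed (use s in \<open>auto simp: convex_halfspace_Re_gt\<close>)
    then show ?thesis by (simp add: Gr_def Gv_def \<psi>_def z_def)
  qed
  \<comment> \<open>The two branches agree on the overlap of the half-planes by \<open>eq\<close>,
    so G is holomorphic on their union.\<close>
  define G where "G = (\<lambda>w. if Re w > K then Gr w else (- of_real \<sigma> * \<i>) * Gv w)"
  show ?thesis unfolding has_reg_integral_inf_def
  proof (intro exI[of _ G] exI[of _ K] conjI allI impI)
    show "((\<lambda>t. exp (- w * of_real t) * (F (of_real t) * of_real t powr (s - 1))) has_integral G w) {t\<^sub>0..}"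
      if "Re w > K" for w using Gri[OF that] that by (simp add: G_def)
    have e: "{w. K < Re w \<or> 0 < \<sigma> * Im w} = {w. K < Re w} \<union> {w. 0 < \<sigma> * Im w}" by auto
    show "G holomorphic_on {w. K < Re w \<or> 0 < \<sigma> * Im w}"
      unfolding e
    proof (rule holomorphic_on_Un)
      show "G holomorphic_on {w. K < Re w}"
        using Grh by (rule holomorphic_transform) (simp add: G_def)
      have "(\<lambda>w. (- of_real \<sigma> * \<i>) * Gv w) holomorphic_on {w. 0 < \<sigma> * Im w}"
        by (intro holomorphic_intros Gvh)
      then show "G holomorphic_on {w. 0 < \<sigma> * Im w}"
        by (rule holomorphic_transform) (use eq in \<open>auto simp: G_def\<close>)
    qed (intro open_Collect_less continuous_intros)+
    have "\<forall>\<^sub>F w in at 0 within {w. 0 < \<sigma> * Im w}. (- of_real \<sigma> * \<i>) * Gv w = G w"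
      unfolding eventually_at_filter by (intro always_eventually) (use eq in \<open>auto simp: G_def\<close>)
    moreover have "((\<lambda>w. (- of_real \<sigma> * \<i>) * Gv w) \<longlongrightarrow> (- of_real \<sigma> * \<i>) * Gv 0) (at 0 within {w. 0 < \<sigma> * Im w})"
      by (intro tendsto_intros Gv0)
    ultimately have "(G \<longlongrightarrow> (- of_real \<sigma> * \<i>) * Gv 0) (at 0 within {w. 0 < \<sigma> * Im w})"
      by (rule Lim_transform_eventually[rotated])
    then show "(G \<longlongrightarrow> (- of_real \<sigma> * \<i>) * integral {t\<^sub>0..} (\<lambda>t. F (z t) * z t powr (s - 1)))
        (at 0 within {w. 0 < \<sigma> * Im w})" by (simp add: Gv_def \<psi>_def)
  qed
qed

text \<open>Since ln t \<le> c t + |ln c| for every c > 0, |s Ln z| grows more slowly than any given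
  linear function as long as s is bounded and |z| is comparable to t. The slope c = d / L makes the
  product L c t equal to d t; the summand 1 in L keeps it positive.\<close>

lemma norm_exp_Ln_le:
  assumes t0: "t\<^sub>0 > 0" and d: "d > 0"
  obtains C where "\<And>s z t. norm s < K \<Longrightarrow> t \<ge> t\<^sub>0 \<Longrightarrow> t / 3 \<le> norm z \<Longrightarrow> norm z \<le> 3 * t \<Longrightarrow>
     norm (exp (s * Ln z)) \<le> C * exp (d * t)"
proof
  define L where "L = \<bar>K\<bar> + 1"
  define c where "c = d / L"
  have L: "L > 0" by (simp add: L_def)
  have c: "c > 0" using d L by (simp add: c_def)
  define A where "A = \<bar>ln c\<bar> + \<bar>ln t\<^sub>0\<bar> + ln 3 + pi"
  fix s z :: complex and t :: real
  assume s: "norm s < K" and t: "t \<ge> t\<^sub>0" and z: "t / 3 \<le> norm z" "norm z \<le> 3 * t"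
  have tp: "t > 0" and zp: "norm z > 0" and z0: "z \<noteq> 0" using t t0 z by auto
  have "ln (norm z) \<le> ln (3 * t)" 
    by (rule iffD2[OF ln_le_cancel_iff]) (use z(2) tp zp in linarith)+
  also have "\<dots> = ln 3 + ln t" using tp by (intro ln_mult_pos) auto
  finally have l1: "ln (norm z) \<le> ln 3 + ln t" .
  have l2: "ln (norm z) \<ge> ln t - ln 3" using z(1) tp zp ln_div[of t 3] ln_mono[of "t / 3" "norm z"] by auto
  have l3: "ln t \<ge> ln t\<^sub>0" using t t0 by simp
  have "ln (c * t) \<le> c * t - 1" by (rule ln_le_minus_one) (use c tp in simp)
  then have l4: "ln t \<le> c * t + \<bar>ln c\<bar>" using c tp by (simp add: ln_mult)
  have l5: "\<bar>ln t\<bar> \<le> c * t + \<bar>ln c\<bar> + \<bar>ln t\<^sub>0\<bar>"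
    using l3 l4 mult_pos_pos[OF c tp] by linarith
  have "norm (Ln z) \<le> \<bar>Re (Ln z)\<bar> + \<bar>Im (Ln z)\<bar>" by (rule cmod_le)
  also have "\<dots> \<le> (\<bar>ln t\<bar> + ln 3) + pi"
    using l1 l2 mpi_less_Im_Ln[OF z0] Im_Ln_le_pi[OF z0] z0 by (intro add_mono) auto
  also have "\<dots> \<le> c * t + A" using l5 by (simp add: A_def)
  finally have Ln: "norm (Ln z) \<le> c * t + A" .
  have "norm s * norm (Ln z) \<le> L * (c * t + A)"
    by (rule mult_mono[OF _ Ln _ norm_ge_zero]) (use s L in \<open>auto simp: L_def\<close>)
  also have "\<dots> = L * A + d * t" using L by (simp add: c_def algebra_simps)
  finally have "Re (s * Ln z) \<le> L * A + d * t"
    using complex_Re_le_cmod[of "s * Ln z"] by (simp add: norm_mult)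
  then have "exp (Re (s * Ln z)) \<le> exp (L * A) * exp (d * t)" by (simp flip: exp_add)
  then show "norm (exp (s * Ln z)) \<le> exp (L * A) * exp (d * t)" by (simp only: norm_exp_eq_Re)
qed

text \<open>Half of the decay rate d pays for the growth of z powr s with s bounded; the other half
  leaves an integrable majorant.\<close>

lemma holomorphic_Mellin_ray:
  fixes z \<psi> :: "real \<Rightarrow> complex"
  assumes t0: "t\<^sub>0 > 0" and d: "d > 0"
    and z: "continuous_on {t\<^sub>0..} z" "\<And>t. t \<ge> t\<^sub>0 \<Longrightarrow> z t \<notin> \<real>\<^sub>\<le>\<^sub>0"
      "\<And>t. t \<ge> t\<^sub>0 \<Longrightarrow> t / 3 \<le> norm (z t)" "\<And>t. t \<ge> t\<^sub>0 \<Longrightarrow> norm (z t) \<le> 3 * t"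
    and \<psi>: "continuous_on {t\<^sub>0..} \<psi>" "\<And>t. t \<ge> t\<^sub>0 \<Longrightarrow> norm (\<psi> t) \<le> B * exp (- d * t)"
  shows "(\<lambda>s. integral {t\<^sub>0..} (\<lambda>t. exp (s * Ln (z t)) * \<psi> t)) holomorphic_on UNIV"
proof (rule holomorphic_integral_exp_to_inf[OF _ \<psi>(1) open_UNIV])
  show "continuous_on {t\<^sub>0..} (\<lambda>t. Ln (z t))"
    by (intro continuous_intros z) (use z in auto)
  show "\<exists>b. continuous_on {t\<^sub>0..} b \<and> b integrable_on {t\<^sub>0..} \<and> (\<forall>p t. p \<in> UNIV \<longrightarrow> norm p < K \<longrightarrow>
      t\<^sub>0 \<le> t \<longrightarrow> norm (exp (p * Ln (z t)) * \<psi> t) \<le> b t)" for K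
  proof -
    obtain C where C: "\<And>s z t. norm s < K \<Longrightarrow> t \<ge> t\<^sub>0 \<Longrightarrow> t / 3 \<le> norm z \<Longrightarrow> norm z \<le> 3 * t \<Longrightarrow>
       norm (exp (s * Ln z)) \<le> C * exp (d / 2 * t)"
      using norm_exp_Ln_le[OF t0, of "d / 2" K] d by auto
    show ?thesis
    proof (intro exI[of _ "\<lambda>t. (C * B) * exp (- (d / 2) * t)"] conjI exp_integrable_to_inf allI impI)
      fix p :: complex and t :: real assume p: "norm p < K" "t\<^sub>0 \<le> t"
      have 1: "norm (exp (p * Ln (z t))) \<le> C * exp (d / 2 * t)"
        by (rule C) (use p z in auto)
      have "norm (exp (p * Ln (z t))) * norm (\<psi> t) \<le> (C * exp (d / 2 * t)) * (B * exp (- d * t))"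
        using 1 \<psi>(2)[OF p(2)] order_trans[OF norm_ge_zero 1] by (intro mult_mono) auto
      also have "\<dots> = (C * B) * exp (- (d / 2) * t)"
        by (simp add: field_simps flip: exp_add)
      finally show "norm (exp (p * Ln (z t)) * \<psi> t) \<le> (C * B) * exp (- (d / 2) * t)"
        by (simp only: norm_mult)
    qed (use d in \<open>auto intro!: continuous_intros\<close>)
  qed
qed

lemma powr_minus_1_conv_exp_Ln:
  assumes "z \<noteq> 0"
  shows "z powr (s - 1) = exp (s * Ln z) / z"
  using assms by (simp add: powr_def left_diff_distrib exp_diff)

section \<open>Values at w = 0 for decaying, constant and growing terms\<close>

lemma vertical_cone_lower:
  assumes "\<sigma> \<in> {1, -1 :: real}" "t\<^sub>0 > 0" "x \<ge> 0" "y \<ge> 0"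
  shows "norm (of_real t\<^sub>0 + of_real x * 1 + of_real y * (- of_real \<sigma> * \<i>)) \<ge> (t\<^sub>0 + x + y) / 3"
proof -
  let ?u = "of_real t\<^sub>0 + of_real x * 1 + of_real y * (- of_real \<sigma> * \<i>)"
  have "t\<^sub>0 + x \<le> norm ?u" using abs_Re_le_cmod[of ?u] assms by simp
  moreover have "y \<le> norm ?u" using abs_Im_le_cmod[of ?u] assms by auto
  ultimately show ?thesis using assms by simp
qed

text \<open>For bounded F and Re s < 0 the integrand decays like a power below -1 in the whole
  quarter-plane. The ray can then be turned at w = 0 itself, and the regularized integral is an
  ordinary one.\<close>

lemma vertical_eq_real:
  fixes F :: "complex \<Rightarrow> complex"
  assumes \<sigma>: "\<sigma> \<in> {1, -1}" and T: "0 \<le> T" "T < t\<^sub>0"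
    and F: "F holomorphic_on {z. Re z > T}"
    and bd: "\<And>z. Re z \<ge> t\<^sub>0 \<Longrightarrow> norm (F z) \<le> B"
    and s: "Re s < 0"
  defines "z \<equiv> \<lambda>t. of_real t\<^sub>0 + of_real (t - t\<^sub>0) * (- of_real \<sigma> * \<i>)"
  shows "(- of_real \<sigma> * \<i>) * integral {t\<^sub>0..} (\<lambda>t. F (z t) * z t powr (s - 1)) =
     integral {t\<^sub>0..} (\<lambda>t. F (of_real t) * of_real t powr (s - 1))"
proof -
  have t0: "t\<^sub>0 > 0" using T by simp
  define A where "A = 3 powr (1 - Re s) * exp (pi * \<bar>Im s\<bar>)"
  have "1 * integral {t\<^sub>0..} (\<lambda>t. (\<lambda>u. F u * u powr (s - 1)) (of_real t\<^sub>0 + of_real (t - t\<^sub>0) * 1)) =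
     (- of_real \<sigma> * \<i>) * integral {t\<^sub>0..} (\<lambda>t. (\<lambda>u. F u * u powr (s - 1))
        (of_real t\<^sub>0 + of_real (t - t\<^sub>0) * (- of_real \<sigma> * \<i>)))"
  proof (rule ray_rotation[OF t0, where \<delta> = "- Re s" and \<Omega> = "{z. Re z > T}" and B = "B * A"])
    show "(\<lambda>u. F u * u powr (s - 1)) holomorphic_on {z. Re z > T}"
      using T by (intro holomorphic_intros F) (auto simp: complex_nonpos_Reals_iff)
    show "open {z. Re z > T}" by (intro open_Collect_less continuous_intros)
    fix x y :: real assume xy: "x \<ge> 0" "y \<ge> 0"
    let ?u = "of_real t\<^sub>0 + of_real x * 1 + of_real y * (- of_real \<sigma> * \<i>)"
    have Reu: "Re ?u = t\<^sub>0 + x" by simp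
    have "norm (?u powr (s - 1)) \<le> A * (t\<^sub>0 + x + y) powr (Re s - 1)"
      using norm_powr_le_decay[of "t\<^sub>0 + x + y" ?u "s - 1"] vertical_cone_lower[OF \<sigma> t0 xy] t0 xy s
      by (simp add: A_def)
    moreover have "norm (F ?u) \<le> B" using bd[of ?u] xy unfolding Reu by simp
    ultimately have "norm (F ?u) * norm (?u powr (s - 1)) \<le> B * (A * (t\<^sub>0 + x + y) powr (Re s - 1))"
      using order_trans[OF norm_ge_zero bd[of "of_real t\<^sub>0"]] by (intro mult_mono) auto
    then show "norm (F ?u * ?u powr (s - 1)) \<le> B * A * (t\<^sub>0 + x + y) powr (- 1 - - Re s)"
      by (simp add: norm_mult mult_ac)
    show "?u \<in> {z. Re z > T}" using Reu T xy by simp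
  qed (use s in \<open>auto simp: convex_halfspace_Re_gt\<close>)
  then show ?thesis by (simp add: z_def)
qed

text \<open>The ordinary integral over the real ray converges for every s because F decays
  exponentially. The restriction Re s < 0 serves its identification with the value on the vertical
  ray.\<close>

lemma reg_integral_tail:
  fixes F :: "complex \<Rightarrow> complex"
  assumes \<sigma>: "\<sigma> \<in> {1, -1}" and T: "0 \<le> T" "T < t\<^sub>0" and d: "d > 0"
    and F: "F holomorphic_on {z. Re z > T}"
    and bd: "\<And>z. Re z \<ge> t\<^sub>0 \<Longrightarrow> norm (F z) \<le> B * exp (- d * Re z)"
  shows "\<exists>V. V holomorphic_on UNIV \<and> (\<forall>s. Re s < 0 \<longrightarrow>
     has_reg_integral_inf \<sigma> (\<lambda>t. F (of_real t) * of_real t powr (s - 1)) t\<^sub>0 (V s))"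
proof -
  have t0: "t\<^sub>0 > 0" using T by simp
  have B0: "B \<ge> 0"
  proof -
    have "0 \<le> B * exp (- d * t\<^sub>0)" using bd[of "of_real t\<^sub>0"] norm_ge_zero order_trans
      by (metis Re_complex_of_real order_refl)
    then show ?thesis by (simp add: zero_le_mult_iff)
  qed
  have bd': "norm (F z) \<le> B" if "Re z \<ge> t\<^sub>0" for z
  proof -
    have "B * exp (- d * Re z) \<le> B * 1" using that t0 d B0 by (intro mult_left_mono) auto
    with bd[OF that] show ?thesis by simp
  qed
  define V where "V = (\<lambda>s. integral {t\<^sub>0..} (\<lambda>t. exp (s * Ln (of_real t)) * (F (of_real t) / of_real t)))"
  have cF: "continuous_on {t\<^sub>0..} (\<lambda>t. F (of_real t))"
    using T by (intro continuous_on_compose2[OF holomorphic_on_imp_continuous_on[OF F]] continuous_intros) auto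
  have "V holomorphic_on UNIV"
    unfolding V_def
  proof (rule holomorphic_Mellin_ray[OF t0 d, where B = "B / t\<^sub>0"])
    show "continuous_on {t\<^sub>0..} (\<lambda>t. F (of_real t) / of_real t)"
      using t0 by (intro continuous_intros cF) auto
    show "norm (F (of_real t) / of_real t) \<le> B / t\<^sub>0 * exp (- d * t)" if "t \<ge> t\<^sub>0" for t
    proof -
      have "norm (F (of_real t)) / t \<le> (B * exp (- d * t)) / t\<^sub>0"
        using bd[of "of_real t"] that t0 B0 by (intro frac_le) auto
      then show ?thesis using that t0 by (simp add: norm_divide)
    qed
  qed (use t0 in \<open>auto intro!: continuous_intros simp: complex_nonpos_Reals_iff\<close>)
  moreover have "has_reg_integral_inf \<sigma> (\<lambda>t. F (of_real t) * of_real t powr (s - 1)) t\<^sub>0 (V s)"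
    if s: "Re s < 0" for s
  proof -
    have "V s = integral {t\<^sub>0..} (\<lambda>t. F (of_real t) * of_real t powr (s - 1))"
      unfolding V_def using t0
      by (intro integral_cong) (simp add: powr_minus_1_conv_exp_Ln)
    then show ?thesis
      using has_reg_integral_inf_vertical[OF \<sigma> T order_refl F, of B s]
        vertical_eq_real[OF \<sigma> T F bd' s] bd' s by simp
  qed
  ultimately show ?thesis by blast
qed

text \<open>This covers the constant Fourier term. In contrast to decaying and growing terms, its
  value continues in s with a pole, here at s = 0.\<close>

lemma reg_integral_const:
  assumes \<sigma>: "\<sigma> \<in> {1, -1}" and t0: "0 < t\<^sub>0" and s: "Re s < 0"
  shows "has_reg_integral_inf \<sigma> (\<lambda>t. of_real t powr (s - 1)) t\<^sub>0 (- (of_real t\<^sub>0 powr s / s))"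
proof -
  have s0: "s \<noteq> 0" using s by auto
  have I: "((\<lambda>t. complex_of_real t powr (s - 1)) has_integral
      (of_real (t\<^sub>0 + real n) powr s / s - of_real t\<^sub>0 powr s / s)) {t\<^sub>0..t\<^sub>0 + real n}" for n
  proof (rule fundamental_theorem_of_calculus)
    fix t assume t: "t \<in> {t\<^sub>0..t\<^sub>0 + real n}"
    have "((\<lambda>t. of_real t powr s / s) has_vector_derivative (of_real t powr (s - 1))) (at t)"
    proof (rule has_vector_derivative_real_field)
      show "((\<lambda>z. z powr s / s) has_field_derivative of_real t powr (s - 1)) (at (of_real t))"
        using t t0 s0 by (auto intro!: derivative_eq_intros)
    qed
    then show "((\<lambda>t. of_real t powr s / s) has_vector_derivative (of_real t powr (s - 1)))
       (at t within {t\<^sub>0..t\<^sub>0 + real n})" by (rule has_vector_derivative_at_within)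
  qed auto
  have 1: "(\<lambda>n. integral {t\<^sub>0..t\<^sub>0 + real n} (\<lambda>t. complex_of_real t powr (s - 1))) \<longlonglongrightarrow>
      integral {t\<^sub>0..} (\<lambda>t. complex_of_real t powr (s - 1))"
  proof (rule integral_truncation_tendsto(2)[OF _ powr_integrable_to_inf[OF t0]])
    show "norm (complex_of_real t powr (s - 1)) \<le> 1 * t powr (Re s - 1)" if "t \<ge> t\<^sub>0" for t
      using norm_powr_real_powr[of "of_real t" "s - 1"] that t0 by simp
    show "(\<lambda>t. complex_of_real t powr (s - 1)) integrable_on {t\<^sub>0..t\<^sub>0 + real n}" for n
      by (rule has_integral_integrable[OF I])
  qed (use s in simp)
  have 2: "(\<lambda>n. integral {t\<^sub>0..t\<^sub>0 + real n} (\<lambda>t. complex_of_real t powr (s - 1))) \<longlonglongrightarrow>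
      0 / s - of_real t\<^sub>0 powr s / s"
  proof -
    have "(\<lambda>n. (t\<^sub>0 + real n) powr Re s) \<longlonglongrightarrow> 0"
      by (rule tendsto_neg_powr[OF s filterlim_tendsto_add_at_top[OF tendsto_const filterlim_real_sequentially]])
    then have "(\<lambda>n. complex_of_real (t\<^sub>0 + real n) powr s) \<longlonglongrightarrow> 0"
    proof (rule Lim_null_comparison[rotated], intro always_eventually allI)
      fix n
      show "norm (complex_of_real (t\<^sub>0 + real n) powr s) \<le> (t\<^sub>0 + real n) powr Re s"
        using norm_powr_real_powr[of "of_real (t\<^sub>0 + real n)" s] t0 by (simp del: of_real_add)
    qed
    then have "(\<lambda>n. complex_of_real (t\<^sub>0 + real n) powr s / s - of_real t\<^sub>0 powr s / s) \<longlonglongrightarrow> 0 / s - of_real t\<^sub>0 powr s / s"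
      by (rule tendsto_diff[OF tendsto_divide[OF _ tendsto_const s0] tendsto_const])
    then show ?thesis by (simp only: integral_unique[OF I])
  qed
  have V: "integral {t\<^sub>0..} (\<lambda>t. complex_of_real t powr (s - 1)) = - (of_real t\<^sub>0 powr s / s)"
    using LIMSEQ_unique[OF 1 2] by simp
  have hol: "(\<lambda>_::complex. 1 :: complex) holomorphic_on {z. Re z > 0}" by (rule holomorphic_on_const)
  have "norm (1 :: complex) \<le> 1 * exp (0 * Re u)" for u by simp
  note h = has_reg_integral_inf_vertical[OF \<sigma> order_refl t0 order_refl hol this s]
  have "norm (1 :: complex) \<le> 1" by simp
  note e = vertical_eq_real[OF \<sigma> order_refl t0 hol this s]
  from h show ?thesis unfolding e by (simp add: V)
qed

text \<open>
  The value at \<open>w = 0\<close> of the continued Laplace integral of an exponentially growing term is an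
  integral over a ray on which that term decays. It is therefore entire in \<open>s\<close>.
\<close>
lemma reg_integral_exp:
  fixes c :: real
  assumes \<sigma>: "\<sigma> \<in> {1, -1}" and t0: "0 < t\<^sub>0" and lam: "c > 0"
  shows "\<exists>V. V holomorphic_on UNIV \<and> (\<forall>s. Re s < 0 \<longrightarrow>
     has_reg_integral_inf \<sigma> (\<lambda>t. exp (of_real c * of_real t) * of_real t powr (s - 1)) t\<^sub>0 (V s))"
proof -
  \<comment> \<open>The real part -1 makes exp (c z) decay; the imaginary part - \<sigma> keeps the
    ray on the side of the vertical ray and off the branch cut of Ln.\<close>
  define \<rho> where "\<rho> = - 1 - of_real \<sigma> * \<i>"
  define z where "z = (\<lambda>t. of_real t\<^sub>0 + of_real (t - t\<^sub>0) * \<rho>)"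
  define V where "V = (\<lambda>s. \<rho> * integral {t\<^sub>0..} (\<lambda>t. exp (s * Ln (z t)) * (exp (of_real c * z t) / z t)))"
  have ss: "\<sigma> * \<sigma> = 1" using \<sigma> by auto
  have cone: "norm (of_real t\<^sub>0 + of_real x * (- of_real \<sigma> * \<i>) + of_real y * \<rho>) \<ge> (t\<^sub>0 + x + y) / 3"
    if "x \<ge> 0" "y \<ge> 0" for x y
  proof -
    let ?u = "of_real t\<^sub>0 + of_real x * (- of_real \<sigma> * \<i>) + of_real y * \<rho>"
    have "t\<^sub>0 - y \<le> norm ?u" using abs_Re_le_cmod[of ?u] by (simp add: \<rho>_def)
    moreover have "x + y \<le> norm ?u" using abs_Im_le_cmod[of ?u] that \<sigma> by (auto simp: \<rho>_def)
    ultimately show ?thesis using that t0 by simp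
  qed
  have zl: "norm (z t) \<ge> t / 3" if "t \<ge> t\<^sub>0" for t
    using cone[of 0 "t - t\<^sub>0"] that by (simp add: z_def)
  have zu: "norm (z t) \<le> 3 * t" if "t \<ge> t\<^sub>0" for t
  proof -
    have "norm \<rho> \<le> 2" unfolding \<rho>_def using \<sigma> by (intro norm_triangle_le_diff) auto
    then have "(t - t\<^sub>0) * norm \<rho> \<le> (t - t\<^sub>0) * 2" using that by (intro mult_left_mono) auto
    moreover have "norm (z t) \<le> t\<^sub>0 + (t - t\<^sub>0) * norm \<rho>"
      unfolding z_def using that t0 by (intro norm_triangle_le) (simp add: norm_mult flip: of_real_diff)
    ultimately show ?thesis using that t0 by simp
  qed
  have zn: "z t \<notin> \<real>\<^sub>\<le>\<^sub>0" if "t \<ge> t\<^sub>0" for t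
    using that t0 \<sigma> by (auto simp: z_def \<rho>_def complex_nonpos_Reals_iff)
  have z0: "z t \<noteq> 0" if "t \<ge> t\<^sub>0" for t using zn[OF that] by auto
  have cz: "continuous_on X z" for X unfolding z_def by (intro continuous_intros)
  have "V holomorphic_on UNIV"
    unfolding V_def
  proof (intro holomorphic_intros holomorphic_Mellin_ray[OF t0 lam, where B = "3 / t\<^sub>0 * exp (2 * c * t\<^sub>0)"])
    show "norm (exp (of_real c * z t) / z t) \<le> 3 / t\<^sub>0 * exp (2 * c * t\<^sub>0) * exp (- c * t)" if "t \<ge> t\<^sub>0" for t
    proof -
      \<comment> \<open>On this ray Re z = 2 t0 - t, and |z| \<ge> t / 3 \<ge> t0 / 3.\<close>
      have "norm (exp (of_real c * z t)) / norm (z t) \<le> exp (c * (2 * t\<^sub>0 - t)) / (t\<^sub>0 / 3)"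
        using zl[OF that] t0 that by (intro frac_le) (auto simp: z_def \<rho>_def)
      also have "\<dots> = 3 / t\<^sub>0 * exp (2 * c * t\<^sub>0) * exp (- c * t)"
        by (simp add: field_simps flip: exp_add)
      finally show ?thesis by (simp add: norm_divide)
    qed
  qed (use zl zu zn z0 in \<open>auto intro!: continuous_intros cz\<close>)
  moreover have "has_reg_integral_inf \<sigma> (\<lambda>t. exp (of_real c * of_real t) * of_real t powr (s - 1)) t\<^sub>0 (V s)"
    if s: "Re s < 0" for s
  proof -
    define A where "A = 3 powr (1 - Re s) * exp (pi * \<bar>Im s\<bar>)"
    \<comment> \<open>A half-plane that misses the branch cut and contains the cone between the two
      rays, on which Re u - \<sigma> Im u = t0 + x.\<close>
    define \<Omega> where "\<Omega> = {u. Re u - \<sigma> * Im u > 0}"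
    have "(- of_real \<sigma> * \<i>) * integral {t\<^sub>0..} (\<lambda>t. (\<lambda>u. exp (of_real c * u) * u powr (s - 1)) (of_real t\<^sub>0 + of_real (t - t\<^sub>0) * (- of_real \<sigma> * \<i>)))
       = \<rho> * integral {t\<^sub>0..} (\<lambda>t. (\<lambda>u. exp (of_real c * u) * u powr (s - 1)) (of_real t\<^sub>0 + of_real (t - t\<^sub>0) * \<rho>))"
    proof (rule ray_rotation[OF t0, where \<delta> = "- Re s" and \<Omega> = \<Omega> and B = "exp (c * t\<^sub>0) * A"])
      show "(\<lambda>u. exp (of_real c * u) * u powr (s - 1)) holomorphic_on \<Omega>"
        by (intro holomorphic_intros) (auto simp: complex_nonpos_Reals_iff \<Omega>_def)
      show "open \<Omega>" unfolding \<Omega>_def by (intro open_Collect_less continuous_intros)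
      have "\<Omega> = {u. inner (Complex 1 (- \<sigma>)) u > 0}" by (simp add: \<Omega>_def inner_complex_def)
      then show "convex \<Omega>" by (simp add: convex_halfspace_gt)
      fix x y :: real assume xy: "x \<ge> 0" "y \<ge> 0"
      let ?u = "of_real t\<^sub>0 + of_real x * (- of_real \<sigma> * \<i>) + of_real y * \<rho>"
      have Reu: "Re ?u = t\<^sub>0 - y" by (simp add: \<rho>_def)
      have Imu: "\<sigma> * Im ?u = - (x + y)" using \<sigma> by (auto simp: \<rho>_def)
      have "norm (?u powr (s - 1)) \<le> A * (t\<^sub>0 + x + y) powr (Re s - 1)"
        using norm_powr_le_decay[of "t\<^sub>0 + x + y" ?u "s - 1"] cone[OF xy] t0 xy s
        by (simp add: A_def)
      moreover have "norm (exp (of_real c * ?u)) \<le> exp (c * t\<^sub>0)"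
        using lam xy Reu by (simp add: mult_left_mono)
      ultimately have "norm (exp (of_real c * ?u)) * norm (?u powr (s - 1)) \<le> exp (c * t\<^sub>0) * (A * (t\<^sub>0 + x + y) powr (Re s - 1))"
        by (intro mult_mono) auto
      then show "norm (exp (of_real c * ?u) * ?u powr (s - 1)) \<le> exp (c * t\<^sub>0) * A * (t\<^sub>0 + x + y) powr (- 1 - - Re s)"
        by (simp add: norm_mult mult_ac)
      show "?u \<in> \<Omega>" unfolding \<Omega>_def mem_Collect_eq Reu Imu using xy t0 by simp
    qed (use s in auto)
    also have "\<dots> = V s"
    proof -
      have zt: "of_real t\<^sub>0 + of_real (t - t\<^sub>0) * \<rho> = z t" for t by (simp only: z_def)
      have "integral {t\<^sub>0..} (\<lambda>t. exp (of_real c * z t) * z t powr (s - 1)) =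
          integral {t\<^sub>0..} (\<lambda>t. exp (s * Ln (z t)) * (exp (of_real c * z t) / z t))"
        by (rule integral_cong) (simp add: z0 powr_minus_1_conv_exp_Ln)
      then show ?thesis unfolding V_def zt by simp
    qed
    finally have V: "(- of_real \<sigma> * \<i>) * integral {t\<^sub>0..} (\<lambda>t. exp (of_real c * (of_real t\<^sub>0 + of_real (t - t\<^sub>0) * (- of_real \<sigma> * \<i>)))
       * (of_real t\<^sub>0 + of_real (t - t\<^sub>0) * (- of_real \<sigma> * \<i>)) powr (s - 1)) = V s" .
    have hol: "(\<lambda>u. exp (of_real c * u)) holomorphic_on {z. Re z > 0}"
      by (intro holomorphic_intros)
    have "norm (exp (of_real c * u)) \<le> 1 * exp (c * Re u)" for u by simp
    from has_reg_integral_inf_vertical[OF \<sigma> order_refl t0 less_imp_le[OF lam] hol this s]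
    show ?thesis by (simp only: V)
  qed
  ultimately show ?thesis by blast
qed

section \<open>Functions with a finite-order exponential expansion\<close>

text \<open>
  The behaviour at infinity of \<open>t \<mapsto> f (\<i> t)\<close> and of \<open>t \<mapsto> f (\<i> / t)\<close> for a quasi-modular form \<open>f\<close>:
  Laurent series in \<open>exp (- 2 \<pi> t)\<close>, multiplied by powers of \<open>t\<close>. This class is closed under
  differentiation, whereas quasi-modularity itself would need the derivative of the transformation law.
\<close>
inductive qexp_type :: "(real \<Rightarrow> complex) \<Rightarrow> bool" where
  basic: "\<phi> analytic_on {0} \<Longrightarrow> qexp_type (\<lambda>t. of_real t powi m *
     (exp (of_real (2 * pi * real n) * of_real t) * \<phi> (exp (- of_real (2 * pi) * of_real t))))"
| add: "qexp_type g \<Longrightarrow> qexp_type h \<Longrightarrow> qexp_type (\<lambda>t. g t + h t)"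
| cong: "qexp_type g \<Longrightarrow> eventually (\<lambda>t. g t = h t) at_top \<Longrightarrow> qexp_type h"

lemma qexp_type_cmult: "qexp_type g \<Longrightarrow> qexp_type (\<lambda>t. c * g t)"
proof (induction rule: qexp_type.induct)
  case (basic \<phi> m n)
  have "(\<lambda>q. c * \<phi> q) analytic_on {0}" by (intro analytic_intros basic)
  from qexp_type.basic[OF this, of m n] show ?case by (simp add: mult_ac)
next
  case (add g h)
  from qexp_type.add[OF add.IH] show ?case by (simp add: distrib_left)
next
  case (cong g h)
  show ?case by (rule qexp_type.cong[OF cong.IH]) (use cong.hyps(2) in eventually_elim, simp)
qed

lemma qexp_type_powi: "qexp_type g \<Longrightarrow> qexp_type (\<lambda>t. of_real t powi j * g t)"
proof (induction rule: qexp_type.induct)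
  case (basic \<phi> m n)
  show ?case
    by (rule qexp_type.cong[OF qexp_type.basic[OF basic, of "j + m" n]])
       (use eventually_gt_at_top[of 0] in eventually_elim, simp add: power_int_add mult_ac)
next
  case (add g h)
  from qexp_type.add[OF add.IH] show ?case by (simp add: distrib_left)
next
  case (cong g h)
  show ?case by (rule qexp_type.cong[OF cong.IH]) (use cong.hyps(2) in eventually_elim, simp)
qed

lemma qexp_type_const: "qexp_type (\<lambda>_. c)"
proof -
  have "(\<lambda>_. c) analytic_on {0}" by (rule analytic_on_const)
  from qexp_type.basic[OF this, of 0 0] show ?thesis by simp
qed

lemma qexp_type_sum:
  assumes "\<And>i. i \<in> I \<Longrightarrow> qexp_type (g i)"
  shows "qexp_type (\<lambda>t. \<Sum>i\<in>I. g i t)"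
  using assms
proof (induction I rule: infinite_finite_induct)
  case (insert x F)
  then show ?case using qexp_type.add[of "g x" "\<lambda>t. \<Sum>i\<in>F. g i t"] by simp
qed (auto simp: qexp_type_const)

lemma eventually_exp_in_ball:
  assumes "r > 0"
  shows "eventually (\<lambda>t. exp (- of_real (2 * pi) * of_real t) \<in> ball (0 :: complex) r) at_top"
  using eventually_gt_at_top[of "- ln r / (2 * pi)"]
proof eventually_elim
  case (elim t)
  then have "- (2 * pi * t) < ln r" by (simp add: field_simps)
  then have "exp (- (2 * pi * t)) < r" using assms by (metis exp_less_mono exp_ln)
  then show ?case by simp
qed

text \<open>With q = exp (- 2 pi t) one has d/dt \<phi>(q) = - 2 pi q \<phi>'(q), so a basic term
  differentiates into two basic terms. The derivative is asserted only eventually because \<phi> is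
  analytic only near q = 0.\<close>

lemma qexp_type_has_derivative:
  "qexp_type g \<Longrightarrow>
     \<exists>g'. qexp_type g' \<and> eventually (\<lambda>t. (g has_vector_derivative g' t) (at t)) at_top"
proof (induction rule: qexp_type.induct)
  case (basic \<phi> m n)
  obtain r where r: "r > 0" "\<phi> holomorphic_on ball 0 r"
    using basic by (auto simp: analytic_on_def)
  define N where "N = complex_of_real (2 * pi * real n)"
  define P where "P = complex_of_real (2 * pi)"
  \<comment> \<open>The part of the product rule that keeps the power t^m: N from the exponential,
    and - P q \<phi>' from the inner function q.\<close>
  define \<xi> where "\<xi> = (\<lambda>q. N * \<phi> q - P * q * deriv \<phi> q)"
  have d: "deriv \<phi> analytic_on {0}" using basic by (rule analytic_deriv)
  have \<xi>: "\<xi> analytic_on {0}" unfolding \<xi>_def by (intro analytic_intros basic d)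
  have \<phi>m: "(\<lambda>q. of_int m * \<phi> q) analytic_on {0}" by (intro analytic_intros basic)
  define g' where "g' = (\<lambda>t. of_real t powi (m - 1) * (exp (N * of_real t) * (of_int m * \<phi> (exp (- P * of_real t))))
      + of_real t powi m * (exp (N * of_real t) * \<xi> (exp (- P * of_real t))))"
  have "qexp_type g'"
    unfolding g'_def N_def P_def by (intro qexp_type.add qexp_type.basic[OF \<xi>] qexp_type.basic[OF \<phi>m])
  moreover have "eventually (\<lambda>t. ((\<lambda>t. of_real t powi m * (exp (N * of_real t) * \<phi> (exp (- P * of_real t))))
     has_vector_derivative g' t) (at t)) at_top"
    using eventually_exp_in_ball[OF r(1)] eventually_gt_at_top[of 0]
  proof eventually_elim
    case (elim t)
    have "(\<phi> has_field_derivative deriv \<phi> (exp (- P * of_real t))) (at (exp (- P * of_real t)))"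
      using r(2) elim(1) unfolding P_def by (intro holomorphic_derivI) auto
    moreover have "((\<lambda>z. exp (- P * z)) has_field_derivative - P * exp (- P * of_real t)) (at (of_real t))"
      by (auto intro!: derivative_eq_intros)
    ultimately have D: "((\<lambda>z. \<phi> (exp (- P * z))) has_field_derivative
        deriv \<phi> (exp (- P * of_real t)) * (- P * exp (- P * of_real t))) (at (of_real t))"
      by (rule DERIV_chain2[where f = \<phi> and g = "\<lambda>z. exp (- P * z)"])
    have d1: "((\<lambda>z. z powi m) has_field_derivative of_int m * of_real t powi (m - 1)) (at (complex_of_real t))"
      using elim DERIV_power_int[OF DERIV_ident, of m "complex_of_real t" UNIV] by simp
    have d2: "((\<lambda>z. exp (N * z)) has_field_derivative N * exp (N * of_real t)) (at (of_real t))"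
      by (auto intro!: derivative_eq_intros)
    show ?case
    proof (rule has_vector_derivative_real_field)
      show "((\<lambda>z. z powi m * (exp (N * z) * \<phi> (exp (- P * z)))) has_field_derivative g' t) (at (of_real t))"
        unfolding g'_def \<xi>_def
        by (rule DERIV_cong[OF DERIV_mult[OF d1 DERIV_mult[OF d2 D]]]) (simp add: algebra_simps)
    qed
  qed
  ultimately show ?case unfolding N_def P_def by blast
next
  case (add g h)
  then obtain g' h' where *: "qexp_type g'" "qexp_type h'"
    "eventually (\<lambda>t. (g has_vector_derivative g' t) (at t)) at_top"
    "eventually (\<lambda>t. (h has_vector_derivative h' t) (at t)) at_top" by blast
  have "eventually (\<lambda>t. ((\<lambda>t. g t + h t) has_vector_derivative (g' t + h' t)) (at t)) at_top"
    using *(3,4) by eventually_elim (rule has_vector_derivative_add)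
  with qexp_type.add[OF *(1,2)] show ?case by blast
next
  case (cong g h)
  then obtain g' where *: "qexp_type g'"
    "eventually (\<lambda>t. (g has_vector_derivative g' t) (at t)) at_top" by blast
  obtain T where T: "\<And>t. t \<ge> T \<Longrightarrow> g t = h t"
    using cong.hyps(2) by (auto simp: eventually_at_top_linorder)
  have "eventually (\<lambda>t. (h has_vector_derivative g' t) (at t)) at_top"
    using *(2) eventually_gt_at_top[of T]
  proof eventually_elim
    case (elim t)
    show ?case
      by (rule has_vector_derivative_transform_within_open[OF elim(1), of "{T<..}"])
         (use elim(2) T in auto)
  qed
  with *(1) show ?case by blast
qed

text \<open>Splitting off the constant term leaves a factor q, which lowers the order of growth at
  infinity by one. The identity holds for every q, also where \<phi> is not analytic, because \<psi>
  is the difference quotient itself.\<close>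

lemma analytic_at_0_split:
  fixes \<phi> :: "complex \<Rightarrow> complex"
  assumes "\<phi> analytic_on {0}"
  obtains \<psi> where "\<psi> analytic_on {0}" "\<And>q. \<phi> q = \<phi> 0 + q * \<psi> q"
proof
  define \<psi> where "\<psi> = (\<lambda>q. if q = 0 then deriv \<phi> 0 else (\<phi> q - \<phi> 0) / q)"
  have an: "(\<lambda>q. \<phi> q - \<phi> 0) analytic_on {0}" by (intro analytic_intros assms)
  have "deriv (\<lambda>q. \<phi> q - \<phi> 0) 0 = deriv \<phi> 0 - 0"
    by (subst deriv_diff) (use assms in \<open>auto intro: analytic_on_imp_differentiable_at\<close>)
  then show "\<psi> analytic_on {0}"
    by (intro pole_theorem_analytic_0[OF an, where a = 0]) (auto simp: \<psi>_def intro!: exI[of _ 1])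
  show "\<phi> q = \<phi> 0 + q * \<psi> q" for q by (simp add: \<psi>_def)
qed

section \<open>Meromorphic dependence on s of the piece at infinity\<close>

lemma entire_imp_meromorphic: "f holomorphic_on UNIV \<Longrightarrow> f meromorphic_on UNIV"
  by (simp add: analytic_on_open analytic_on_imp_meromorphic_on)

lemma meromorphic_on_UNIV_shift:
  assumes "V meromorphic_on UNIV"
  shows "(\<lambda>s. V (s + c)) meromorphic_on UNIV"
  by (rule meromorphic_on_compose[OF assms]) (auto intro!: analytic_intros)

definition mellin_regularizable :: "real \<Rightarrow> real \<Rightarrow> (real \<Rightarrow> complex) \<Rightarrow> real \<Rightarrow> bool" where
  "mellin_regularizable \<sigma> M g t\<^sub>0 \<longleftrightarrow> (\<exists>V. V meromorphic_on UNIV \<and>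
     (\<forall>s. Re s < M \<longrightarrow> has_reg_integral_inf \<sigma> (\<lambda>t. g t * of_real t powr (s - 1)) t\<^sub>0 (V s)))"

lemma mellin_regularizable_add:
  assumes "mellin_regularizable \<sigma> M g t\<^sub>0" "mellin_regularizable \<sigma> M' h t\<^sub>0"
  shows "mellin_regularizable \<sigma> (min M M') (\<lambda>t. g t + h t) t\<^sub>0"
proof -
  obtain V W where V: "V meromorphic_on UNIV" "W meromorphic_on UNIV"
    "\<And>s. Re s < M \<Longrightarrow> has_reg_integral_inf \<sigma> (\<lambda>t. g t * of_real t powr (s - 1)) t\<^sub>0 (V s)"
    "\<And>s. Re s < M' \<Longrightarrow> has_reg_integral_inf \<sigma> (\<lambda>t. h t * of_real t powr (s - 1)) t\<^sub>0 (W s)"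
    using assms unfolding mellin_regularizable_def by blast
  then show ?thesis unfolding mellin_regularizable_def
    using has_reg_integral_inf_add[OF V(3,4)]
    by (intro exI[of _ "\<lambda>s. V s + W s"]) (auto intro!: meromorphic_on_add simp: distrib_right)
qed

lemma mellin_regularizable_cmult:
  assumes "mellin_regularizable \<sigma> M g t\<^sub>0"
  shows "mellin_regularizable \<sigma> M (\<lambda>t. c * g t) t\<^sub>0"
proof -
  obtain V where V: "V meromorphic_on UNIV"
    "\<And>s. Re s < M \<Longrightarrow> has_reg_integral_inf \<sigma> (\<lambda>t. g t * of_real t powr (s - 1)) t\<^sub>0 (V s)"
    using assms unfolding mellin_regularizable_def by blast
  then show ?thesis unfolding mellin_regularizable_def
    using has_reg_integral_inf_cmult[OF V(2), of _ c]
    by (intro exI[of _ "\<lambda>s. c * V s"]) (auto intro!: meromorphic_on_mult simp: mult.assoc)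
qed

lemma mellin_regularizable_cong:
  assumes "mellin_regularizable \<sigma> M g t\<^sub>0" "\<And>t. t \<ge> t\<^sub>0 \<Longrightarrow> g t = h t"
  shows "mellin_regularizable \<sigma> M h t\<^sub>0"
proof -
  have "has_reg_integral_inf \<sigma> (\<lambda>t. g t * of_real t powr (s - 1)) t\<^sub>0 v \<longleftrightarrow>
        has_reg_integral_inf \<sigma> (\<lambda>t. h t * of_real t powr (s - 1)) t\<^sub>0 v" for s v
    by (rule has_reg_integral_inf_cong) (simp add: assms(2))
  with assms(1) show ?thesis unfolding mellin_regularizable_def by simp
qed

text \<open>A factor t^m is the same as a shift of s by m, which moves the half-plane of existence
  by m.\<close>

lemma mellin_regularizable_powi:
  assumes "mellin_regularizable \<sigma> M g t\<^sub>0" and t0: "t\<^sub>0 > 0"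
  shows "mellin_regularizable \<sigma> (M - of_int m) (\<lambda>t. of_real t powi m * g t) t\<^sub>0"
proof -
  obtain V where V: "V meromorphic_on UNIV"
    "\<And>s. Re s < M \<Longrightarrow> has_reg_integral_inf \<sigma> (\<lambda>t. g t * of_real t powr (s - 1)) t\<^sub>0 (V s)"
    using assms(1) unfolding mellin_regularizable_def by blast
  have "has_reg_integral_inf \<sigma> (\<lambda>t. of_real t powi m * g t * of_real t powr (s - 1)) t\<^sub>0 (V (s + of_int m))"
    if "Re s < M - of_int m" for s
  proof -
    have h: "has_reg_integral_inf \<sigma> (\<lambda>t. g t * of_real t powr (s + of_int m - 1)) t\<^sub>0 (V (s + of_int m))"
      by (rule V(2)) (use that in simp)
    have e: "g t * of_real t powr (s + of_int m - 1) = of_real t powi m * g t * of_real t powr (s - 1)"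
      if "t \<ge> t\<^sub>0" for t
    proof -
      have "complex_of_real t \<noteq> 0" using t0 that by auto
      then have "of_real t powr (s + of_int m - 1) = of_real t powi m * of_real t powr (s - 1)"
        by (simp add: algebra_simps flip: complex_powr_of_int powr_add)
      then show ?thesis by (simp only: mult_ac)
    qed
    show ?thesis by (rule iffD1[OF has_reg_integral_inf_cong[OF e] h])
  qed
  with meromorphic_on_UNIV_shift[OF V(1), of "of_int m"] show ?thesis
    unfolding mellin_regularizable_def by (intro exI[of _ "\<lambda>s. V (s + of_int m)"]) blast
qed

text \<open>The factor q gives the decay exp (- 2 pi Re z), uniformly in Im z, because \<psi> is
  bounded on a closed disc around 0.\<close>

lemma mellin_regularizable_vanishing_qexp:
  assumes \<sigma>: "\<sigma> \<in> {1, -1}" and \<psi>: "\<psi> analytic_on {0}"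
  shows "\<exists>T>0. \<forall>t\<^sub>0>T. mellin_regularizable \<sigma> 0
     (\<lambda>t. exp (- of_real (2 * pi) * of_real t) * \<psi> (exp (- of_real (2 * pi) * of_real t))) t\<^sub>0"
proof -
  obtain r where r: "r > 0" "\<psi> holomorphic_on ball 0 r"
    using \<psi> by (auto simp: analytic_on_def)
  have cb: "cball 0 (r / 2) \<subseteq> ball (0 :: complex) r" using r(1) by auto
  have "compact (\<psi> ` cball 0 (r / 2))"
    by (intro compact_continuous_image holomorphic_on_imp_continuous_on holomorphic_on_subset[OF r(2) cb]) auto
  from compact_imp_bounded[OF this] obtain B where "\<forall>x\<in>\<psi> ` cball 0 (r / 2). norm x \<le> B"
    unfolding bounded_iff by blast
  then have B: "norm (\<psi> q) \<le> B" if "norm q \<le> r / 2" for q using that by simp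
  \<comment> \<open>At Re z = - ln (r / 2) / (2 pi) one has |q| = r / 2; beyond it q stays in the
    disc where \<psi> is bounded by B.\<close>
  define T where "T = max 1 (- ln (r / 2) / (2 * pi))"
  have T: "T > 0" by (simp add: T_def)
  have q: "norm (exp (- of_real (2 * pi) * z)) < r / 2" if "Re z > T" for z
  proof -
    have "- ln (r / 2) / (2 * pi) < Re z" using that by (simp add: T_def)
    then have "- (2 * pi * Re z) < ln (r / 2)" by (simp add: field_simps)
    then have "exp (- (2 * pi * Re z)) < r / 2" using r(1) by (metis exp_less_mono exp_ln half_gt_zero)
    then show ?thesis by simp
  qed
  have hol: "(\<lambda>z. exp (- of_real (2 * pi) * z) * \<psi> (exp (- of_real (2 * pi) * z))) holomorphic_on {z. Re z > T}"
    by (intro holomorphic_intros holomorphic_on_compose_gen[OF _ r(2), unfolded o_def])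
       (use q r(1) in force)
  show ?thesis
  proof (intro exI[of _ T] conjI allI impI T)
    fix t\<^sub>0 assume t0: "t\<^sub>0 > T"
    have bd: "norm (exp (- of_real (2 * pi) * z) * \<psi> (exp (- of_real (2 * pi) * z))) \<le> B * exp (- (2 * pi) * Re z)"
      if "Re z \<ge> t\<^sub>0" for z
    proof -
      have "norm (\<psi> (exp (- of_real (2 * pi) * z))) \<le> B"
        using that t0 q[of z] by (intro B) auto
      then have "norm (exp (- of_real (2 * pi) * z)) * norm (\<psi> (exp (- of_real (2 * pi) * z))) \<le> exp (- (2 * pi) * Re z) * B"
        by (intro mult_mono) auto
      then show ?thesis by (simp add: norm_mult mult.commute)
    qed
    have "(2 * pi :: real) > 0" by simp
    from reg_integral_tail[OF \<sigma> less_imp_le[OF T] t0 this hol bd]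
    show "mellin_regularizable \<sigma> 0
       (\<lambda>t. exp (- of_real (2 * pi) * of_real t) * \<psi> (exp (- of_real (2 * pi) * of_real t))) t\<^sub>0"
      unfolding mellin_regularizable_def by (blast intro: entire_imp_meromorphic)
  qed
qed

lemma mellin_regularizable_exp:
  assumes \<sigma>: "\<sigma> \<in> {1, -1}" and t0: "t\<^sub>0 > 0"
  shows "mellin_regularizable \<sigma> 0 (\<lambda>t. exp (of_real (2 * pi * real n) * of_real t)) t\<^sub>0"
proof (cases "n = 0")
  case True
  have "(\<lambda>s. - (of_real t\<^sub>0 powr s / s)) meromorphic_on UNIV"
    using t0 by (intro meromorphic_intros analytic_on_imp_meromorphic_on analytic_intros) (auto simp: complex_nonpos_Reals_iff)
  then show ?thesis using reg_integral_const[OF \<sigma> t0] True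
    unfolding mellin_regularizable_def by (intro exI[of _ "\<lambda>s. - (of_real t\<^sub>0 powr s / s)"]) simp
next
  case False
  then have "2 * pi * real n > 0" by simp
  from reg_integral_exp[OF \<sigma> t0 this] show ?thesis
    unfolding mellin_regularizable_def by (blast intro: entire_imp_meromorphic)
qed

text \<open>Induction on the pole order n at infinity: \<phi>(q) / q^n = \<phi>(0) / q^n + \<psi>(q)
  / q^(n-1). Every step peels off one growing exponential; for n = 0 a constant and a decaying tail
  remain.\<close>

lemma mellin_regularizable_qexp:
  assumes \<sigma>: "\<sigma> \<in> {1, -1}"
  shows "\<phi> analytic_on {0} \<Longrightarrow> \<exists>T>0. \<forall>t\<^sub>0>T. mellin_regularizable \<sigma> 0
     (\<lambda>t. exp (of_real (2 * pi * real n) * of_real t) * \<phi> (exp (- of_real (2 * pi) * of_real t))) t\<^sub>0"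
proof (induction n arbitrary: \<phi>)
  case 0
  obtain \<psi> where \<psi>: "\<psi> analytic_on {0}" "\<And>q. \<phi> q = \<phi> 0 + q * \<psi> q"
    using analytic_at_0_split[OF 0] by blast
  obtain T where T: "T > 0" "\<And>t\<^sub>0. t\<^sub>0 > T \<Longrightarrow> mellin_regularizable \<sigma> 0
     (\<lambda>t. exp (- of_real (2 * pi) * of_real t) * \<psi> (exp (- of_real (2 * pi) * of_real t))) t\<^sub>0"
    using mellin_regularizable_vanishing_qexp[OF \<sigma> \<psi>(1)] by blast
  show ?case
  proof (intro exI[of _ T] conjI allI impI T(1))
    fix t\<^sub>0 assume t0: "t\<^sub>0 > T"
    then have "t\<^sub>0 > 0" using T(1) by simp
    note h = mellin_regularizable_add[OF mellin_regularizable_cmult[OF mellin_regularizable_exp[OF \<sigma> this, of 0], of "\<phi> 0"] T(2)[OF t0]]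
    show "mellin_regularizable \<sigma> 0
       (\<lambda>t. exp (of_real (2 * pi * real 0) * of_real t) * \<phi> (exp (- of_real (2 * pi) * of_real t))) t\<^sub>0"
    proof (rule mellin_regularizable_cong[OF h[unfolded min.idem]])
      show "\<phi> 0 * exp (of_real (2 * pi * real 0) * of_real t) +
          exp (- of_real (2 * pi) * of_real t) * \<psi> (exp (- of_real (2 * pi) * of_real t)) =
         exp (of_real (2 * pi * real 0) * of_real t) * \<phi> (exp (- of_real (2 * pi) * of_real t))" for t
        unfolding \<psi>(2)[of "exp (- of_real (2 * pi) * of_real t)"] by simp
    qed
  qed
next
  case (Suc n)
  obtain \<psi> where \<psi>: "\<psi> analytic_on {0}" "\<And>q. \<phi> q = \<phi> 0 + q * \<psi> q"
    using analytic_at_0_split[OF Suc.prems] by blast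
  obtain T where T: "T > 0" "\<And>t\<^sub>0. t\<^sub>0 > T \<Longrightarrow> mellin_regularizable \<sigma> 0
     (\<lambda>t. exp (of_real (2 * pi * real n) * of_real t) * \<psi> (exp (- of_real (2 * pi) * of_real t))) t\<^sub>0"
    using Suc.IH[OF \<psi>(1)] by blast
  show ?case
  proof (intro exI[of _ T] conjI allI impI T(1))
    fix t\<^sub>0 assume t0: "t\<^sub>0 > T"
    then have "t\<^sub>0 > 0" using T(1) by simp
    note h = mellin_regularizable_add[OF mellin_regularizable_cmult[OF mellin_regularizable_exp[OF \<sigma> this, of "Suc n"], of "\<phi> 0"] T(2)[OF t0]]
    show "mellin_regularizable \<sigma> 0
       (\<lambda>t. exp (of_real (2 * pi * real (Suc n)) * of_real t) * \<phi> (exp (- of_real (2 * pi) * of_real t))) t\<^sub>0"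
    proof (rule mellin_regularizable_cong[OF h[unfolded min.idem]])
      fix t
      have x: "exp (of_real (2 * pi * real n) * of_real t) =
          exp (of_real (2 * pi * real (Suc n)) * of_real t) * exp (- complex_of_real (2 * pi) * of_real t)"
        by (subst exp_add[symmetric]) (simp add: algebra_simps)
      show "\<phi> 0 * exp (of_real (2 * pi * real (Suc n)) * of_real t) +
          exp (of_real (2 * pi * real n) * of_real t) * \<psi> (exp (- of_real (2 * pi) * of_real t)) =
         exp (of_real (2 * pi * real (Suc n)) * of_real t) * \<phi> (exp (- of_real (2 * pi) * of_real t))"
        unfolding \<psi>(2)[of "exp (- of_real (2 * pi) * of_real t)"] x
        by (simp only: distrib_left mult_ac)
    qed
  qed
qed

lemma qexp_type_regularizable:
  assumes \<sigma>: "\<sigma> \<in> {1, -1}"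
  shows "qexp_type g \<Longrightarrow> \<exists>M T. T > 0 \<and> (\<forall>t\<^sub>0>T. mellin_regularizable \<sigma> M g t\<^sub>0)"
proof (induction rule: qexp_type.induct)
  case (basic \<phi> m n)
  from mellin_regularizable_qexp[OF \<sigma> basic, of n] obtain T where T: "T > 0" "\<And>t\<^sub>0. t\<^sub>0 > T \<Longrightarrow> mellin_regularizable \<sigma> 0
     (\<lambda>t. exp (of_real (2 * pi * real n) * of_real t) * \<phi> (exp (- of_real (2 * pi) * of_real t))) t\<^sub>0"
    by blast
  show ?case
    by (rule exI[of _ "0 - of_int m"], rule exI[of _ T], intro conjI allI impI T mellin_regularizable_powi)
       (use T(1) in auto)
next
  case (add g h)
  from add.IH obtain M T M' T' where *: "T > 0" "T' > 0"
    "\<And>t\<^sub>0. t\<^sub>0 > T \<Longrightarrow> mellin_regularizable \<sigma> M g t\<^sub>0" "\<And>t\<^sub>0. t\<^sub>0 > T' \<Longrightarrow> mellin_regularizable \<sigma> M' h t\<^sub>0" by blast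
  show ?case
    by (rule exI[of _ "min M M'"], rule exI[of _ "max T T'"], intro conjI allI impI mellin_regularizable_add *)
       (use *(1) in auto)
next
  case (cong g h)
  from cong.IH obtain M T where *: "T > 0" "\<And>t\<^sub>0. t\<^sub>0 > T \<Longrightarrow> mellin_regularizable \<sigma> M g t\<^sub>0" by blast
  obtain S where S: "\<And>t. t \<ge> S \<Longrightarrow> g t = h t"
    using cong.hyps(2) by (auto simp: eventually_at_top_linorder)
  show ?case
    by (rule exI[of _ M], rule exI[of _ "max T S"], intro conjI allI impI, use *(1) in simp)
       (rule mellin_regularizable_cong[OF *(2) S], auto)
qed

lemma holomorphic_Mellin_interval:
  fixes g :: "real \<Rightarrow> complex"
  assumes "0 < a" "continuous_on {a..b} g"
  shows "(\<lambda>s. integral {a..b} (\<lambda>t. g t * of_real t powr (s - 1))) holomorphic_on UNIV"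
proof -
  have "(\<lambda>s. integral {a..b} (\<lambda>t. exp (s * Ln (of_real t)) * (g t / of_real t))) holomorphic_on UNIV"
    using assms(1)
    by (intro holomorphic_integral_exp continuous_intros assms(2)) (auto simp: complex_nonpos_Reals_iff)
  moreover have "integral {a..b} (\<lambda>t. exp (s * Ln (of_real t)) * (g t / of_real t)) =
      integral {a..b} (\<lambda>t. g t * of_real t powr (s - 1))" for s
    by (rule integral_cong) (use assms(1) in \<open>simp add: powr_minus_1_conv_exp_Ln\<close>)
  ultimately show ?thesis by simp
qed

text \<open>The expansion is usable only beyond some T. The interval from t0 to there adds a
  function that is entire in s.\<close>

lemma qexp_type_reg_integral:
  assumes \<sigma>: "\<sigma> \<in> {1, -1}" and g: "qexp_type g" and t0: "t\<^sub>0 > 0" and c: "continuous_on {t\<^sub>0..} g"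
  shows "\<exists>V M. V meromorphic_on UNIV \<and>
     (\<forall>s. Re s < M \<longrightarrow> has_reg_integral_inf \<sigma> (\<lambda>t. g t * of_real t powr (s - 1)) t\<^sub>0 (V s))"
proof -
  from qexp_type_regularizable[OF \<sigma> g] obtain M T where T: "T > 0"
    "\<And>t\<^sub>0. t\<^sub>0 > T \<Longrightarrow> mellin_regularizable \<sigma> M g t\<^sub>0" by blast
  define T' where "T' = max t\<^sub>0 (T + 1)"
  obtain V where V: "V meromorphic_on UNIV"
     "\<And>s. Re s < M \<Longrightarrow> has_reg_integral_inf \<sigma> (\<lambda>t. g t * of_real t powr (s - 1)) T' (V s)"
  proof -
    have "T' > T" by (simp add: T'_def)
    from T(2)[OF this] show ?thesis using that unfolding mellin_regularizable_def by blast
  qed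
  have c': "continuous_on {t\<^sub>0..T'} g" by (rule continuous_on_subset[OF c]) auto
  let ?W = "\<lambda>s. V s + integral {t\<^sub>0..T'} (\<lambda>t. g t * of_real t powr (s - 1))"
  have "?W meromorphic_on UNIV"
    by (intro meromorphic_on_add V entire_imp_meromorphic holomorphic_Mellin_interval t0 c')
  moreover have "has_reg_integral_inf \<sigma> (\<lambda>t. g t * of_real t powr (s - 1)) t\<^sub>0 (?W s)" if "Re s < M" for s
    using t0 by (intro has_reg_integral_inf_extend V that continuous_intros c')
       (auto simp: T'_def complex_nonpos_Reals_iff)
  ultimately show ?thesis by blast
qed

text \<open>With \<tau> = i z one has q = exp (- 2 pi z). The expansion is kept for complex z, and
  not only on the axis, so that analyticity of F can be read off from it.\<close>

lemma qexpansion_complex: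
  assumes "meromorphic_at_ii_inf F"
  obtains \<phi> n Y where "\<phi> analytic_on {0}" "\<And>z. Re z > Y \<Longrightarrow>
     F (\<i> * z) = exp (of_real (2 * pi * real n) * z) * \<phi> (exp (- of_real (2 * pi) * z))"
proof -
  obtain a :: "int \<Rightarrow> complex" and n\<^sub>0 :: int and Y :: real where a: "\<And>\<tau>. Im \<tau> > Y \<Longrightarrow>
      ((\<lambda>n. a n * exp (2 * of_real pi * \<i> * of_int n * \<tau>)) has_sum F \<tau>) {-n\<^sub>0..}"
    using assms unfolding meromorphic_at_ii_inf_def by blast
  define c where "c = (\<lambda>j :: nat. a (int j - n\<^sub>0))"
  define q where "q = (\<lambda>z. exp (- complex_of_real (2 * pi) * z))"
  have bij: "bij_betw (\<lambda>j :: nat. int j - n\<^sub>0) UNIV {-n\<^sub>0..}"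
    by (rule bij_betwI[of _ _ _ "\<lambda>i. nat (i + n\<^sub>0)"]) auto
  have sums: "(\<lambda>j. c j * q z ^ j) sums (exp (- complex_of_real (2 * pi * of_int n\<^sub>0) * z) * F (\<i> * z))"
    if "Re z > Y" for z
  proof -
    have "((\<lambda>n. a n * exp (2 * of_real pi * \<i> * of_int n * (\<i> * z))) has_sum F (\<i> * z)) {-n\<^sub>0..}"
      by (rule a) (use that in simp)
    then have "((\<lambda>j. c j * exp (2 * of_real pi * \<i> * of_int (int j - n\<^sub>0) * (\<i> * z))) has_sum F (\<i> * z)) UNIV"
      unfolding c_def by (subst (asm) has_sum_reindex_bij_betw[OF bij, symmetric])
    then have s: "(\<lambda>j. c j * exp (2 * of_real pi * \<i> * of_int (int j - n\<^sub>0) * (\<i> * z))) sums F (\<i> * z)"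
      by (rule has_sum_imp_sums)
    have "exp (- complex_of_real (2 * pi * of_int n\<^sub>0) * z) *
       (c j * exp (2 * of_real pi * \<i> * of_int (int j - n\<^sub>0) * (\<i> * z))) = c j * q z ^ j" for j
    proof -
      have i: "\<i> * (\<i> * w) = - w" for w by (simp flip: mult.assoc)
      have "exp (- complex_of_real (2 * pi * of_int n\<^sub>0) * z) * exp (2 * of_real pi * \<i> * of_int (int j - n\<^sub>0) * (\<i> * z)) = q z ^ j"
        unfolding q_def exp_of_nat_mult[symmetric] exp_add[symmetric]
        by (rule arg_cong[where f = exp]) (simp add: algebra_simps i)
      then show ?thesis by (metis mult.left_commute)
    qed
    with sums_mult[OF s, of "exp (- complex_of_real (2 * pi * of_int n\<^sub>0) * z)"]
    show ?thesis by (simp only:)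
  qed
  define \<phi> where "\<phi> = (\<lambda>z. \<Sum>j. c j * z ^ j)"
  have \<phi>: "\<phi> analytic_on {0}"
  proof -
    \<comment> \<open>The series converges at this point, hence in the open disc of radius
      |q1|.\<close>
    define q1 where "q1 = q (of_real (Y + 1))"
    have s: "summable (\<lambda>j. c j * q1 ^ j)" using sums[of "of_real (Y + 1)"] by (simp add: sums_iff q1_def)
    have "\<phi> holomorphic_on ball 0 (norm q1)"
    proof (rule power_series_holomorphic[where a = c])
      fix w :: complex assume "w \<in> ball 0 (norm q1)"
      then have "summable (\<lambda>j. c j * w ^ j)" by (intro powser_inside[OF s]) simp
      then show "(\<lambda>n. c n * (w - 0) ^ n) sums \<phi> w" by (simp add: \<phi>_def summable_sums)
    qed
    then show ?thesis unfolding analytic_on_def by (auto simp: q1_def q_def intro!: exI[of _ "norm q1"])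
  qed
  \<comment> \<open>One of \<open>nat n\<^sub>0\<close> and \<open>nat (- n\<^sub>0)\<close> is 0:
    either there is a pole of order n0 at infinity, or a zero, which is absorbed into
    \<phi>'.\<close>
  define \<phi>' where "\<phi>' = (\<lambda>z. z ^ nat (- n\<^sub>0) * \<phi> z)"
  show ?thesis
  proof (rule that[of \<phi>' Y "nat n\<^sub>0"])
    show "\<phi>' analytic_on {0}" unfolding \<phi>'_def by (intro analytic_intros \<phi>)
    fix z assume z: "Re z > Y"
    have "\<phi> (q z) = exp (- complex_of_real (2 * pi * of_int n\<^sub>0) * z) * F (\<i> * z)"
      using sums[OF z] by (simp add: \<phi>_def sums_iff)
    moreover have "exp (of_real (2 * pi * real (nat n\<^sub>0)) * z) * q z ^ nat (- n\<^sub>0) * exp (- complex_of_real (2 * pi * of_int n\<^sub>0) * z) = exp 0"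
      unfolding q_def exp_of_nat_mult[symmetric] exp_add[symmetric]
      by (rule arg_cong[where f = exp]) (cases "n\<^sub>0 \<ge> 0"; simp add: algebra_simps)
    ultimately show "F (\<i> * z) = exp (of_real (2 * pi * real (nat n\<^sub>0)) * z) * \<phi>' (exp (- of_real (2 * pi) * z))"
      unfolding \<phi>'_def q_def by (simp only: mult_1_left exp_zero mult.assoc[symmetric])
  qed
qed

lemma qexp_type_of_qexpansion:
  assumes "meromorphic_at_ii_inf F"
  shows "qexp_type (\<lambda>t. F (\<i> * of_real t))"
proof -
  obtain \<phi> n Y where \<phi>: "\<phi> analytic_on {0}" "\<And>z. Re z > Y \<Longrightarrow>
     F (\<i> * z) = exp (of_real (2 * pi * real n) * z) * \<phi> (exp (- of_real (2 * pi) * z))"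
    using qexpansion_complex[OF assms] by metis
  show ?thesis
    by (rule qexp_type.cong[OF qexp_type.basic[OF \<phi>(1), of 0 n]])
       (use eventually_gt_at_top[of Y] in eventually_elim, simp add: \<phi>(2))
qed

text \<open>The expansion represents F at every point of large imaginary part. This excludes not
  only poles there but also removable singularities with a wrong value.\<close>

lemma analytic_of_qexpansion:
  assumes "meromorphic_at_ii_inf F"
  obtains Y where "Y > 0" "\<And>\<tau>. Im \<tau> > Y \<Longrightarrow> F analytic_on {\<tau>}"
proof -
  obtain \<phi> n Y where \<phi>: "\<phi> analytic_on {0}" "\<And>z. Re z > Y \<Longrightarrow>
     F (\<i> * z) = exp (of_real (2 * pi * real n) * z) * \<phi> (exp (- of_real (2 * pi) * z))"
    using qexpansion_complex[OF assms] by metis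
  obtain r where r: "r > 0" "\<phi> holomorphic_on ball 0 r"
    using \<phi>(1) by (auto simp: analytic_on_def)
  define T where "T = max (max 1 Y) (- ln r / (2 * pi))"
  define S where "S = {\<tau>. Im \<tau> > T}"
  have S: "open S" unfolding S_def by (intro open_Collect_less continuous_intros)
  have "(\<lambda>\<tau>. exp (of_real (2 * pi * real n) * (- \<i> * \<tau>)) * \<phi> (exp (- of_real (2 * pi) * (- \<i> * \<tau>)))) holomorphic_on S"
  proof (intro holomorphic_intros holomorphic_on_compose_gen[OF _ r(2), unfolded o_def] image_subsetI)
    fix \<tau> assume "\<tau> \<in> S"
    then have "- ln r / (2 * pi) < Im \<tau>" by (simp add: S_def T_def)
    then have "- (2 * pi * Im \<tau>) < ln r" by (simp add: field_simps)
    then have "exp (- (2 * pi * Im \<tau>)) < r" using r(1) by (metis exp_less_mono exp_ln)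
    then show "exp (- of_real (2 * pi) * (- \<i> * \<tau>)) \<in> ball 0 r" by simp
  qed
  moreover have "exp (of_real (2 * pi * real n) * (- \<i> * \<tau>)) * \<phi> (exp (- of_real (2 * pi) * (- \<i> * \<tau>))) = F \<tau>"
    if "\<tau> \<in> S" for \<tau>
  proof -
    have "\<i> * (- \<i> * \<tau>) = \<tau>" by (simp flip: mult.assoc)
    moreover have "Re (- \<i> * \<tau>) > Y" using that by (simp add: S_def T_def)
    ultimately show ?thesis using \<phi>(2)[of "- \<i> * \<tau>"] by simp
  qed
  ultimately have "F holomorphic_on S" by (rule holomorphic_transform)
  then have "F analytic_on {\<tau>}" if "Im \<tau> > T" for \<tau>
    using S that by (auto simp: analytic_at S_def)
  then show ?thesis by (intro that[of T]) (auto simp: T_def)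
qed

section \<open>Regularized integrals across a pole\<close>

text \<open>The difference is either zero off a sparse set or nonzero off a sparse set, and the
  second is impossible near a point of \<open>S\<close>.\<close>

lemma meromorphic_identity:
  assumes f: "f meromorphic_on UNIV" and g: "g meromorphic_on UNIV"
    and eq: "\<And>s. s \<in> S \<Longrightarrow> f s = g s" and S: "open S" "S \<noteq> {}"
  shows "\<forall>\<^sub>\<approx>s. f s = g s"
proof -
  have "(\<lambda>s. f s - g s) meromorphic_on UNIV" by (intro meromorphic_intros f g)
  from meromorphic_imp_constant_or_avoid[OF this open_UNIV connected_UNIV, of 0]
  consider "\<forall>\<^sub>\<approx>s. f s - g s = 0" | "\<forall>\<^sub>\<approx>s. f s - g s \<noteq> 0" by blast
  then show ?thesis
  proof cases
    case 1
    then show ?thesis by simp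
  next
    case 2
    obtain z where z: "z \<in> S" using S by auto
    from 2 have 3: "\<forall>\<^sub>F s in at z. f s - g s \<noteq> 0"
      by (rule eventually_cosparse_imp_eventually_at) auto
    have "\<forall>\<^sub>F s in at z. s \<in> S" using S z by (intro eventually_at_in_open') auto
    with 3 have "\<forall>\<^sub>F s in at z. False"
      by eventually_elim (use eq in auto)
    then show ?thesis by simp
  qed
qed

lemma meromorphic_identity_right:
  assumes "f meromorphic_on UNIV" "g meromorphic_on UNIV" "\<And>s. Re s > M \<Longrightarrow> f s = g s"
  shows "\<forall>\<^sub>\<approx>s. f s = g s"
proof (rule meromorphic_identity[OF assms(1,2), of "{s. Re s > M}"])
  have "of_real (M + 1) \<in> {s. Re s > M}" by simp
  then show "{s. Re s > M} \<noteq> {}" by blast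
qed (use assms(3) in \<open>auto intro!: open_Collect_less continuous_intros\<close>)

lemma meromorphic_identity_left:
  assumes "f meromorphic_on UNIV" "g meromorphic_on UNIV" "\<And>s. Re s < M \<Longrightarrow> f s = g s"
  shows "\<forall>\<^sub>\<approx>s. f s = g s"
proof (rule meromorphic_identity[OF assms(1,2), of "{s. Re s < M}"])
  have "of_real (M - 1) \<in> {s. Re s < M}" by simp
  then show "{s. Re s < M} \<noteq> {}" by blast
qed (use assms(3) in \<open>auto intro!: open_Collect_less continuous_intros\<close>)

section \<open>Finite parts with one singular point\<close>

lemma entire_imp_analytic: "f holomorphic_on UNIV \<Longrightarrow> f analytic_on S"
  by (rule analytic_on_subset[of _ UNIV]) (simp_all add: analytic_on_open)

text \<open>The case of \<open>has_reg_integral_pole\<close> in which the continuation has no pole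
  at u = 0. The constant Laurent term is then the value \<open>G 0\<close>, so that sums and
  multiples need no manipulation of Laurent series.\<close>

definition has_finite_part :: "(real \<Rightarrow> complex) \<Rightarrow> real \<Rightarrow> real \<Rightarrow> real \<Rightarrow> complex \<Rightarrow> bool" where
  "has_finite_part g a b c v \<longleftrightarrow>
     (\<exists>(G :: complex \<Rightarrow> complex) (M :: real).
        G meromorphic_on UNIV \<and> G analytic_on {0} \<and> G 0 = v \<and>
        (\<forall>u. Re u > M \<longrightarrow> ((\<lambda>t. of_real \<bar>t - c\<bar> powr u * g t) has_integral G u) {a..b}))"

lemma has_finite_part_imp_reg_integral:
  assumes "has_finite_part g a b c v"
  shows "has_reg_integral_pole g a b c v"
proof -
  from assms obtain G M where G: "G meromorphic_on UNIV" "G analytic_on {0}" "G 0 = v"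
    "\<And>u. Re u > M \<Longrightarrow> ((\<lambda>t. of_real \<bar>t - c\<bar> powr u * g t) has_integral G u) {a..b}"
    unfolding has_finite_part_def by blast
  have e: "G has_fps_expansion fps_expansion G 0"
    by (rule analytic_at_imp_has_fps_expansion_0[OF G(2)])
  then have "(\<lambda>w. G (0 + w)) has_laurent_expansion fps_to_fls (fps_expansion G 0)"
    unfolding add_0 by (rule has_laurent_expansion_fps)
  then have "laurent_expansion G 0 = fps_to_fls (fps_expansion G 0)"
    by (rule laurent_expansion_eqI)
  then have "fls_nth (laurent_expansion G 0) 0 = v"
    by (simp add: fps_expansion_def G(3))
  then show ?thesis unfolding has_reg_integral_pole_def
    by (intro exI[of _ G] exI[of _ M] conjI allI impI G(1,4)) auto
qed

lemma has_reg_integral_pole_unique: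
  assumes "has_reg_integral_pole g a b c v" "has_reg_integral_pole g a b c w"
  shows "v = w"
proof -
  from assms(1) obtain G M where G: "G meromorphic_on UNIV"
    "\<And>u. Re u > M \<Longrightarrow> ((\<lambda>t. of_real \<bar>t - c\<bar> powr u * g t) has_integral G u) {a..b}"
    "v = fls_nth (laurent_expansion G 0) 0"
    unfolding has_reg_integral_pole_def by blast
  from assms(2) obtain H N where H: "H meromorphic_on UNIV"
    "\<And>u. Re u > N \<Longrightarrow> ((\<lambda>t. of_real \<bar>t - c\<bar> powr u * g t) has_integral H u) {a..b}"
    "w = fls_nth (laurent_expansion H 0) 0"
    unfolding has_reg_integral_pole_def by blast
  have "\<forall>\<^sub>\<approx>u. G u = H u"
  proof (rule meromorphic_identity_right[OF G(1) H(1)])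
    show "G u = H u" if "Re u > max M N" for u
      by (rule has_integral_unique[OF G(2) H(2)]) (use that in simp_all)
  qed
  then have ev: "\<forall>\<^sub>F u in at 0. G u = H u"
    by (rule eventually_cosparse_imp_eventually_at) auto
  have "(\<lambda>u. H (0 + u)) has_laurent_expansion laurent_expansion H 0"
    by (rule meromorphic_on_imp_has_laurent_expansion[OF H(1)]) auto
  then have "(\<lambda>u. G (0 + u)) has_laurent_expansion laurent_expansion H 0"
    by (rule iffD2[OF has_laurent_expansion_cong[OF _ refl], rotated]) (simp add: ev)
  then have "laurent_expansion G 0 = laurent_expansion H 0" by (rule laurent_expansion_eqI)
  then show ?thesis unfolding G(3) H(3) by (rule arg_cong)
qed

lemma has_finite_part_cong:
  assumes "has_finite_part g a b c v" "\<And>t. a \<le> t \<Longrightarrow> t \<le> b \<Longrightarrow> t \<noteq> c \<Longrightarrow> g t = h t"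
  shows "has_finite_part h a b c v"
proof -
  from assms(1) obtain G M where G: "G meromorphic_on UNIV" "G analytic_on {0}" "G 0 = v"
    "\<And>u. Re u > M \<Longrightarrow> ((\<lambda>t. of_real \<bar>t - c\<bar> powr u * g t) has_integral G u) {a..b}"
    unfolding has_finite_part_def by blast
  have "((\<lambda>t. of_real \<bar>t - c\<bar> powr u * h t) has_integral G u) {a..b}" if "Re u > M" for u
  proof (rule has_integral_eq[OF _ G(4)[OF that]])
    fix t assume t: "t \<in> {a..b}"
    show "of_real \<bar>t - c\<bar> powr u * g t = of_real \<bar>t - c\<bar> powr u * h t"
    \<comment> \<open>At t = c the weight is \<open>0 powr u = 0\<close>, so the values of g and h
      at the singular point do not enter.\<close>
    proof (cases "t = c")
      case False
      with t assms(2)[of t] show ?thesis by simp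
    qed simp
  qed
  with G(1-3) show ?thesis unfolding has_finite_part_def by blast
qed

lemma has_finite_part_add:
  assumes "has_finite_part g a b c v" "has_finite_part h a b c w"
  shows "has_finite_part (\<lambda>t. g t + h t) a b c (v + w)"
proof -
  from assms(1) obtain G M where G: "G meromorphic_on UNIV" "G analytic_on {0}" "G 0 = v"
    "\<And>u. Re u > M \<Longrightarrow> ((\<lambda>t. of_real \<bar>t - c\<bar> powr u * g t) has_integral G u) {a..b}"
    unfolding has_finite_part_def by blast
  from assms(2) obtain H N where H: "H meromorphic_on UNIV" "H analytic_on {0}" "H 0 = w"
    "\<And>u. Re u > N \<Longrightarrow> ((\<lambda>t. of_real \<bar>t - c\<bar> powr u * h t) has_integral H u) {a..b}"
    unfolding has_finite_part_def by blast
  have "((\<lambda>t. of_real \<bar>t - c\<bar> powr u * (g t + h t)) has_integral G u + H u) {a..b}"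
    if "Re u > max M N" for u
    using has_integral_add[OF G(4) H(4), of u] that by (simp add: distrib_left)
  then show ?thesis unfolding has_finite_part_def
    using G(1-3) H(1-3)
    by (intro exI[of _ "\<lambda>u. G u + H u"] exI[of _ "max M N"])
       (auto intro!: meromorphic_intros analytic_intros)
qed

lemma has_finite_part_cmult:
  assumes "has_finite_part g a b c v"
  shows "has_finite_part (\<lambda>t. k * g t) a b c (k * v)"
proof -
  from assms(1) obtain G M where G: "G meromorphic_on UNIV" "G analytic_on {0}" "G 0 = v"
    "\<And>u. Re u > M \<Longrightarrow> ((\<lambda>t. of_real \<bar>t - c\<bar> powr u * g t) has_integral G u) {a..b}"
    unfolding has_finite_part_def by blast
  have "((\<lambda>t. of_real \<bar>t - c\<bar> powr u * (k * g t)) has_integral k * G u) {a..b}"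
    if "Re u > M" for u
    using has_integral_mult_right[OF G(4)[OF that], of k] by (simp add: mult.left_commute)
  then show ?thesis unfolding has_finite_part_def
    using G(1-3)
    by (intro exI[of _ "\<lambda>u. k * G u"] exI[of _ M]) (auto intro!: meromorphic_intros analytic_intros)
qed

lemma abs_powr_integral_entire:
  fixes g :: "real \<Rightarrow> complex"
  assumes c: "c \<notin> {a..b}" and g: "continuous_on {a..b} g"
  shows "(\<lambda>u. integral {a..b} (\<lambda>t. of_real \<bar>t - c\<bar> powr u * g t)) holomorphic_on UNIV"
    and "(\<lambda>t. of_real \<bar>t - c\<bar> powr u * g t) integrable_on {a..b}"
    and "integral {a..b} (\<lambda>t. of_real \<bar>t - c\<bar> powr 0 * g t) = integral {a..b} g"
proof -
  have n: "\<bar>t - c\<bar> \<noteq> 0" if "t \<in> {a..b}" for t using that c by auto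
  have "(\<lambda>u. integral {a..b} (\<lambda>t. exp (u * of_real (ln \<bar>t - c\<bar>)) * g t)) holomorphic_on UNIV"
    using n by (intro holomorphic_integral_exp continuous_intros g) auto
  moreover have e: "of_real \<bar>t - c\<bar> powr u * g t = exp (u * of_real (ln \<bar>t - c\<bar>)) * g t"
    if "t \<in> {a..b}" for t u
    using n[OF that] by (auto simp add: powr_def Ln_of_real simp del: of_real_diff)
  have i: "integral {a..b} (\<lambda>t. exp (u * of_real (ln \<bar>t - c\<bar>)) * g t) =
      integral {a..b} (\<lambda>t. of_real \<bar>t - c\<bar> powr u * g t)" for u
    by (rule integral_cong) (simp add: e)
  ultimately show "(\<lambda>u. integral {a..b} (\<lambda>t. of_real \<bar>t - c\<bar> powr u * g t)) holomorphic_on UNIV"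
    by simp
  have "(\<lambda>t. exp (u * of_real (ln \<bar>t - c\<bar>)) * g t) integrable_on {a..b}"
    using n by (intro integrable_continuous_interval continuous_intros g) auto
  then show "(\<lambda>t. of_real \<bar>t - c\<bar> powr u * g t) integrable_on {a..b}"
    by (rule integrable_eq) (simp add: e)
  show "integral {a..b} (\<lambda>t. of_real \<bar>t - c\<bar> powr 0 * g t) = integral {a..b} g"
    unfolding i[of 0, symmetric] by simp
qed

text \<open>Away from c the weight is exp (u ln |t - c|), so the outer intervals contribute entire
  functions of u, with the ordinary integrals as values at u = 0.\<close>

lemma has_finite_part_extend:
  assumes g: "has_finite_part g a b c v" and le: "a' \<le> a" "a < c" "c < b" "b \<le> b'"
    and cg: "continuous_on {a'..a} g" "continuous_on {b..b'} g"
  shows "has_finite_part g a' b' c (v + integral {a'..a} g + integral {b..b'} g)"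
proof -
  from g obtain G M where G: "G meromorphic_on UNIV" "G analytic_on {0}" "G 0 = v"
    "\<And>u. Re u > M \<Longrightarrow> ((\<lambda>t. of_real \<bar>t - c\<bar> powr u * g t) has_integral G u) {a..b}"
    unfolding has_finite_part_def by blast
  define L where "L = (\<lambda>u. integral {a'..a} (\<lambda>t. of_real \<bar>t - c\<bar> powr u * g t))"
  define R where "R = (\<lambda>u. integral {b..b'} (\<lambda>t. of_real \<bar>t - c\<bar> powr u * g t))"
  have ca: "c \<notin> {a'..a}" and cb: "c \<notin> {b..b'}" using le by auto
  note l = abs_powr_integral_entire[OF ca cg(1)]
  note r = abs_powr_integral_entire[OF cb cg(2)]
  have "((\<lambda>t. of_real \<bar>t - c\<bar> powr u * g t) has_integral (L u + G u) + R u) {a'..b'}"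
    if "Re u > M" for u
  proof (rule has_integral_combine[of a' b b'])
    show "((\<lambda>t. of_real \<bar>t - c\<bar> powr u * g t) has_integral L u + G u) {a'..b}"
      by (rule has_integral_combine[of a' a b])
         (use le G(4)[OF that] l(2)[of u] in \<open>auto simp: L_def simp del: of_real_diff intro: integrable_integral\<close>)
  qed (use le r(2)[of u] in \<open>auto simp: R_def simp del: of_real_diff intro: integrable_integral\<close>)
  moreover have "(\<lambda>u. (L u + G u) + R u) meromorphic_on UNIV"
    unfolding L_def R_def
    by (intro meromorphic_on_add G(1) entire_imp_meromorphic[OF l(1)] entire_imp_meromorphic[OF r(1)])
  moreover have "(\<lambda>u. (L u + G u) + R u) analytic_on {0}"
    unfolding L_def R_def
    by (intro analytic_on_add G(2) entire_imp_analytic[OF l(1)] entire_imp_analytic[OF r(1)])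
  moreover have "(L 0 + G 0) + R 0 = v + integral {a'..a} g + integral {b..b'} g"
    unfolding L_def R_def l(3) r(3) G(3) by simp
  ultimately show ?thesis unfolding has_finite_part_def
    by (intro exI[of _ "\<lambda>u. (L u + G u) + R u"] exI[of _ M] conjI allI impI)
qed

text \<open>With w = u + j + 1 the primitives on the two sides of c are multiples of |t - c| powr w
  / w. They vanish at c as Re w > 0, and the left side carries the sign (-1)^j.\<close>

lemma has_integral_abs_powr_mult_powi:
  assumes ab: "a < c" "c < b" and u: "Re u + real_of_int j + 1 > 0"
  shows "((\<lambda>t. of_real \<bar>t - c\<bar> powr u * of_real (t - c) powi j) has_integral
     ((-1) powi j * of_real (c - a) powr (u + of_int j + 1) + of_real (b - c) powr (u + of_int j + 1))
       / (u + of_int j + 1)) {a..b}"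
proof -
  define w where "w = u + of_int j + 1"
  have w: "Re w > 0" "w \<noteq> 0" using u by (auto simp: w_def complex_eq_iff)
  have w1: "w - 1 = u + of_int j" by (simp add: w_def)
  have R: "((\<lambda>t. of_real \<bar>t - c\<bar> powr u * of_real (t - c) powi j) has_integral
     (of_real (b - c) powr w / w - of_real (c - c) powr w / w)) {c..b}"
  proof (rule fundamental_theorem_of_calculus_interior)
    show "continuous_on {c..b} (\<lambda>t. of_real (t - c) powr w / w)"
      using w by (intro continuous_intros) auto
    fix t assume t: "t \<in> {c<..<b}"
    have "((\<lambda>t. of_real (t - c) powr w / w) has_vector_derivative of_real (t - c) powr (w - 1)) (at t)"
    proof -
      have "((\<lambda>z. (z - of_real c) powr w / w) has_field_derivative (of_real t - of_real c) powr (w - 1)) (at (of_real t))"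
        using t w by (auto intro!: derivative_eq_intros simp: complex_nonpos_Reals_iff)
      from has_vector_derivative_real_field[OF this] show ?thesis by simp
    qed
    moreover have "of_real (t - c) powr (w - 1) = of_real \<bar>t - c\<bar> powr u * (of_real (t - c) :: complex) powi j"
      using t unfolding w1 by (simp add: powr_add complex_powr_of_int del: of_real_diff)
    ultimately show "((\<lambda>t. of_real (t - c) powr w / w) has_vector_derivative
        of_real \<bar>t - c\<bar> powr u * of_real (t - c) powi j) (at t)" by (simp only:)
  qed (use ab in auto)
  have L: "((\<lambda>t. of_real \<bar>t - c\<bar> powr u * of_real (t - c) powi j) has_integral
     (- ((-1) powi j * of_real (c - c) powr w / w) - - ((-1) powi j * of_real (c - a) powr w / w))) {a..c}"
  proof (rule fundamental_theorem_of_calculus_interior)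
    show "continuous_on {a..c} (\<lambda>t. - ((-1) powi j * of_real (c - t) powr w / w))"
      using w by (intro continuous_intros) auto
    fix t assume t: "t \<in> {a<..<c}"
    have "((\<lambda>t. - ((-1) powi j * of_real (c - t) powr w / w)) has_vector_derivative
        (-1) powi j * of_real (c - t) powr (w - 1)) (at t)"
    proof -
      have "((\<lambda>z. - ((-1) powi j * (of_real c - z) powr w / w)) has_field_derivative
           (-1) powi j * (of_real c - of_real t) powr (w - 1)) (at (of_real t))"
        using t w by (auto intro!: derivative_eq_intros simp: complex_nonpos_Reals_iff)
      from has_vector_derivative_real_field[OF this] show ?thesis by simp
    qed
    moreover have "(-1) powi j * of_real (c - t) powr (w - 1) = of_real \<bar>t - c\<bar> powr u * (of_real (t - c) :: complex) powi j"
    proof -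
      have "(of_real (t - c) :: complex) = (-1) * of_real (c - t)" by simp
      then have "(of_real (t - c) :: complex) powi j = (-1) powi j * of_real (c - t) powi j"
        by (simp only: power_int_mult_distrib)
      moreover have "\<bar>t - c\<bar> = c - t" using t by simp
      ultimately show ?thesis
        using t unfolding w1 by (simp add: powr_add complex_powr_of_int del: of_real_diff)
    qed
    ultimately show "((\<lambda>t. - ((-1) powi j * of_real (c - t) powr w / w)) has_vector_derivative
        of_real \<bar>t - c\<bar> powr u * of_real (t - c) powi j) (at t)" by (simp only:)
  qed (use ab in auto)
  from has_integral_combine[OF _ _ L R] ab show ?thesis
    by (simp add: w_def add_divide_distrib)
qed

text \<open>The integral of |t - c| powr u (t - c)^j continues with its only possible pole at u = -
  j - 1. This is the point 0 just for j = -1, and there the two sides of c cancel the pole. The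
  values are the Hadamard finite part and, for j = -1, the Cauchy principal value.\<close>

lemma has_finite_part_powi:
  assumes ab: "a < c" "c < b"
  shows "j \<noteq> -1 \<Longrightarrow> has_finite_part (\<lambda>t. of_real (t - c) powi j) a b c
      ((of_real (b - c) powi (j + 1) - of_real (a - c) powi (j + 1)) / of_int (j + 1))"
    and "has_finite_part (\<lambda>t. of_real (t - c) powi (-1)) a b c (of_real (ln (b - c) - ln (c - a)))"
proof -
  assume j: "j \<noteq> -1"
  define G where "G = (\<lambda>u :: complex. ((-1) powi j * of_real (c - a) powr (u + of_int j + 1) + of_real (b - c) powr (u + of_int j + 1))
       / (u + of_int j + 1))"
  have j1: "complex_of_int j + 1 \<noteq> 0" using j by (metis add_eq_0_iff of_int_1 of_int_add of_int_eq_0_iff add.commute)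
  have an: "(\<lambda>u. (-1) powi j * of_real (c - a) powr (u + of_int j + 1) + of_real (b - c) powr (u + of_int j + 1)) analytic_on S" for S
    using ab by (intro analytic_intros) (auto simp: complex_nonpos_Reals_iff)
  have "G meromorphic_on UNIV"
    unfolding G_def by (intro meromorphic_on_divide analytic_on_imp_meromorphic_on[OF an]) (auto intro!: meromorphic_intros)
  moreover have "G analytic_on {0}"
    unfolding G_def using j1 by (intro analytic_on_divide an analytic_intros) auto
  moreover have "G 0 = (of_real (b - c) powi (j + 1) - of_real (a - c) powi (j + 1)) / of_int (j + 1)"
  proof -
    have 1: "of_real (b - c) powr (of_int j + 1) = (of_real (b - c) :: complex) powi (j + 1)"
      using ab complex_powr_of_int[of "of_real (b - c)" "j + 1"] by simp
    have 2: "of_real (c - a) powr (of_int j + 1) = (of_real (c - a) :: complex) powi (j + 1)"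
      using ab complex_powr_of_int[of "of_real (c - a)" "j + 1"] by simp
    have "(of_real (a - c) :: complex) = (-1) * of_real (c - a)" by simp
    then have "(of_real (a - c) :: complex) powi (j + 1) = (-1) powi (j + 1) * of_real (c - a) powi (j + 1)"
      by (simp only: power_int_mult_distrib)
    also have "(-1 :: complex) powi (j + 1) = - ((-1) powi j)" by (simp add: power_int_add)
    finally have 3: "(of_real (a - c) :: complex) powi (j + 1) = - ((-1) powi j) * of_real (c - a) powi (j + 1)" .
    show ?thesis unfolding G_def 3 by (simp add: 1 2 del: of_real_diff)
  qed
  ultimately show "has_finite_part (\<lambda>t. of_real (t - c) powi j) a b c
      ((of_real (b - c) powi (j + 1) - of_real (a - c) powi (j + 1)) / of_int (j + 1))"
    unfolding has_finite_part_def using has_integral_abs_powr_mult_powi[OF ab]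
    by (intro exI[of _ G] exI[of _ "- real_of_int j - 1"]) (auto simp: G_def)
next
  define E where "E = (\<lambda>u :: complex. of_real (b - c) powr u - of_real (c - a) powr u)"
  \<comment> \<open>E is the numerator for j = -1. It vanishes at 0, so E u / u extends analytically
    with value E'(0), the difference of the logarithms.\<close>
  define G where "G = (\<lambda>u. if u = 0 then deriv E 0 else E u / u)"
  have an: "E analytic_on S" for S
    unfolding E_def using ab by (intro analytic_intros) (auto simp: complex_nonpos_Reals_iff)
  have E0: "E 0 = 0" using ab by (simp add: E_def)
  have "(E has_field_derivative of_real (ln (b - c) - ln (c - a))) (at 0)"
    unfolding E_def using ab
    by (auto intro!: derivative_eq_intros simp: Ln_of_real simp del: of_real_diff) simp
  then have "deriv E 0 = of_real (ln (b - c) - ln (c - a))" by (rule DERIV_imp_deriv)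
  moreover have Gan: "G analytic_on {0}"
    by (intro pole_theorem_analytic_0[OF an, where a = 0]) (auto simp: G_def E0 intro!: exI[of _ 1])
  moreover have "G meromorphic_on UNIV"
  proof -
    have "(\<lambda>u. E u / u) meromorphic_on UNIV"
      by (intro meromorphic_intros analytic_on_imp_meromorphic_on[OF an])
    moreover have "\<forall>\<^sub>F w in at z. G w = E w / w" for z
    proof (cases "z = 0")
      case True
      then show ?thesis by (auto simp: G_def eventually_at_filter)
    next
      case False
      then have "\<forall>\<^sub>F w in at z. w \<in> - {0}" by (intro eventually_at_in_open') auto
      then show ?thesis by eventually_elim (auto simp: G_def)
    qed
    ultimately show ?thesis using meromorphic_on_cong[of UNIV G "\<lambda>u. E u / u" UNIV] by blast
  qed
  ultimately show "has_finite_part (\<lambda>t. of_real (t - c) powi (-1)) a b c (of_real (ln (b - c) - ln (c - a)))"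
    unfolding has_finite_part_def
  proof (intro exI[of _ G] exI[of _ 0] conjI allI impI)
    show "((\<lambda>t. of_real \<bar>t - c\<bar> powr u * of_real (t - c) powi (-1)) has_integral G u) {a..b}"
      if "Re u > 0" for u
    proof -
      have "u \<noteq> 0" using that by auto
      with has_integral_abs_powr_mult_powi[OF ab, of u "-1"] that show ?thesis
        by (simp add: G_def E_def del: of_real_diff)
    qed
  qed (auto simp: G_def)
qed

section \<open>Finite parts of analytic integrands\<close>

lemma summable_mult_bounded:
  fixes a m :: "nat \<Rightarrow> complex"
  assumes "summable (\<lambda>n. norm (a n))" "\<And>n. norm (m n) \<le> B"
  shows "summable (\<lambda>n. a n * m n)"
proof (rule summable_comparison_test')
  show "summable (\<lambda>n. norm (a n) * B)" by (intro summable_mult2 assms)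
  show "norm (a n * m n) \<le> norm (a n) * B" if "n \<ge> 0" for n
    unfolding norm_mult by (intro mult_left_mono assms) auto
qed

text \<open>Absolute convergence at distance d makes the series uniform on the closed interval, also
  after multiplication by the bounded weight. It is applied to \<omega> = |t - c| powr u and to
  \<omega> = 1.\<close>

lemma has_integral_power_series_moments:
  fixes \<omega> :: "real \<Rightarrow> complex" and a m :: "nat \<Rightarrow> complex"
  assumes \<omega>: "continuous_on {c - d..c + d} \<omega>"
    and a: "summable (\<lambda>n. norm (a n * of_real d ^ n))"
    and A: "\<And>t. t \<in> {c - d..c + d} \<Longrightarrow> (\<lambda>n. a n * of_real (t - c) ^ n) sums A t"
    and m: "\<And>n. ((\<lambda>t. \<omega> t * of_real (t - c) ^ n) has_integral m n) {c - d..c + d}"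
  shows "((\<lambda>t. \<omega> t * A t) has_integral (\<Sum>n. a n * m n)) {c - d..c + d}"
proof -
  let ?I = "{c - d..c + d}"
  have "compact (\<omega> ` ?I)" by (intro compact_continuous_image \<omega>) auto
  from compact_imp_bounded[OF this] obtain W where W: "\<And>t. t \<in> ?I \<Longrightarrow> norm (\<omega> t) \<le> W"
    unfolding bounded_iff by blast
  have ul: "uniform_limit ?I (\<lambda>n t. \<Sum>i<n. a i * (\<omega> t * of_real (t - c) ^ i)) (\<lambda>t. \<Sum>i. a i * (\<omega> t * of_real (t - c) ^ i)) sequentially"
  proof (rule Weierstrass_m_test)
    show "norm (a n * (\<omega> t * of_real (t - c) ^ n)) \<le> W * norm (a n * of_real d ^ n)" if "t \<in> ?I" for n t
    proof -
      have "norm (of_real (t - c) ^ n :: complex) \<le> norm (of_real d ^ n :: complex)"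
        using that unfolding norm_power by (intro power_mono) (auto simp: abs_le_iff simp del: of_real_diff)
      then have "norm (\<omega> t) * (norm (a n) * norm (of_real (t - c) ^ n :: complex)) \<le> W * (norm (a n) * norm (of_real d ^ n :: complex))"
        using W[OF that] order_trans[OF norm_ge_zero W[OF that]] by (intro mult_mono mult_left_mono) auto
      then show ?thesis by (simp add: norm_mult mult_ac)
    qed
    show "summable (\<lambda>n. W * norm (a n * of_real d ^ n))" by (intro summable_mult a)
  qed
  obtain I J where IJ: "\<And>n. ((\<lambda>t. \<Sum>i<n. a i * (\<omega> t * of_real (t - c) ^ i)) has_integral I n) ?I"
    "((\<lambda>t. \<Sum>i. a i * (\<omega> t * of_real (t - c) ^ i)) has_integral J) ?I" "I \<longlonglongrightarrow> J"
    by (rule uniform_limit_integral[OF ul]) (auto intro!: continuous_intros \<omega>)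
  have In: "I n = (\<Sum>i<n. a i * m i)" for n
    by (rule has_integral_unique[OF IJ(1)]) (intro has_integral_sum has_integral_mult_right m finite_lessThan)
  have "(\<lambda>i. a i * m i) sums J" using IJ(3) unfolding In sums_def .
  then have J: "J = (\<Sum>i. a i * m i)" by (simp add: sums_iff)
  have "(\<Sum>i. a i * (\<omega> t * of_real (t - c) ^ i)) = \<omega> t * A t" if "t \<in> ?I" for t
    using sums_mult[OF A[OF that], of "\<omega> t"] by (simp add: sums_iff mult.left_commute)
  from has_integral_eq[OF this IJ(2)] show ?thesis unfolding J .
qed

text \<open>The Mellin transform of a power series at \<open>0\<close>, up to the factor \<open>d powr u\<close>.\<close>
lemma partial_fraction_series:
  fixes b :: "nat \<Rightarrow> complex"
  assumes b: "summable (\<lambda>n. norm (b n))"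
  shows "(\<lambda>u. \<Sum>n. b n / (u + of_nat n + 1)) meromorphic_on UNIV"
    and "(\<lambda>u. \<Sum>n. b n / (u + of_nat n + 1)) analytic_on {0}"
proof -
  define S where "S = (\<lambda>u. \<Sum>n. b n / (u + of_nat n + 1))"
  \<comment> \<open>The tail from index K on is holomorphic for |u| < K, because its denominators
    have modulus at least 1 there; the first K terms are rational functions of u.\<close>
  define T where "T = (\<lambda>K :: nat. \<lambda>u. \<Sum>n. b (n + K) / (u + of_nat (n + K) + 1))"
  have lower: "norm (u + of_nat (n + K) + 1) \<ge> 1" if "norm u < real K" for u :: complex and n K
  proof -
    have "of_nat (n + K) + 1 = (of_nat (n + K + 1) :: complex)" by simp
    then have "norm (of_nat (n + K) + 1 :: complex) = real (n + K + 1)" by (simp only: norm_of_nat)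
    moreover have "norm (of_nat (n + K) + 1 :: complex) \<le> norm (u + of_nat (n + K) + 1) + norm u"
      using norm_triangle_ineq4[of "u + of_nat (n + K) + 1" u] by (simp add: algebra_simps)
    ultimately show ?thesis using that by simp
  qed
  have termle: "norm (b (n + K) / (u + of_nat (n + K) + 1)) \<le> norm (b (n + K))"
    if "norm u < real K" for u n K
  proof -
    have "norm (b (n + K)) / norm (u + of_nat (n + K) + 1) \<le> norm (b (n + K)) / 1"
      by (rule divide_left_mono) (use lower[OF that, of n] in auto)
    then show ?thesis by (simp add: norm_divide)
  qed
  have bK: "summable (\<lambda>n. norm (b (n + K)))" for K
    by (rule iffD2[OF summable_iff_shift[of "\<lambda>n. norm (b n)" K] b])
  have Th: "T K holomorphic_on ball 0 (real K)" for K
  proof (rule holomorphic_uniform_sequence)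
    fix z :: complex assume "z \<in> ball 0 (real K)"
    from bspec[OF iffD1[OF open_contains_cball open_ball] this]
    obtain d where d: "d > 0" "cball z d \<subseteq> ball 0 (real K)" by blast
    have nd: "norm u < real K" if "u \<in> cball z d" for u using subsetD[OF d(2) that] by simp
    have "uniform_limit (cball z d) (\<lambda>N u. \<Sum>n<N. b (n + K) / (u + of_nat (n + K) + 1)) (T K) sequentially"
      unfolding T_def
      by (rule Weierstrass_m_test[OF _ bK[of K]]) (rule termle, rule nd)
    then show "\<exists>d>0. cball z d \<subseteq> ball 0 (real K) \<and>
        uniform_limit (cball z d) (\<lambda>N u. \<Sum>n<N. b (n + K) / (u + of_nat (n + K) + 1)) (T K) sequentially"
      using d by blast
  next
    show "(\<lambda>u. \<Sum>n<N. b (n + K) / (u + of_nat (n + K) + 1)) holomorphic_on ball 0 (real K)" for N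
    proof (intro holomorphic_intros)
      fix u :: complex and n assume "u \<in> ball 0 (real K)"
      then show "u + of_nat (n + K) + 1 \<noteq> 0" using lower[of u K n] by auto
    qed
  qed auto
  have split: "S u = T K u + (\<Sum>n<K. b n / (u + of_nat n + 1))" if "norm u < real K" for u K
  proof -
    have "summable (\<lambda>n. b (n + K) / (u + of_nat (n + K) + 1))"
      by (rule summable_comparison_test'[OF bK[of K]]) (rule termle[OF that])
    then have "summable (\<lambda>n. b n / (u + of_nat n + 1))"
      using summable_iff_shift[of "\<lambda>n. b n / (u + of_nat n + 1)" K] by simp
    from suminf_split_initial_segment[OF this, of K] show ?thesis
      unfolding S_def T_def .
  qed
  have near: "\<forall>\<^sub>F w in nhds z. S w = T K w + (\<Sum>n<K. b n / (w + of_nat n + 1))" if "norm z < real K" for z K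
  proof -
    have "\<forall>\<^sub>F w in nhds z. w \<in> ball 0 (real K)" using that by (intro eventually_nhds_in_open) auto
    then show ?thesis by eventually_elim (use split in auto)
  qed
  have Tan: "T K analytic_on {z}" if "norm z < real K" for z K
    using Th[of K] that by (auto simp: analytic_at intro!: exI[of _ "ball 0 (real K)"])
  show "S meromorphic_on UNIV"
  proof (subst meromorphic_on_meromorphic_at, intro ballI)
    fix z :: complex
    obtain K :: nat where K: "norm z < real K" using reals_Archimedean2 by blast
    have "(\<lambda>w. T K w + (\<Sum>n<K. b n / (w + of_nat n + 1))) meromorphic_on {z}"
      by (intro meromorphic_on_add analytic_on_imp_meromorphic_on[OF Tan[OF K]] meromorphic_intros)
    moreover have "\<forall>\<^sub>F w in at z'. S w = T K w + (\<Sum>n<K. b n / (w + of_nat n + 1))" if "z' \<in> {z}" for z'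
      using near[OF K] that by (simp add: eventually_nhds_conv_at)
    ultimately show "S meromorphic_on {z}" by (rule iffD2[OF meromorphic_on_cong[OF _ refl], rotated])
  qed
  \<comment> \<open>Near 0 it suffices to separate the term n = 0, whose pole is at u = -1.\<close>
  have "(\<lambda>w. T 1 w + (\<Sum>n<1. b n / (w + of_nat n + 1))) analytic_on {0}"
    by (intro analytic_on_add Tan analytic_intros) auto
  moreover have "\<forall>\<^sub>F w in nhds 0. T 1 w + (\<Sum>n<1. b n / (w + of_nat n + 1)) = S w"
    by (rule eventually_mono[OF near[of 0 1]]) auto
  ultimately show "S analytic_on {0}" by (rule iffD1[OF analytic_at_cong[OF _ refl], rotated])
qed

text \<open>Integrating the Taylor series termwise gives a series with poles only at negative
  integers. It is therefore analytic at u = 0, and its value there is the termwise integral without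
  the weight.\<close>

lemma has_finite_part_analytic_disc:
  assumes A: "A holomorphic_on ball (of_real c) r" and d: "0 < d" "d < r"
  shows "has_finite_part (\<lambda>t. A (of_real t)) (c - d) (c + d) c (integral {c - d..c + d} (\<lambda>t. A (of_real t)))"
proof -
  define a where "a = (\<lambda>n. (deriv ^^ n) A (of_real c) / fact n)"
  have ser: "(\<lambda>n. a n * (w - of_real c) ^ n) sums A w" if "w \<in> ball (of_real c) r" for w
    unfolding a_def by (rule holomorphic_power_series[OF A that])
  have sa: "summable (\<lambda>n. norm (a n * of_real d ^ n))"
  proof (rule powser_insidea)
    show "summable (\<lambda>n. a n * of_real ((d + r) / 2) ^ n)"
      using ser[of "of_real c + of_real ((d + r) / 2)"] d by (simp add: sums_iff dist_norm del: of_real_add of_real_divide)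
  qed (use d in \<open>simp del: of_real_add of_real_divide\<close>)
  have At: "(\<lambda>n. a n * of_real (t - c) ^ n) sums A (of_real t)" if "t \<in> {c - d..c + d}" for t
  proof -
    have "dist (complex_of_real c) (of_real t) < r" using that d by (auto simp: dist_of_real dist_real_def)
    then show ?thesis using ser[of "of_real t"] by simp
  qed
  \<comment> \<open>The two sides of c contribute 1 and (-1)^n: odd powers cancel on the symmetric
    interval.\<close>
  define \<epsilon> where "\<epsilon> = (\<lambda>n :: nat. (-1 :: complex) ^ n + 1)"
  define b where "b = (\<lambda>n. a n * of_real d ^ n * (of_real d * \<epsilon> n))"
  have sb: "summable (\<lambda>n. norm (b n))"
  proof (rule summable_comparison_test')
    show "summable (\<lambda>n. norm (a n * of_real d ^ n) * (d * 2))" by (intro summable_mult2 sa)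
    show "norm (norm (b n)) \<le> norm (a n * of_real d ^ n) * (d * 2)" if "n \<ge> 0" for n
    proof -
      have "norm (\<epsilon> n) \<le> 2" unfolding \<epsilon>_def by (rule norm_triangle_le) (simp add: norm_power)
      then have "norm (of_real d * \<epsilon> n) \<le> d * 2" using d by (simp add: norm_mult)
      then have "norm (a n * of_real d ^ n) * norm (of_real d * \<epsilon> n) \<le> norm (a n * of_real d ^ n) * (d * 2)"
        by (rule mult_left_mono) auto
      then show ?thesis unfolding b_def norm_mult[of "a n * of_real d ^ n"] by simp
    qed
  qed
  define G where "G = (\<lambda>u. of_real d powr u * (\<Sum>n. b n / (u + of_nat n + 1)))"
  have m: "((\<lambda>t. of_real \<bar>t - c\<bar> powr u * of_real (t - c) ^ n) has_integral
       of_real d powr u * (of_real d ^ n * (of_real d * \<epsilon> n) / (u + of_nat n + 1))) {c - d..c + d}"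
    if "Re u > - 1" for u n
  proof -
    have "of_real d powr (u + of_nat n + 1) = of_real d powr u * of_real d ^ n * of_real d"
      using d by (simp add: powr_add powr_nat)
    moreover have "((\<lambda>t. of_real \<bar>t - c\<bar> powr u * of_real (t - c) powi int n) has_integral
     ((-1) powi int n * of_real (c - (c - d)) powr (u + of_int (int n) + 1) + of_real (c + d - c) powr (u + of_int (int n) + 1))
       / (u + of_int (int n) + 1)) {c - d..c + d}"
      using d that by (intro has_integral_abs_powr_mult_powi) auto
    ultimately show ?thesis by (simp add: \<epsilon>_def algebra_simps add_divide_distrib del: of_real_diff)
  qed
  have int: "((\<lambda>t. of_real \<bar>t - c\<bar> powr u * A (of_real t)) has_integral G u) {c - d..c + d}"
    if u: "Re u > 0" for u
  proof -
    have "((\<lambda>t. of_real \<bar>t - c\<bar> powr u * A (of_real t)) has_integral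
      (\<Sum>n. a n * (of_real d powr u * (of_real d ^ n * (of_real d * \<epsilon> n) / (u + of_nat n + 1))))) {c - d..c + d}"
    proof (rule has_integral_power_series_moments[OF _ sa At m])
      show "continuous_on {c - d..c + d} (\<lambda>t. complex_of_real \<bar>t - c\<bar> powr u)"
        using u by (intro continuous_intros) auto
    qed (use u in auto)
    also have "(\<Sum>n. a n * (of_real d powr u * (of_real d ^ n * (of_real d * \<epsilon> n) / (u + of_nat n + 1)))) =
        (\<Sum>n. of_real d powr u * (b n / (u + of_nat n + 1)))"
      by (intro suminf_cong) (simp add: b_def mult_ac)
    also have "\<dots> = G u"
      unfolding G_def
    proof (rule suminf_mult)
      have "summable (\<lambda>n. b n * inverse (u + of_nat n + 1))"
      proof (rule summable_mult_bounded[OF sb])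
        show "norm (inverse (u + of_nat n + 1)) \<le> 1" for n
        proof -
          have "1 \<le> Re (u + of_nat n + 1)" using u by simp
          also have "\<dots> \<le> norm (u + of_nat n + 1)" by (rule complex_Re_le_cmod)
          finally show ?thesis unfolding norm_inverse by (rule inverse_le_1_iff[THEN iffD2, OF disjI2])
        qed
      qed
      then show "summable (\<lambda>n. b n / (u + of_nat n + 1))" by (simp add: divide_inverse)
    qed
    finally show ?thesis .
  qed
  have "((\<lambda>t. 1 * A (of_real t)) has_integral (\<Sum>n. a n * (of_real d ^ n * (of_real d * \<epsilon> n) / (of_nat n + 1)))) {c - d..c + d}"
  proof (rule has_integral_power_series_moments[OF continuous_on_const sa At])
    fix n
    have v: "of_real d powr 0 * (of_real d ^ n * (of_real d * \<epsilon> n) / (0 + of_nat n + 1)) =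
        of_real d ^ n * (of_real d * \<epsilon> n) / (of_nat n + 1)" using d by simp
    have "((\<lambda>t. of_real \<bar>t - c\<bar> powr 0 * of_real (t - c) ^ n) has_integral
        of_real d powr 0 * (of_real d ^ n * (of_real d * \<epsilon> n) / (0 + of_nat n + 1))) {c - d..c + d}"
      by (rule m) simp
    then have m0: "((\<lambda>t. of_real \<bar>t - c\<bar> powr 0 * of_real (t - c) ^ n) has_integral
        of_real d ^ n * (of_real d * \<epsilon> n) / (of_nat n + 1)) {c - d..c + d}"
      unfolding v .
    show "((\<lambda>t. 1 * of_real (t - c) ^ n) has_integral of_real d ^ n * (of_real d * \<epsilon> n) / (of_nat n + 1)) {c - d..c + d}"
      \<comment> \<open>At t = c the weight \<open>0 powr 0\<close> is 0 and not 1, hence the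
        exceptional point.\<close>
      by (rule has_integral_spike_finite[OF _ _ m0, of "{c}"]) auto
  qed
  then have "integral {c - d..c + d} (\<lambda>t. A (of_real t)) = G 0"
    using d by (simp add: G_def b_def integral_unique mult_ac)
  moreover have p: "(\<lambda>u. of_real d powr u) analytic_on X" for X
    using d by (intro analytic_intros) (auto simp: complex_nonpos_Reals_iff)
  have "G meromorphic_on UNIV"
    unfolding G_def
    by (intro meromorphic_on_mult analytic_on_imp_meromorphic_on[OF p] partial_fraction_series(1)[OF sb])
  moreover have "G analytic_on {0}"
    unfolding G_def by (intro analytic_on_mult p partial_fraction_series(2)[OF sb])
  ultimately show ?thesis
    unfolding has_finite_part_def using int by (intro exI[of _ G] exI[of _ 0] conjI) auto
qed

lemma has_finite_part_analytic:
  assumes A: "A holomorphic_on U" and U: "open U" "convex U" "of_real a \<in> U" "of_real b \<in> U"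
    and ab: "a < c" "c < b"
  shows "has_finite_part (\<lambda>t. A (of_real t)) a b c (integral {a..b} (\<lambda>t. A (of_real t)))"
proof -
  have seg: "complex_of_real t \<in> U" if "a \<le> t" "t \<le> b" for t
  proof -
    have "complex_of_real t \<in> closed_segment (of_real a) (of_real b)"
      using that ab by (simp add: closed_segment_of_real closed_segment_eq_real_ivl)
    then show ?thesis using closed_segment_subset[OF U(3,4,2)] by blast
  qed
  have "of_real c \<in> U" using ab by (intro seg) auto
  then obtain r where r: "r > 0" "ball (of_real c) r \<subseteq> U" using U(1) open_contains_ball by blast
  \<comment> \<open>The radius keeps [c - d, c + d] both inside the disc of analyticity and inside
    [a, b]; the remaining intervals are added by \<open>has_finite_part_extend\<close>.\<close>
  define d where "d = min (r / 2) (min (c - a) (b - c))"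
  have d: "0 < d" "d < r" "a \<le> c - d" "c + d \<le> b" using r ab by (auto simp: d_def)
  have ct: "continuous_on {x..y} (\<lambda>t. A (of_real t))" if "a \<le> x" "y \<le> b" for x y
    by (rule continuous_on_compose2[OF holomorphic_on_imp_continuous_on[OF A]])
       (use that seg in \<open>auto intro!: continuous_intros\<close>)
  have I: "(\<lambda>t. A (of_real t)) integrable_on {x..y}" if "a \<le> x" "y \<le> b" for x y
    by (rule integrable_continuous_interval[OF ct[OF that]])
  have "has_finite_part (\<lambda>t. A (of_real t)) (c - d) (c + d) c (integral {c - d..c + d} (\<lambda>t. A (of_real t)))"
    by (rule has_finite_part_analytic_disc[OF holomorphic_on_subset[OF A r(2)] d(1,2)])
  from has_finite_part_extend[OF this d(3) _ _ d(4) ct ct]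
  have "has_finite_part (\<lambda>t. A (of_real t)) a b c (integral {c - d..c + d} (\<lambda>t. A (of_real t)) +
      integral {a..c - d} (\<lambda>t. A (of_real t)) + integral {c + d..b} (\<lambda>t. A (of_real t)))"
    using d ab by auto
  also have "integral {c - d..c + d} (\<lambda>t. A (of_real t)) + integral {a..c - d} (\<lambda>t. A (of_real t)) +
      integral {c + d..b} (\<lambda>t. A (of_real t)) = integral {a..b} (\<lambda>t. A (of_real t))"
  proof -
    have "integral {a..c - d} (\<lambda>t. A (of_real t)) + integral {c - d..c + d} (\<lambda>t. A (of_real t)) =
        integral {a..c + d} (\<lambda>t. A (of_real t))"
      by (rule Henstock_Kurzweil_Integration.integral_combine[OF d(3) _ I]) (use d in auto)
    moreover have "integral {a..c + d} (\<lambda>t. A (of_real t)) + integral {c + d..b} (\<lambda>t. A (of_real t)) =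
        integral {a..b} (\<lambda>t. A (of_real t))"
      by (rule Henstock_Kurzweil_Integration.integral_combine[OF _ d(4) I]) (use d ab in auto)
    ultimately show ?thesis by (simp add: add_ac)
  qed
  finally show ?thesis .
qed

text \<open>
  The finite part across a pole is the mean of the integrals along two paths that avoid the pole on
  either side. In this form it depends holomorphically on parameters and integrates derivatives
  to differences of boundary values.
\<close>
definition pole_avg :: "(complex \<Rightarrow> complex) \<Rightarrow> real \<Rightarrow> real \<Rightarrow> real \<Rightarrow> real \<Rightarrow> complex" where
  "pole_avg h a b c e =
     (contour_integral (linepath (of_real a) (Complex c e)) h + contour_integral (linepath (Complex c e) (of_real b)) h +
      contour_integral (linepath (of_real a) (Complex c (- e))) h + contour_integral (linepath (Complex c (- e)) (of_real b)) h) / 2"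

definition bypass :: "real \<Rightarrow> real \<Rightarrow> real \<Rightarrow> real \<Rightarrow> complex set" where
  "bypass a b c e = closed_segment (of_real a) (Complex c e) \<union> closed_segment (Complex c e) (of_real b) \<union>
     closed_segment (of_real a) (Complex c (- e)) \<union> closed_segment (Complex c (- e)) (of_real b)"

section \<open>Contour averages above and below the pole\<close>

lemma pole_avg_cong:
  assumes "\<And>z. z \<in> bypass a b c e \<Longrightarrow> f z = g z"
  shows "pole_avg f a b c e = pole_avg g a b c e"
  unfolding pole_avg_def using assms
  by (intro arg_cong2[of _ _ _ _ "(/)"] arg_cong2[of _ _ _ _ "(+)"] refl contour_integral_eq)
     (auto simp: bypass_def)

lemma pole_avg_add:
  assumes "continuous_on (bypass a b c e) f" "continuous_on (bypass a b c e) g"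
  shows "pole_avg (\<lambda>z. f z + g z) a b c e = pole_avg f a b c e + pole_avg g a b c e"
proof -
  have f: "f contour_integrable_on linepath p q" if "closed_segment p q \<subseteq> bypass a b c e" for p q
    by (rule contour_integrable_continuous_linepath[OF continuous_on_subset[OF assms(1) that]])
  have g: "g contour_integrable_on linepath p q" if "closed_segment p q \<subseteq> bypass a b c e" for p q
    by (rule contour_integrable_continuous_linepath[OF continuous_on_subset[OF assms(2) that]])
  have s: "contour_integral (linepath p q) (\<lambda>z. f z + g z) = contour_integral (linepath p q) f + contour_integral (linepath p q) g"
    if "closed_segment p q \<subseteq> bypass a b c e" for p q
    by (rule contour_integral_add[OF f[OF that] g[OF that]])
  show ?thesis unfolding pole_avg_def
    by (subst (1 2 3 4) s) (auto simp: bypass_def field_simps)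
qed

lemma pole_avg_cmult:
  assumes "continuous_on (bypass a b c e) f"
  shows "pole_avg (\<lambda>z. k * f z) a b c e = k * pole_avg f a b c e"
proof -
  have f: "f contour_integrable_on linepath p q" if "closed_segment p q \<subseteq> bypass a b c e" for p q
    by (rule contour_integrable_continuous_linepath[OF continuous_on_subset[OF assms(1) that]])
  have s: "contour_integral (linepath p q) (\<lambda>z. k * f z) = k * contour_integral (linepath p q) f"
    if "closed_segment p q \<subseteq> bypass a b c e" for p q
    by (rule contour_integral_lmul[OF f[OF that]])
  show ?thesis unfolding pole_avg_def
    by (subst (1 2 3 4) s) (auto simp: bypass_def field_simps)
qed

text \<open>The values of H at the corners c + i e and c - i e cancel, and both paths yield the same
  difference.\<close>

lemma pole_avg_primitive:
  assumes "\<And>z. z \<in> bypass a b c e \<Longrightarrow> (H has_field_derivative h z) (at z)"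
  shows "pole_avg h a b c e = H (of_real b) - H (of_real a)"
proof -
  have s: "contour_integral (linepath p q) h = H q - H p" if "closed_segment p q \<subseteq> bypass a b c e" for p q
  proof -
    have "(h has_contour_integral (H (pathfinish (linepath p q)) - H (pathstart (linepath p q)))) (linepath p q)"
      by (rule contour_integral_primitive[where S = "bypass a b c e"])
         (use that assms in \<open>auto intro: has_field_derivative_at_within\<close>)
    then show ?thesis by (simp add: contour_integral_unique)
  qed
  show ?thesis unfolding pole_avg_def
    by (subst (1 2 3 4) s) (auto simp: bypass_def)
qed

lemma bypass_subset:
  assumes "convex U" "of_real a \<in> U" "of_real b \<in> U" "Complex c e \<in> U" "Complex c (- e) \<in> U"
  shows "bypass a b c e \<subseteq> U"
  unfolding bypass_def using assms by (auto simp: closed_segment_subset subsetD)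

lemma closed_segment_Im_sign:
  assumes "z \<in> closed_segment (of_real a) (Complex c e)" "e \<noteq> 0"
  shows "Im z = 0 \<longleftrightarrow> z = of_real a" "Im z * e \<ge> 0"
proof -
  obtain u where u: "0 \<le> u" "u \<le> 1" "z = (1 - u) *\<^sub>R of_real a + u *\<^sub>R Complex c e"
    using assms(1) by (auto simp: closed_segment_def)
  have i: "Im z = u * e" using u(3) by simp
  show "Im z = 0 \<longleftrightarrow> z = of_real a"
  proof
    assume "Im z = 0"
    with i assms(2) have "u = 0" by simp
    with u(3) show "z = of_real a" by simp
  qed simp
  show "Im z * e \<ge> 0" unfolding i using u(1) by (simp add: mult.assoc)
qed

text \<open>A point of one of the four segments is real only at the end point a or b.\<close>

lemma bypass_cases:
  assumes "z \<in> bypass a b c e" "e > 0" "a < c" "c < b"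
  shows "z \<noteq> of_real c"
proof
  assume z: "z = of_real c"
  then have "z = of_real a \<or> z = of_real b"
    using assms closed_segment_Im_sign(1)[of z a c e] closed_segment_Im_sign(1)[of z b c e]
      closed_segment_Im_sign(1)[of z a c "- e"] closed_segment_Im_sign(1)[of z b c "- e"]
    by (auto simp: bypass_def closed_segment_commute)
  with z assms show False by auto
qed

text \<open>Parametrised by [0, 1], each segment gives an integral with kernel exp (s Ln z), and the
  right half-plane keeps Ln continuous on it.\<close>

lemma pole_avg_holomorphic:
  assumes k: "continuous_on (bypass a b c e) k" and pos: "\<And>z. z \<in> bypass a b c e \<Longrightarrow> Re z > 0"
  shows "(\<lambda>s. pole_avg (\<lambda>z. k z * z powr (s - 1)) a b c e) holomorphic_on UNIV"
proof -
  have s: "(\<lambda>s. contour_integral (linepath p q) (\<lambda>z. k z * z powr (s - 1))) holomorphic_on UNIV"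
    if sub: "closed_segment p q \<subseteq> bypass a b c e" for p q
  proof -
    have L: "linepath p q x \<in> bypass a b c e" if "x \<in> {0..1}" for x
      using sub linepath_in_path[of x p q] that by auto
    have cl: "continuous_on {0..1} (linepath p q)" by (rule continuous_on_linepath)
    have n: "linepath p q x \<notin> \<real>\<^sub>\<le>\<^sub>0" "linepath p q x \<noteq> 0" if "x \<in> {0..1}" for x
      using pos[OF L[OF that]] by (auto simp: complex_nonpos_Reals_iff)
    have "(\<lambda>s. integral {0..1} (\<lambda>x. exp (s * Ln (linepath p q x)) * (k (linepath p q x) / linepath p q x * (q - p)))) holomorphic_on UNIV"
      using n by (intro holomorphic_integral_exp continuous_intros cl
         continuous_on_compose2[OF k cl]) (use L in auto)
    moreover have "integral {0..1} (\<lambda>x. exp (s * Ln (linepath p q x)) * (k (linepath p q x) / linepath p q x * (q - p))) =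
        contour_integral (linepath p q) (\<lambda>z. k z * z powr (s - 1))" for s
      unfolding contour_integral_integral
      by (rule integral_cong) (simp add: n powr_minus_1_conv_exp_Ln)
    ultimately show ?thesis by simp
  qed
  show ?thesis unfolding pole_avg_def
    by (intro holomorphic_intros s) (auto simp: bypass_def)
qed

text \<open>A primitive on the convex set makes both detours and the straight interval integrate to
  the same boundary difference.\<close>

lemma pole_avg_analytic:
  assumes A: "A holomorphic_on U" and U: "open U" "convex U" "of_real a \<in> U" "of_real b \<in> U"
      "Complex c e \<in> U" "Complex c (- e) \<in> U" and ab: "a < b"
  shows "pole_avg A a b c e = integral {a..b} (\<lambda>t. A (of_real t))"
proof -
  obtain H where H: "\<And>z. z \<in> U \<Longrightarrow> (H has_field_derivative A z) (at z)"
    using holomorphic_convex_primitive'[OF U(2,1) A] U(1) by (metis at_within_open)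
  have "pole_avg A a b c e = H (of_real b) - H (of_real a)"
    by (rule pole_avg_primitive) (use H bypass_subset[OF U(2-)] in auto)
  moreover have "((\<lambda>t. A (of_real t)) has_integral (H (of_real b) - H (of_real a))) {a..b}"
  proof (rule fundamental_theorem_of_calculus)
    fix t assume t: "t \<in> {a..b}"
    have "complex_of_real t \<in> closed_segment (of_real a) (of_real b)"
      using t ab by (simp add: closed_segment_of_real closed_segment_eq_real_ivl)
    then have "complex_of_real t \<in> U" using closed_segment_subset[OF U(3,4,2)] by blast
    from has_vector_derivative_real_field[OF H[OF this]]
    have "((\<lambda>t. H (of_real t)) has_vector_derivative A (of_real t)) (at t)" .
    then show "((\<lambda>t. H (of_real t)) has_vector_derivative A (of_real t)) (at t within {a..b})"
      by (rule has_vector_derivative_at_within)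
  qed (use ab in auto)
  ultimately show ?thesis by (simp add: integral_unique)
qed

text \<open>For j other than -1 there is a single-valued primitive around c. For j = -1 the path
  above c gives ln (b - c) - ln (c - a) - i pi and the path below gives + i pi instead; this is the
  reason for taking the mean.\<close>

lemma pole_avg_powi:
  assumes ab: "a < c" "c < b" and e: "e > 0"
  shows "j \<noteq> -1 \<Longrightarrow> pole_avg (\<lambda>z. (z - of_real c) powi j) a b c e =
      (of_real (b - c) powi (j + 1) - of_real (a - c) powi (j + 1)) / of_int (j + 1)"
    and "pole_avg (\<lambda>z. (z - of_real c) powi (-1)) a b c e = of_real (ln (b - c) - ln (c - a))"
proof -
  assume j: "j \<noteq> -1"
  have j1: "complex_of_int (j + 1) \<noteq> 0" using j by (metis add_eq_0_iff of_int_eq_0_iff add.commute)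
  have "pole_avg (\<lambda>z. (z - of_real c) powi j) a b c e =
      (of_real b - of_real c) powi (j + 1) / of_int (j + 1) - (of_real a - of_real c) powi (j + 1) / of_int (j + 1)"
  proof (rule pole_avg_primitive)
    fix z assume "z \<in> bypass a b c e"
    then have "z - of_real c \<noteq> 0" using bypass_cases[of z a b c e] ab e by simp
    then have "((\<lambda>z. (z - of_real c) powi (j + 1)) has_field_derivative
        of_int (j + 1) * (z - of_real c) powi (j + 1 - 1) * (1 - 0)) (at z)"
      by (intro DERIV_power_int DERIV_diff DERIV_ident DERIV_const) auto
    from DERIV_cdivide[OF this, of "of_int (j + 1)"]
    show "((\<lambda>z. (z - of_real c) powi (j + 1) / of_int (j + 1)) has_field_derivative (z - of_real c) powi j) (at z)"
      using j1 by (simp del: of_int_add)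
  qed
  then show "pole_avg (\<lambda>z. (z - of_real c) powi j) a b c e =
      (of_real (b - c) powi (j + 1) - of_real (a - c) powi (j + 1)) / of_int (j + 1)"
    by (simp add: diff_divide_distrib)
next
  let ?h = "\<lambda>z. (z - complex_of_real c) powi (-1)"
  have s: "contour_integral (linepath (of_real x) (Complex c \<epsilon>)) ?h =
      Ln (- \<i> * of_real (sgn \<epsilon>) * (Complex c \<epsilon> - of_real c)) - Ln (- \<i> * of_real (sgn \<epsilon>) * (of_real x - of_real c)) \<and>
     contour_integral (linepath (Complex c \<epsilon>) (of_real x)) ?h =
      Ln (- \<i> * of_real (sgn \<epsilon>) * (of_real x - of_real c)) - Ln (- \<i> * of_real (sgn \<epsilon>) * (Complex c \<epsilon> - of_real c))"
    if x: "x \<noteq> c" and \<epsilon>: "\<epsilon> \<noteq> 0" for x \<epsilon> :: real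
  proof -
    \<comment> \<open>The factor - i sgn \<epsilon> turns the closed half-plane containing the
      segment into the right half-plane, so this branch of the logarithm is analytic along the
      segment, including its real end point.\<close>
    let ?H = "\<lambda>z. Ln (- \<i> * of_real (sgn \<epsilon>) * (z - of_real c))"
    let ?S = "closed_segment (of_real x) (Complex c \<epsilon>)"
    have d: "(?H has_field_derivative ?h z) (at z within ?S)" if z: "z \<in> ?S" for z
    proof -
      note i = closed_segment_Im_sign[OF z \<epsilon>]
      have "- \<i> * of_real (sgn \<epsilon>) * (z - of_real c) \<notin> \<real>\<^sub>\<le>\<^sub>0"
      proof (cases "Im z = 0")
        case True
        with i(1) have "z = of_real x" by simp
        with x \<epsilon> show ?thesis by (auto simp: complex_nonpos_Reals_iff sgn_if)
      next
        case False
        have "sgn \<epsilon> * Im z > 0" using i(2) False \<epsilon> by (auto simp: sgn_if zero_le_mult_iff)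
        then show ?thesis by (auto simp: complex_nonpos_Reals_iff)
      qed
      moreover have "z - of_real c \<noteq> 0" using calculation by auto
      ultimately have "(?H has_field_derivative ?h z) (at z)"
        using \<epsilon> by (auto intro!: derivative_eq_intros simp: power_int_minus field_simps sgn_if)
      then show ?thesis by (rule has_field_derivative_at_within)
    qed
    have "(?h has_contour_integral (?H (pathfinish (linepath (of_real x) (Complex c \<epsilon>))) - ?H (pathstart (linepath (of_real x) (Complex c \<epsilon>)))))
        (linepath (of_real x) (Complex c \<epsilon>))"
      by (rule contour_integral_primitive[where S = ?S, OF d]) auto
    moreover have "(?h has_contour_integral (?H (pathfinish (linepath (Complex c \<epsilon>) (of_real x))) - ?H (pathstart (linepath (Complex c \<epsilon>) (of_real x)))))
        (linepath (Complex c \<epsilon>) (of_real x))"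
      by (rule contour_integral_primitive[where S = ?S, OF d]) (auto simp: closed_segment_commute)
    ultimately show ?thesis by (simp add: contour_integral_unique)
  qed
  have L1: "Ln (- \<i> * of_real r) = of_real (ln r) - \<i> * of_real pi / 2" if "r > 0" for r
    using that Ln_times_of_real[of r "- \<i>"] by (simp add: mult.commute Ln_of_real)
  have L2: "Ln (\<i> * of_real r) = of_real (ln r) + \<i> * of_real pi / 2" if "r > 0" for r
    using that Ln_times_of_real[of r "\<i>"] by (simp add: mult.commute Ln_of_real)
  have b1: "Ln (- \<i> * (of_real b - of_real c)) = of_real (ln (b - c)) - \<i> * of_real pi / 2"
    using L1[of "b - c"] ab by simp
  have b2: "Ln (\<i> * (of_real b - of_real c)) = of_real (ln (b - c)) + \<i> * of_real pi / 2"
    using L2[of "b - c"] ab by simp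
  have a1: "Ln (- \<i> * (of_real a - of_real c)) = of_real (ln (c - a)) + \<i> * of_real pi / 2"
    using L2[of "c - a"] ab by (simp add: algebra_simps)
  have a2: "Ln (\<i> * (of_real a - of_real c)) = of_real (ln (c - a)) - \<i> * of_real pi / 2"
    using L1[of "c - a"] ab by (simp add: algebra_simps)
  note L = a1 a2 b1 b2 a1[unfolded mult_minus_left] b1[unfolded mult_minus_left]
  have ac: "a \<noteq> c" "b \<noteq> c" using ab by auto
  note sa = s[OF ac(1)] and sb = s[OF ac(2)]
  show "pole_avg ?h a b c e = of_real (ln (b - c) - ln (c - a))"
    unfolding pole_avg_def using e sa[of e] sb[of e] sa[of "- e"] sb[of "- e"]
    by (simp add: L sgn_if)
qed

text \<open>Induction on N: g(z) / (z - c)^(N+1) splits into g(c) (z - c)^(-N-1) and \<psi>(z) / (z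
  - c)^N with \<psi> the difference quotient of g at c. Finite part and contour average are both
  linear, and they agree on powers of z - c and on holomorphic functions.\<close>

theorem has_finite_part_pole_avg:
  assumes U: "open U" "convex U" "of_real a \<in> U" "of_real b \<in> U"
      "Complex c e \<in> U" "Complex c (- e) \<in> U" and ab: "a < c" "c < b" and e: "e > 0"
  shows "g holomorphic_on U \<Longrightarrow> has_finite_part (\<lambda>t. g (of_real t) / (of_real t - of_real c) ^ N) a b c
     (pole_avg (\<lambda>z. g z / (z - of_real c) ^ N) a b c e)"
proof (induction N arbitrary: g)
  case 0
  have "a < b" using ab by simp
  from pole_avg_analytic[OF 0 U this] has_finite_part_analytic[OF 0 U(1-4) ab] show ?case by simp
next
  case (Suc N)
  define \<psi> where "\<psi> = (\<lambda>z. if z = of_real c then deriv g (of_real c) else (g z - g (of_real c)) / (z - of_real c))"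
  have \<psi>: "\<psi> holomorphic_on U"
    unfolding \<psi>_def by (rule pole_lemma_open[OF Suc.prems U(1)])
  have split: "g z / (z - of_real c) ^ Suc N = g (of_real c) * (z - of_real c) powi (- int (Suc N)) + \<psi> z / (z - of_real c) ^ N"
    if "z \<noteq> of_real c" for z
  proof -
    have w: "z - of_real c \<noteq> 0" using that by simp
    have g: "g z = g (of_real c) + (z - of_real c) * \<psi> z" using w by (simp add: \<psi>_def)
    have "(A + w * B) / w ^ Suc N = A * w powi (- int (Suc N)) + B / w ^ N" if "w \<noteq> 0" for w A B :: complex
      using that by (simp add: power_int_minus field_simps del: of_nat_Suc)
    from this[OF w] show ?thesis unfolding g .
  qed
  have sub: "bypass a b c e \<subseteq> U" by (rule bypass_subset[OF U(2-)])
  have nz: "z - of_real c \<noteq> 0" if "z \<in> bypass a b c e" for z using bypass_cases[OF that e ab] by simp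
  have c1: "continuous_on (bypass a b c e) (\<lambda>z. (z - of_real c) powi j)" for j
    using nz by (intro continuous_intros) auto
  have c2: "continuous_on (bypass a b c e) (\<lambda>z. \<psi> z / (z - of_real c) ^ N)"
    using nz by (intro continuous_intros continuous_on_subset[OF holomorphic_on_imp_continuous_on[OF \<psi>] sub]) auto
  have fp: "has_finite_part (\<lambda>t. of_real (t - c) powi j) a b c (pole_avg (\<lambda>z. (z - of_real c) powi j) a b c e)" for j
  proof (cases "j = -1")
    case True
    then show ?thesis using has_finite_part_powi(2)[OF ab] pole_avg_powi(2)[OF ab e] by simp
  next
    case False
    then show ?thesis using has_finite_part_powi(1)[OF ab] pole_avg_powi(1)[OF ab e] by simp
  qed
  have "pole_avg (\<lambda>z. g z / (z - of_real c) ^ Suc N) a b c e =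
      pole_avg (\<lambda>z. g (of_real c) * (z - of_real c) powi (- int (Suc N)) + \<psi> z / (z - of_real c) ^ N) a b c e"
    by (rule pole_avg_cong) (use split nz in auto)
  also have "\<dots> = g (of_real c) * pole_avg (\<lambda>z. (z - of_real c) powi (- int (Suc N))) a b c e +
      pole_avg (\<lambda>z. \<psi> z / (z - of_real c) ^ N) a b c e"
    by (subst pole_avg_add[OF continuous_on_mult[OF continuous_on_const c1] c2]) (simp only: pole_avg_cmult[OF c1])
  finally have v: "pole_avg (\<lambda>z. g z / (z - of_real c) ^ Suc N) a b c e = \<dots>" .
  show ?case unfolding v
  proof (rule has_finite_part_cong[OF has_finite_part_add[OF has_finite_part_cmult[OF fp] Suc.IH[OF \<psi>]]])
    fix t assume "t \<noteq> c"
    then show "g (of_real c) * of_real (t - c) powi (- int (Suc N)) + \<psi> (of_real t) / (of_real t - of_real c) ^ N =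
        g (of_real t) / (of_real t - of_real c) ^ Suc N"
      using split[of "of_real t"] by (simp del: power_Suc of_nat_Suc)
  qed
qed

section \<open>Poles on the imaginary axis\<close>

definition axis_poles :: "(complex \<Rightarrow> complex) \<Rightarrow> real set" where
  "axis_poles f = {t. t > 0 \<and> is_pole f (\<i> * of_real t)}"

text \<open>Besides unfolding the definition, this shows that \<open>cs\<close> enumerates the poles
  on the axis in increasing order. Thus \<open>cs\<close> is determined by f, and two splittings can
  differ only in \<open>as\<close>.\<close>

lemma pole_splittingD:
  assumes "pole_splitting f as cs"
  shows "length as = Suc (length cs)" "hd as = as ! 0" "last as = as ! length cs"
    and "\<And>j. j < length cs \<Longrightarrow> as ! j < cs ! j" "\<And>j. j < length cs \<Longrightarrow> cs ! j < as ! Suc j"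
    and "\<And>j. j < length cs \<Longrightarrow> axis_poles f \<inter> {as ! j..as ! Suc j} = {cs ! j}"
    and "axis_poles f \<inter> {0<..as ! 0} = {}" "axis_poles f \<inter> {as ! length cs..} = {}"
    and "\<And>i j. i \<le> j \<Longrightarrow> j \<le> length cs \<Longrightarrow> as ! i \<le> as ! j"
    and "\<And>j. j \<le> length cs \<Longrightarrow> 0 < as ! j"
    and "set cs = axis_poles f" "sorted_wrt (<) cs"
proof -
  show len: "length as = Suc (length cs)"
    using assms by (simp add: pole_splitting_def Let_def)
  then have ne: "as \<noteq> []" by auto
  show h: "hd as = as ! 0" using ne by (rule hd_conv_nth)
  show l: "last as = as ! length cs" using ne len by (simp add: last_conv_nth)
  show a: "as ! j < cs ! j" "cs ! j < as ! Suc j" "axis_poles f \<inter> {as ! j..as ! Suc j} = {cs ! j}"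
    if "j < length cs" for j
    using assms that by (simp_all add: pole_splitting_def Let_def axis_poles_def)
  show p0: "axis_poles f \<inter> {0<..as ! 0} = {}" and p1: "axis_poles f \<inter> {as ! length cs..} = {}"
    using assms unfolding pole_splitting_def Let_def axis_poles_def h l by simp_all
  have pos: "0 < as ! 0" using assms unfolding pole_splitting_def Let_def h by simp
  show mono: "as ! i \<le> as ! j" if "i \<le> j" "j \<le> length cs" for i j
    using that
  proof (induction j rule: dec_induct)
    case (step n)
    then show ?case using a(1,2)[of n] by simp
  qed simp
  show pos': "0 < as ! j" if "j \<le> length cs" for j using mono[of 0 j] that pos by simp
  have "t \<in> set cs" if "t \<in> axis_poles f" "t \<le> as ! j" "j \<le> length cs" for t j
    using that(2,3)
  proof (induction j)
    case 0
    have "t > 0" using that(1) by (simp add: axis_poles_def)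
    with 0 that(1) p0 show ?case by auto
  next
    case (Suc j)
    show ?case
    proof (cases "t \<le> as ! j")
      case True
      then show ?thesis using Suc by simp
    next
      case False
      then have "t \<in> axis_poles f \<inter> {as ! j..as ! Suc j}" using Suc that(1) by simp
      then have "t = cs ! j" using a(3)[of j] Suc by auto
      then show ?thesis using Suc by simp
    qed
  qed
  moreover have "t \<le> as ! length cs" if "t \<in> axis_poles f" for t
    using that p1 by (metis IntI atLeast_iff empty_iff linear)
  ultimately have "axis_poles f \<subseteq> set cs" by blast
  moreover have "set cs \<subseteq> axis_poles f"
    using a(3) by (fastforce simp: in_set_conv_nth)
  ultimately show "set cs = axis_poles f" by blast
  show "sorted_wrt (<) cs"
    unfolding sorted_wrt_iff_nth_less
  proof (intro allI impI)
    fix i j assume ij: "i < j" "j < length cs"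
    have "cs ! i < as ! Suc i" using a(2)[of i] ij by simp
    also have "\<dots> \<le> as ! j" using ij by (intro mono) auto
    also have "\<dots> < cs ! j" using a(1) ij by simp
    finally show "cs ! i < cs ! j" .
  qed
qed

lemma pole_splitting_exists:
  assumes fin: "finite (axis_poles f)"
  shows "\<exists>as cs. pole_splitting f as cs"
proof -
  define cs where "cs = sorted_list_of_set (axis_poles f)"
  define n where "n = length cs"
  have set: "set cs = axis_poles f" and sw: "sorted_wrt (<) cs" using fin by (simp_all add: cs_def)
  have pos: "cs ! j > 0" if "j < n" for j
    using set that nth_mem[of j cs] by (auto simp: n_def axis_poles_def)
  have lt: "cs ! i < cs ! j" if "i < j" "j < n" for i j
    using sw that by (simp add: n_def sorted_wrt_iff_nth_less)
  have le: "cs ! i \<le> cs ! j" if "i \<le> j" "j < n" for i j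
    using lt[of i j] that by (cases "i = j") auto
  \<comment> \<open>Half of the first pole, the midpoints of consecutive poles, and the last pole
    plus 1; the single point 1 if there is no pole.\<close>
  define \<alpha> where "\<alpha> = (\<lambda>j. if j = 0 then (if n = 0 then 1 else cs ! 0 / 2)
     else if j < n then (cs ! (j - 1) + cs ! j) / 2 else cs ! (n - 1) + 1)"
  have up: "\<alpha> j < cs ! j" if "j < n" for j
    using that pos[of 0] lt[of "j - 1" j] by (auto simp: \<alpha>_def)
  have dn: "cs ! j < \<alpha> (Suc j)" if "j < n" for j
  proof (cases "Suc j < n")
    case False
    then have "n - 1 = j" using that by simp
    then show ?thesis using False that by (simp add: \<alpha>_def)
  qed (use lt[of j "Suc j"] in \<open>simp add: \<alpha>_def\<close>)
  have inP: "\<exists>i<n. t = cs ! i" if "t \<in> axis_poles f" for t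
    using that unfolding set[symmetric] in_set_conv_nth n_def by auto
  have mem: "cs ! j \<in> axis_poles f" if "j < n" for j
    using that unfolding set[symmetric] n_def by simp
  define as where "as = map \<alpha> [0..<Suc n]"
  have nth: "as ! j = \<alpha> j" if "j \<le> n" for j using that by (simp add: as_def del: upt_Suc)
  have "as \<noteq> []" by (simp add: as_def)
  then have hd: "hd as = \<alpha> 0" and last: "last as = \<alpha> n"
    using nth by (simp_all add: hd_conv_nth last_conv_nth) (simp add: as_def del: upt_Suc)
  have 1: "axis_poles f \<inter> {0<..\<alpha> 0} = {}"
  proof -
    have "\<not> cs ! i \<le> \<alpha> 0" if "i < n" for i using up[of 0] le[of 0 i] that by auto
    then show ?thesis using inP by fastforce
  qed
  have 2: "axis_poles f \<inter> {\<alpha> n..} = {}"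
  proof -
    have "cs ! i < \<alpha> n" if i: "i < n" for i
    proof -
      have "cs ! i \<le> cs ! (n - 1)" using i by (intro le) auto
      also have "\<dots> < \<alpha> (Suc (n - 1))" using i by (intro dn) auto
      finally show ?thesis using i by simp
    qed
    then show ?thesis using inP by fastforce
  qed
  have 3: "axis_poles f \<inter> {\<alpha> j..\<alpha> (Suc j)} = {cs ! j}" if j: "j < n" for j
  proof -
    have "i = j" if "i < n" "\<alpha> j \<le> cs ! i" "cs ! i \<le> \<alpha> (Suc j)" for i
    proof (rule ccontr)
      assume "i \<noteq> j"
      then consider "i < j" | "i > j" by linarith
      then show False
      proof cases
        case 1
        then have "cs ! i \<le> cs ! (j - 1)" using j by (intro le) auto
        also have "\<dots> < \<alpha> j" using dn[of "j - 1"] 1 j by simp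
        finally show False using that by simp
      next
        case 2
        then have "\<alpha> (Suc j) < cs ! Suc j" using up[of "Suc j"] that by simp
        also have "\<dots> \<le> cs ! i" using 2 that by (intro le) auto
        finally show False using that by simp
      qed
    qed
    then show ?thesis using inP mem[OF j] up[OF j] dn[OF j] by fastforce
  qed
  have "\<alpha> 0 > 0" using pos[of 0] by (simp add: \<alpha>_def)
  then have "pole_splitting f as cs"
    unfolding pole_splitting_def Let_def axis_poles_def[symmetric] hd last n_def[symmetric]
    using 1 2 3 up dn nth by (simp add: as_def n_def[symmetric])
  then show ?thesis by blast
qed

section \<open>Independence of values on a sparse set\<close>

lemma countable_axis_exceptions:
  assumes "\<forall>\<^sub>\<approx>\<tau>\<in>\<H>. f \<tau> = g \<tau>"
  shows "countable {t::real. t > 0 \<and> f (\<i> * of_real t) \<noteq> g (\<i> * of_real t)}"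
    and "countable {t::real. t > 0 \<and> f (\<i> * of_real (1 / t)) \<noteq> g (\<i> * of_real (1 / t))}"
proof -
  have "open \<H>" by (intro open_Collect_less continuous_intros)
  moreover have "{\<tau>. f \<tau> \<noteq> g \<tau>} sparse_in \<H>" using assms by (simp add: eventually_cosparse)
  ultimately have c: "countable (\<H> \<inter> {\<tau>. f \<tau> \<noteq> g \<tau>})" by (rule sparse_imp_countable)
  show "countable {t::real. t > 0 \<and> f (\<i> * of_real t) \<noteq> g (\<i> * of_real t)}"
    by (rule countable_image_inj_on[of "\<lambda>t. \<i> * of_real t"])
       (auto intro!: countable_subset[OF _ c] inj_onI)
  show "countable {t::real. t > 0 \<and> f (\<i> * of_real (1 / t)) \<noteq> g (\<i> * of_real (1 / t))}"
    by (rule countable_image_inj_on[of "\<lambda>t. \<i> * of_real (1 / t)"])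
       (auto intro!: countable_subset[OF _ c] inj_onI)
qed

lemma negligible_of_countable:
  fixes S :: "real set"
  assumes "countable S"
  shows "negligible S"
proof -
  have "negligible (\<Union>((\<lambda>x. {x}) ` S))"
    by (rule negligible_countable_Union) (use assms in auto)
  then show ?thesis by simp
qed

lemma has_reg_integral_inf_spike:
  assumes "has_reg_integral_inf \<sigma> g t\<^sub>0 v" "negligible S" "\<And>t. t \<ge> t\<^sub>0 \<Longrightarrow> t \<notin> S \<Longrightarrow> g t = h t"
  shows "has_reg_integral_inf \<sigma> h t\<^sub>0 v"
proof -
  have "((\<lambda>t. exp (- w * of_real t) * g t) has_integral I) {t\<^sub>0..} \<longleftrightarrow>
        ((\<lambda>t. exp (- w * of_real t) * h t) has_integral I) {t\<^sub>0..}" for w I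
    by (rule has_integral_spike_eq[OF assms(2)]) (use assms(3) in auto)
  then show ?thesis using assms(1) unfolding has_reg_integral_inf_def by simp
qed

lemma has_reg_integral_pole_spike:
  assumes "has_reg_integral_pole g a b c v" "negligible S" "\<And>t. t \<in> {a..b} \<Longrightarrow> t \<notin> S \<Longrightarrow> g t = h t"
  shows "has_reg_integral_pole h a b c v"
proof -
  have "((\<lambda>t. of_real \<bar>t - c\<bar> powr u * g t) has_integral I) {a..b} \<longleftrightarrow>
        ((\<lambda>t. of_real \<bar>t - c\<bar> powr u * h t) has_integral I) {a..b}" for u I
    by (rule has_integral_spike_eq[OF assms(2)]) (use assms(3) in auto)
  then show ?thesis using assms(1) unfolding has_reg_integral_pole_def by simp
qed

lemma open_upper_half_plane: "open \<H>"
  by (intro open_Collect_less continuous_intros)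

lemma cosparse_eq_imp_pole_iff:
  assumes "\<forall>\<^sub>\<approx>\<tau>\<in>\<H>. f \<tau> = g \<tau>" "Im z > 0"
  shows "is_pole f z \<longleftrightarrow> is_pole g z"
  using assms open_upper_half_plane by (intro is_pole_cong) (auto simp: eventually_cosparse_open_eq)

lemma is_complete_LI:
  assumes "\<Lambda> nicely_meromorphic_on UNIV" "pole_splitting f as cs"
    "\<Lambda>\<^sub>0 meromorphic_on UNIV" "\<Lambda>\<^sub>1 meromorphic_on UNIV"
    "\<And>s. Re s > M\<^sub>0 \<Longrightarrow> has_reg_integral_zero \<sigma> (mellin_integrand f s) (hd as) (\<Lambda>\<^sub>0 s)"
    "\<And>s. Re s < M\<^sub>1 \<Longrightarrow> has_reg_integral_inf \<sigma> (mellin_integrand f s) (last as) (\<Lambda>\<^sub>1 s)"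
    "\<And>j s. j < length cs \<Longrightarrow> has_reg_integral_pole (mellin_integrand f s) (as ! j) (as ! Suc j) (cs ! j) (I j s)"
    "\<forall>\<^sub>\<approx>s. \<Lambda> s = \<Lambda>\<^sub>0 s + (\<Sum>j<length cs. I j s) + \<Lambda>\<^sub>1 s"
  shows "is_complete_L \<sigma> f \<Lambda>"
  unfolding is_complete_L_def
  apply (rule conjI[OF assms(1)])
  apply (rule exI[of _ as], rule exI[of _ cs], rule exI[of _ \<Lambda>\<^sub>0], rule exI[of _ \<Lambda>\<^sub>1], rule exI[of _ I])
  apply (intro conjI assms(2,3,4,8))
    apply (rule exI[of _ M\<^sub>0], intro allI impI, erule assms(5))
   apply (rule exI[of _ M\<^sub>1], intro allI impI, erule assms(6))
  apply (intro allI impI, erule assms(7))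
  done

text \<open>Changing f on a sparse set preserves the poles and alters the integrands only on a
  countable, hence negligible, set. The inverted variable 1 / t needs its own null set for the piece
  at 0.\<close>

lemma is_complete_L_cong:
  assumes eq: "\<forall>\<^sub>\<approx>\<tau>\<in>\<H>. f \<tau> = g \<tau>" and f: "is_complete_L \<sigma> f \<Lambda>"
  shows "is_complete_L \<sigma> g \<Lambda>"
proof -
  define N where "N = {t::real. t > 0 \<and> f (\<i> * of_real t) \<noteq> g (\<i> * of_real t)}"
  define N' where "N' = {t::real. t > 0 \<and> f (\<i> * of_real (1 / t)) \<noteq> g (\<i> * of_real (1 / t))}"
  have N: "negligible N" "negligible N'"
    unfolding N_def N'_def using countable_axis_exceptions[OF eq] by (simp_all add: negligible_of_countable)
  from f obtain as cs \<Lambda>\<^sub>0 \<Lambda>\<^sub>1 I M\<^sub>0 M\<^sub>1 where *: "\<Lambda> nicely_meromorphic_on UNIV" "pole_splitting f as cs"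
    "\<Lambda>\<^sub>0 meromorphic_on UNIV" "\<Lambda>\<^sub>1 meromorphic_on UNIV"
    "\<And>s. Re s > M\<^sub>0 \<Longrightarrow> has_reg_integral_zero \<sigma> (mellin_integrand f s) (hd as) (\<Lambda>\<^sub>0 s)"
    "\<And>s. Re s < M\<^sub>1 \<Longrightarrow> has_reg_integral_inf \<sigma> (mellin_integrand f s) (last as) (\<Lambda>\<^sub>1 s)"
    "\<And>j s. j < length cs \<Longrightarrow> has_reg_integral_pole (mellin_integrand f s) (as ! j) (as ! Suc j) (cs ! j) (I j s)"
    "\<forall>\<^sub>\<approx>s. \<Lambda> s = \<Lambda>\<^sub>0 s + (\<Sum>j<length cs. I j s) + \<Lambda>\<^sub>1 s"
    unfolding is_complete_L_def by blast
  note ps = pole_splittingD[OF *(2)]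
  have "is_pole f (\<i> * of_real t) \<longleftrightarrow> is_pole g (\<i> * of_real t)" if "t > 0" for t
    using cosparse_eq_imp_pole_iff[OF eq] that by simp
  then have ps': "pole_splitting g as cs"
    using *(2) unfolding pole_splitting_def by (simp cong: conj_cong)
  have m: "mellin_integrand f s t = mellin_integrand g s t" if "t > 0" "t \<notin> N" for s t
    using that by (simp add: mellin_integrand_def N_def)
  have m': "mellin_integrand f s (1 / t) = mellin_integrand g s (1 / t)" if "t > 0" "t \<notin> N'" for s t
    using that unfolding mellin_integrand_def N'_def by simp
  have z: "has_reg_integral_zero \<sigma> (mellin_integrand g s) (hd as) (\<Lambda>\<^sub>0 s)" if "Re s > M\<^sub>0" for s
    using *(5)[OF that] unfolding has_reg_integral_zero_def
  proof (rule has_reg_integral_inf_spike[OF _ N(2)])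
    fix t assume t: "t \<ge> 1 / hd as" "t \<notin> N'"
    have "1 / hd as > 0" using ps(10)[of 0] unfolding ps(2) by simp
    then have "t > 0" using t(1) by linarith
    from m'[OF this t(2)]
    show "mellin_integrand f s (1 / t) / of_real (t\<^sup>2) = mellin_integrand g s (1 / t) / of_real (t\<^sup>2)" by simp
  qed
  have i: "has_reg_integral_inf \<sigma> (mellin_integrand g s) (last as) (\<Lambda>\<^sub>1 s)" if "Re s < M\<^sub>1" for s
  proof (rule has_reg_integral_inf_spike[OF *(6)[OF that] N(1) m])
    show "t > 0" if "t \<ge> last as" for t using that ps(10)[of "length cs"] unfolding ps(3) by simp
  qed
  have p: "has_reg_integral_pole (mellin_integrand g s) (as ! j) (as ! Suc j) (cs ! j) (I j s)"
    if "j < length cs" for j s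
  proof (rule has_reg_integral_pole_spike[OF *(7)[OF that] N(1) m])
    show "t > 0" if "t \<in> {as ! j..as ! Suc j}" for t using that ps(10)[of j] \<open>j < length cs\<close> by auto
  qed
  show ?thesis by (rule is_complete_LI[OF *(1) ps' *(3,4) z i p *(8)])
qed

lemma complete_L_cong:
  assumes "\<forall>\<^sub>\<approx>\<tau>\<in>\<H>. f \<tau> = g \<tau>"
  shows "complete_L \<sigma> f = complete_L \<sigma> g"
proof -
  have "\<forall>\<^sub>\<approx>\<tau>\<in>\<H>. g \<tau> = f \<tau>" using assms by (simp add: eq_commute)
  then have "is_complete_L \<sigma> f = is_complete_L \<sigma> g"
    using is_complete_L_cong assms by (intro ext iffI) blast+
  then show ?thesis by (simp add: complete_L_def)
qed

text \<open>Each point of a punctured neighbourhood on which f and g agree has a full neighbourhood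
  on which they agree, so the derivatives coincide there too.\<close>

lemma D_op_cong:
  assumes "\<forall>\<^sub>\<approx>\<tau>\<in>\<H>. f \<tau> = g \<tau>"
  shows "\<forall>\<^sub>\<approx>\<tau>\<in>\<H>. D_op f \<tau> = D_op g \<tau>"
  unfolding eventually_cosparse_open_eq[OF open_upper_half_plane]
proof
  fix z assume "z \<in> \<H>"
  then have "eventually (\<lambda>w. f w = g w) (at z)"
    using assms eventually_cosparse_open_eq[OF open_upper_half_plane] by blast
  then obtain S where S: "open S" "z \<in> S" "\<And>w. w \<in> S \<Longrightarrow> w \<noteq> z \<Longrightarrow> f w = g w"
    by (auto simp: eventually_at_topological)
  have "eventually (\<lambda>w. w \<in> S - {z}) (at z)"
    using S by (auto simp: eventually_at_topological)
  then have "eventually (\<lambda>w. eventually (\<lambda>v. f v = g v) (nhds w)) (at z)"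
  proof eventually_elim
    case (elim w)
    have "eventually (\<lambda>v. v \<in> S - {z}) (nhds w)"
      using elim S(1) by (intro eventually_nhds_in_open) auto
    then show ?case by eventually_elim (use S(3) in auto)
  qed
  then show "eventually (\<lambda>w. D_op f w = D_op g w) (at z)"
    by eventually_elim (auto simp: D_op_def intro!: deriv_cong_ev)
qed

text \<open>What the construction of \<open>\<Lambda>\<close> uses of a quasi-modular form, in a
  shape that survives differentiation. The second conjunct rules out removable singularities with a
  wrong value, which meromorphy would permit.\<close>

definition tame_form :: "(complex \<Rightarrow> complex) \<Rightarrow> bool" where
  "tame_form f \<longleftrightarrow> f meromorphic_on \<H> \<and> (\<forall>z. Im z > 0 \<longrightarrow> f analytic_on {z} \<or> is_pole f z) \<and>
     qexp_type (\<lambda>t. f (\<i> * of_real t)) \<and> qexp_type (\<lambda>t. f (\<i> / of_real t))"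

section \<open>Tame forms on the imaginary axis\<close>

lemma filterlim_axis:
  fixes h :: "real \<Rightarrow> complex"
  assumes "isCont h t" "inj_on h {0<..}" "t > 0"
  shows "filterlim h (at (h t)) (at t)"
  unfolding filterlim_at
proof
  have "eventually (\<lambda>x. x \<in> {0<..}) (at t)"
    using assms(3) by (intro eventually_at_in_open') auto
  then show "eventually (\<lambda>x. h x \<in> UNIV \<and> h x \<noteq> h t) (at t)"
    using eventually_neq_at_within[of t t UNIV]
    by eventually_elim (use assms(2,3) in \<open>auto simp: inj_on_def\<close>)
  show "(h \<longlongrightarrow> h t) (at t)" using assms(1) by (simp add: isCont_def)
qed

lemma not_isCont_at_pole:
  fixes h :: "real \<Rightarrow> complex"
  assumes "isCont h t" "inj_on h {0<..}" "t > 0" "is_pole f (h t)"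
  shows "\<not> isCont (\<lambda>t. f (h t)) t"
proof
  assume "isCont (\<lambda>t. f (h t)) t"
  then have "((\<lambda>t. f (h t)) \<longlongrightarrow> f (h t)) (at t)" by (simp add: isCont_def)
  moreover have "filterlim (\<lambda>t. f (h t)) at_infinity (at t)"
    using assms(4) filterlim_axis[OF assms(1-3)] unfolding is_pole_def by (rule filterlim_compose)
  ultimately show False using not_tendsto_and_filterlim_at_infinity[of "at t"] by auto
qed

lemma qexp_type_eventually_isCont:
  assumes "qexp_type g"
  shows "eventually (\<lambda>t. isCont g t) at_top"
proof -
  obtain g' where "eventually (\<lambda>t. (g has_vector_derivative g' t) (at t)) at_top"
    using qexp_type_has_derivative[OF assms] by blast
  then show ?thesis by eventually_elim (rule has_vector_derivative_continuous)
qed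

lemma inj_axis: "inj_on (\<lambda>t. \<i> * complex_of_real t) X" "inj_on (\<lambda>t. \<i> / complex_of_real t) X"
  by (auto simp: inj_on_def)

text \<open>A function of \<open>qexp_type\<close> is continuous for large t, while f (i t) is
  discontinuous at a pole. Applied to f (i t) and f (i / t), this excludes poles near infinity and
  near 0.\<close>

lemma axis_poles_bounds:
  assumes "tame_form f"
  obtains T where "T > 0" "\<And>t. t \<in> axis_poles f \<Longrightarrow> 1 / T < t \<and> t < T"
proof -
  have "eventually (\<lambda>t. isCont (\<lambda>t. f (\<i> * of_real t)) t \<and> isCont (\<lambda>t. f (\<i> / of_real t)) t) at_top"
    using assms by (intro eventually_conj qexp_type_eventually_isCont) (auto simp: tame_form_def)
  then obtain T where T: "\<And>t. t \<ge> T \<Longrightarrow> isCont (\<lambda>t. f (\<i> * of_real t)) t"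
    "\<And>t. t \<ge> T \<Longrightarrow> isCont (\<lambda>t. f (\<i> / of_real t)) t"
    by (auto simp: eventually_at_top_linorder)
  define T' where "T' = max T 1"
  have T': "T' > 0" by (simp add: T'_def)
  show ?thesis
  proof (rule that[OF T'])
    fix t assume t: "t \<in> axis_poles f"
    then have tp: "t > 0" "is_pole f (\<i> * of_real t)" by (auto simp: axis_poles_def)
    have "\<not> isCont (\<lambda>t. f (\<i> * of_real t)) t"
      by (rule not_isCont_at_pole[OF _ inj_axis(1) tp]) (auto intro!: continuous_intros)
    with T(1) have "t < T" by (meson not_le)
    moreover have "1 / T' < t"
    proof (rule ccontr)
      assume "\<not> 1 / T' < t"
      then have "T' \<le> 1 / t" using T' tp by (simp add: field_simps)
      then have "T \<le> 1 / t" by (simp add: T'_def)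
      then have c: "isCont (\<lambda>t. f (\<i> / of_real t)) (1 / t)" by (rule T(2))
      have "is_pole f (\<i> / of_real (1 / t))" using tp by simp
      from not_isCont_at_pole[OF _ inj_axis(2) _ this] tp c show False
        by (auto intro!: continuous_intros)
    qed
    ultimately show "1 / T' < t \<and> t < T'" by (simp add: T'_def)
  qed
qed

text \<open>By \<open>axis_poles_bounds\<close> the poles lie on a compact segment of the upper
  half-plane, where singularities of a meromorphic function cannot accumulate.\<close>

lemma finite_axis_poles:
  assumes f: "tame_form f"
  shows "finite (axis_poles f)"
proof -
  obtain T where T: "T > 0" "\<And>t. t \<in> axis_poles f \<Longrightarrow> 1 / T < t \<and> t < T"
    using axis_poles_bounds[OF f] by blast
  define K where "K = (\<lambda>t. \<i> * complex_of_real t) ` {1 / T..T}"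
  have K: "compact K" unfolding K_def by (intro compact_continuous_image continuous_intros) auto
  have KH: "K \<subseteq> \<H>"
  proof -
    have "0 < 1 / T" using T(1) by simp
    then have "t > 0" if "t \<in> {1 / T..T}" for t using that by (meson atLeastAtMost_iff less_le_trans)
    then show ?thesis by (auto simp: K_def)
  qed
  define X where "X = (\<lambda>t. \<i> * complex_of_real t) ` axis_poles f"
  have XK: "X \<subseteq> K" using T(2) by (force simp: X_def K_def)
  have "finite X"
  proof (rule ccontr)
    assume "infinite X"
    then obtain z where z: "z \<in> K" "z islimpt X"
      using K XK unfolding compact_eq_Bolzano_Weierstrass by blast
    have "X \<subseteq> {w. \<not> f analytic_on {w}}"
      using analytic_at not_is_pole_holomorphic by (fastforce simp: X_def axis_poles_def)
    with z(2) have "z islimpt {w. \<not> f analytic_on {w}}" by (rule islimpt_subset)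
    moreover have "f meromorphic_on \<H>" using f by (simp add: tame_form_def)
    ultimately show False using meromorphic_on_imp_not_islimpt_singularities z(1) KH by blast
  qed
  then show ?thesis unfolding X_def by (rule finite_imageD) (rule inj_axis)
qed

lemma tame_form_analytic:
  assumes "tame_form f" "t > 0" "t \<notin> axis_poles f"
  shows "f analytic_on {\<i> * of_real t}"
proof -
  have "Im (\<i> * of_real t) > 0" using assms(2) by simp
  then have "f analytic_on {\<i> * of_real t} \<or> is_pole f (\<i> * of_real t)"
    using assms(1) unfolding tame_form_def by blast
  then show ?thesis using assms(2,3) by (auto simp: axis_poles_def)
qed

lemma analytic_has_deriv:
  assumes "f analytic_on {z}"
  shows "(f has_field_derivative deriv f z) (at z)"
  by (rule DERIV_deriv_iff_field_differentiable[THEN iffD2, OF analytic_on_imp_differentiable_at[OF assms]]) simp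

lemma axis_derivative:
  assumes "f analytic_on {\<i> * of_real t}"
  shows "((\<lambda>t. f (\<i> * of_real t)) has_vector_derivative (- (2 * of_real pi) * D_op f (\<i> * of_real t))) (at t)"
proof -
  have "((\<lambda>z. f (\<i> * z)) has_field_derivative deriv f (\<i> * of_real t) * \<i>) (at (of_real t))"
    by (rule DERIV_chain2[where f = f and g = "\<lambda>z. \<i> * z", OF analytic_has_deriv[OF assms]])
       (auto intro!: derivative_eq_intros)
  from has_vector_derivative_real_field[OF this] show ?thesis
    by (rule has_vector_derivative_eq_rhs) (simp add: D_op_def field_simps)
qed

lemma axis_derivative_inverse:
  assumes "f analytic_on {\<i> / of_real t}" "t \<noteq> 0"
  shows "((\<lambda>t. f (\<i> / of_real t)) has_vector_derivative (2 * of_real pi * D_op f (\<i> / of_real t) / of_real t ^ 2)) (at t)"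
proof -
  have "((\<lambda>z. f (\<i> / z)) has_field_derivative deriv f (\<i> / of_real t) * (- \<i> / of_real t ^ 2)) (at (of_real t))"
    by (rule DERIV_chain2[where f = f and g = "\<lambda>z. \<i> / z", OF analytic_has_deriv[OF assms(1)]])
       (use assms(2) in \<open>auto intro!: derivative_eq_intros simp: power2_eq_square\<close>)
  from has_vector_derivative_real_field[OF this] show ?thesis
    by (rule has_vector_derivative_eq_rhs) (simp add: D_op_def field_simps)
qed

text \<open>A function of \<open>qexp_type\<close> has a real derivative of that type; uniqueness of
  derivatives identifies it with a multiple of D f (i t), and of t^(-2) D f (i / t) for the inverted
  variable. Multiplication by t^2 stays in the class.\<close>

lemma tame_form_D_op:
  assumes f: "tame_form f"
  shows "tame_form (D_op f)"
proof -
  note f' = f[unfolded tame_form_def]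
  have m: "f meromorphic_on \<H>" and q: "qexp_type (\<lambda>t. f (\<i> * of_real t))" "qexp_type (\<lambda>t. f (\<i> / of_real t))"
    using f' by simp_all
  have ap: "f analytic_on {z} \<or> is_pole f z" if "Im z > 0" for z
    using f' that by blast
  have D: "D_op f = (\<lambda>z. inverse (2 * of_real pi * \<i>) * deriv f z)"
    by (rule ext) (simp add: D_op_def field_simps)
  have "D_op f meromorphic_on \<H>" unfolding D by (intro meromorphic_on_mult meromorphic_on_const meromorphic_on_deriv m)
  moreover have "D_op f analytic_on {z} \<or> is_pole (D_op f) z" if z: "Im z > 0" for z
    using ap[OF z]
  proof
    assume "f analytic_on {z}"
    then have "D_op f analytic_on {z}"
      unfolding D by (intro analytic_on_mult analytic_on_const analytic_deriv)
    then show ?thesis ..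
  next
    assume "is_pole f z"
    moreover have "f meromorphic_on {z}" by (rule meromorphic_on_subset[OF m]) (use z in auto)
    ultimately have "is_pole (D_op f) z" 
      unfolding D by (subst is_pole_cmult_iff) (simp_all add: is_pole_deriv_iff)
    then show ?thesis ..
  qed
  moreover
  obtain T where T: "T > 0" "\<And>t. t \<in> axis_poles f \<Longrightarrow> 1 / T < t \<and> t < T"
    using axis_poles_bounds[OF f] by blast
  have "qexp_type (\<lambda>t. D_op f (\<i> * of_real t))"
  proof -
    obtain g' where g': "qexp_type g'" "eventually (\<lambda>t. ((\<lambda>t. f (\<i> * of_real t)) has_vector_derivative g' t) (at t)) at_top"
      using qexp_type_has_derivative[OF q(1)] by blast
    have "eventually (\<lambda>t. inverse (- (2 * of_real pi)) * g' t = D_op f (\<i> * of_real t)) at_top"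
      using g'(2) eventually_ge_at_top[of T] eventually_gt_at_top[of 0]
    proof eventually_elim
      case (elim t)
      have "t \<notin> axis_poles f" using T(2)[of t] elim(2) by auto
      from vector_derivative_unique_at[OF elim(1) axis_derivative[OF tame_form_analytic[OF f elim(3) this]]]
      show ?case by simp
    qed
    then show ?thesis by (rule qexp_type.cong[OF qexp_type_cmult[OF g'(1)]])
  qed
  moreover have "qexp_type (\<lambda>t. D_op f (\<i> / of_real t))"
  proof -
    obtain g' where g': "qexp_type g'" "eventually (\<lambda>t. ((\<lambda>t. f (\<i> / of_real t)) has_vector_derivative g' t) (at t)) at_top"
      using qexp_type_has_derivative[OF q(2)] by blast
    have "eventually (\<lambda>t. inverse (2 * of_real pi) * (of_real t powi 2 * g' t) = D_op f (\<i> / of_real t)) at_top"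
      using g'(2) eventually_ge_at_top[of T] eventually_gt_at_top[of 0]
    proof eventually_elim
      case (elim t)
      have "1 / t \<le> 1 / T" using elim T(1) by (intro divide_left_mono) auto
      then have "1 / t \<notin> axis_poles f" using T(2)[of "1 / t"] by auto
      with elim have "f analytic_on {\<i> * of_real (1 / t)}" by (intro tame_form_analytic[OF f]) auto
      then have "f analytic_on {\<i> / of_real t}" by simp
      from vector_derivative_unique_at[OF elim(1) axis_derivative_inverse[OF this]] elim
      have "g' t = 2 * of_real pi * D_op f (\<i> / of_real t) / of_real t ^ 2" by simp
      then show ?case using elim(3) by simp
    qed
    then show ?thesis by (rule qexp_type.cong[OF qexp_type_cmult[OF qexp_type_powi[OF g'(1)]]])
  qed
  ultimately show ?thesis by (simp add: tame_form_def)
qed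

text \<open>The identity matrix gives f = F_0, hence the expansion at infinity; the inversion
  expresses f (i / t) by the F_r (i t) and powers of t. Both laws hold off a sparse set, and
  \<open>remove_sings\<close> turns them into equalities at every point of the axis far enough
  up.\<close>

lemma tame_form_of_quasimodular:
  assumes f: "meromorphic_quasimodular_form k f"
  shows "tame_form (remove_sings f)"
proof -
  from f obtain p F where m: "f meromorphic_on \<H>"
    and F: "\<And>r. r \<le> p \<Longrightarrow> F r meromorphic_on \<H>" "\<And>r. r \<le> p \<Longrightarrow> meromorphic_at_ii_inf (F r)"
    and law: "\<And>a b c d :: int. a * d - b * c = 1 \<Longrightarrow>
           (\<forall>\<^sub>\<approx>\<tau>\<in>\<H>.
              (of_int c * \<tau> + of_int d) powi (-k) *
                f ((of_int a * \<tau> + of_int b) / (of_int c * \<tau> + of_int d)) =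
              (\<Sum>r\<le>p. F r \<tau> * (of_int c / (of_int c * \<tau> + of_int d)) ^ r))"
    unfolding meromorphic_quasimodular_form_def by blast
  let ?f = "remove_sings f"
  have "\<exists>Y>0. \<forall>\<tau>. Im \<tau> > Y \<longrightarrow> (F r analytic_on {\<tau>})" if "r \<le> p" for r
    using analytic_of_qexpansion[OF F(2)[OF that]] by metis
  then obtain Yr where Yr: "\<And>r \<tau>. r \<le> p \<Longrightarrow> Im \<tau> > Yr r \<Longrightarrow> F r analytic_on {\<tau>}" "\<And>r. r \<le> p \<Longrightarrow> Yr r > 0"
    by metis
  define Y where "Y = Max (Yr ` {..p})"
  have Yle: "Yr r \<le> Y" if "r \<le> p" for r unfolding Y_def using that by (intro Max_ge) auto
  have Y: "F r analytic_on {\<tau>}" if "r \<le> p" "Im \<tau> > Y" for r \<tau>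
    using Yr(1)[OF that(1)] Yle[OF that(1)] that(2) by simp
  have Y0: "Y > 0" using Yr(2)[of 0] Yle[of 0] by simp
  have nice: "?f nicely_meromorphic_on \<H>" by (rule remove_sings_nicely_meromorphic[OF m])
  have "?f analytic_on {z} \<or> is_pole ?f z" if "Im z > 0" for z
    using nicely_meromorphic_on_imp_analytic_at[OF nice] that by auto
  moreover have "?f meromorphic_on \<H>" by (rule remove_sings_meromorphic[OF m])
  moreover have "qexp_type (\<lambda>t. ?f (\<i> * of_real t))"
  proof (rule qexp_type.cong[OF qexp_type_of_qexpansion[OF F(2)[of 0]]])
    have "(\<Sum>r\<le>p. F r \<tau> * 0 ^ r) = F 0 \<tau>" for \<tau>
      by (subst sum.remove[of _ 0]) (auto intro!: sum.neutral)
    \<comment> \<open>The variables of the law are instantiated in the order a, d, b, c, so this is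
      the identity matrix; with c = 0 only the summand r = 0 survives.\<close>
    then have eq: "\<forall>\<^sub>\<approx>\<tau>\<in>\<H>. f \<tau> = F 0 \<tau>" using law[of 1 1 0 0] by simp
    show "eventually (\<lambda>t. F 0 (\<i> * of_real t) = ?f (\<i> * of_real t)) at_top"
      using eventually_gt_at_top[of Y]
    proof eventually_elim
      case (elim t)
      let ?z = "\<i> * complex_of_real t"
      have "eventually (\<lambda>w. f w = F 0 w) (at ?z)"
        using eq elim Y0 by (simp add: eventually_cosparse_open_eq[OF open_upper_half_plane])
      then have "?f ?z = remove_sings (F 0) ?z" by (rule remove_sings_cong) simp
      also have "\<dots> = F 0 ?z" by (rule remove_sings_at_analytic[OF Y]) (use elim in auto)
      finally show ?case ..
    qed
  qed simp
  moreover have "qexp_type (\<lambda>t. ?f (\<i> / of_real t))"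
  proof (rule qexp_type.cong)
    \<comment> \<open>The transformation law solved for f (- 1 / \<tau>); h is analytic at points of
      large imaginary part.\<close>
    define h where "h = (\<lambda>\<tau>. \<tau> powi k * (\<Sum>r\<le>p. F r \<tau> * (1 / \<tau>) ^ r))"
    \<comment> \<open>Here a = d = 0, b = -1 and c = 1. At \<tau> = i t the point - 1 / \<tau> is i
      / t.\<close>
    have eq: "\<forall>\<^sub>\<approx>\<tau>\<in>\<H>. \<tau> powi (-k) * f (- 1 / \<tau>) = (\<Sum>r\<le>p. F r \<tau> * (1 / \<tau>) ^ r)"
      using law[of 0 0 "-1" 1] by simp
    show "qexp_type (\<lambda>t. \<Sum>r\<le>p. \<i> powi (k - int r) * (of_real t powi (k - int r) * F r (\<i> * of_real t)))"
      by (intro qexp_type_sum qexp_type_cmult qexp_type_powi qexp_type_of_qexpansion F) auto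
    show "eventually (\<lambda>t. (\<Sum>r\<le>p. \<i> powi (k - int r) * (of_real t powi (k - int r) * F r (\<i> * of_real t))) = ?f (\<i> / of_real t)) at_top"
      using eventually_gt_at_top[of Y]
    proof eventually_elim
      case (elim t)
      let ?\<tau> = "\<i> * complex_of_real t"
      have t0: "t > 0" using elim Y0 by simp
      have z: "- 1 / ?\<tau> = \<i> / of_real t" using t0 by (simp add: field_simps)
      have z': "- 1 / (\<i> / of_real t) = ?\<tau>" using t0 by (simp add: field_simps)
      have "eventually (\<lambda>w. w \<in> - {0}) (at ?\<tau>)"
        using t0 by (intro eventually_at_in_open') auto
      moreover have "eventually (\<lambda>w. w powi (-k) * f (- 1 / w) = (\<Sum>r\<le>p. F r w * (1 / w) ^ r)) (at ?\<tau>)"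
        using eq t0 by (simp add: eventually_cosparse_open_eq[OF open_upper_half_plane])
      ultimately have "eventually (\<lambda>w. f (- 1 / w) = h w) (at ?\<tau>)"
        by eventually_elim (auto simp: h_def power_int_minus field_simps)
      moreover have "filterlim (\<lambda>z. - 1 / z) (at ?\<tau>) (at (\<i> / of_real t))"
        unfolding filterlim_at
      proof
        have "isCont (\<lambda>z. - 1 / z) (\<i> / complex_of_real t)" using t0 by (intro continuous_intros) auto
        then show "((\<lambda>z. - 1 / z) \<longlongrightarrow> ?\<tau>) (at (\<i> / of_real t))" unfolding isCont_def z' .
        show "eventually (\<lambda>w. - 1 / w \<in> UNIV \<and> - 1 / w \<noteq> ?\<tau>) (at (\<i> / of_real t))"
          using eventually_neq_at_within[of "\<i> / complex_of_real t" "\<i> / complex_of_real t" UNIV]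
        proof eventually_elim
          case (elim w)
          show ?case
          proof safe
            assume "- 1 / w = ?\<tau>"
            then have "- 1 / (- 1 / w) = \<i> / of_real t" using z by simp
            with elim show False by simp
          qed simp
        qed
      qed
      ultimately have "eventually (\<lambda>z. f (- 1 / (- 1 / z)) = h (- 1 / z)) (at (\<i> / of_real t))"
        by (rule eventually_compose_filterlim)
      then have "?f (\<i> / of_real t) = remove_sings (\<lambda>z. h (- 1 / z)) (\<i> / of_real t)"
        by (intro remove_sings_cong) simp_all
      also have "\<dots> = h (- 1 / (\<i> / of_real t))"
      proof (rule remove_sings_at_analytic)
        have "h analytic_on {?\<tau>}" unfolding h_def
          using t0 Y elim by (intro analytic_intros) auto
        moreover have "(\<lambda>z. - 1 / z) analytic_on {\<i> / complex_of_real t}"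
          using t0 by (intro analytic_intros) auto
        ultimately show "(\<lambda>z. h (- 1 / z)) analytic_on {\<i> / complex_of_real t}"
          using analytic_on_compose_gen[of "\<lambda>z. - 1 / z" "{\<i> / complex_of_real t}" h "{?\<tau>}"] z' by (simp add: o_def)
      qed
      also have "\<dots> = h ?\<tau>" unfolding z' ..
      also have "\<dots> = (\<Sum>r\<le>p. \<i> powi (k - int r) * (of_real t powi (k - int r) * F r ?\<tau>))"
        unfolding h_def sum_distrib_left
      proof (rule sum.cong[OF refl])
        fix r
        have "\<i> powi (k - int r) * of_real t powi (k - int r) = ?\<tau> powi (k - int r)"
          by (simp add: power_int_mult_distrib)
        also have "\<dots> = ?\<tau> powi k / ?\<tau> powi int r"
          by (rule power_int_diff) (use t0 in auto)
        also have "\<dots> = ?\<tau> powi k * (1 / ?\<tau>) ^ r"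
          by (simp only: power_one_over power_int_of_nat times_divide_eq_right mult_1_right)
        finally show "?\<tau> powi k * (F r ?\<tau> * (1 / ?\<tau>) ^ r) = \<i> powi (k - int r) * (of_real t powi (k - int r) * F r ?\<tau>)"
          by (simp add: mult_ac)
      qed
      finally show ?case ..
    qed
  qed
  ultimately show ?thesis by (simp add: tame_form_def)
qed

section \<open>The pieces of the complete L-function\<close>

lemma axis_continuous:
  assumes f: "tame_form f" and X: "X \<subseteq> {0<..}" "X \<inter> axis_poles f = {}"
  shows "continuous_on X (\<lambda>t. f (\<i> * of_real t))" and "continuous_on X (mellin_integrand f s)"
proof -
  show c: "continuous_on X (\<lambda>t. f (\<i> * of_real t))"
  proof (rule continuous_at_imp_continuous_on, rule ballI)
    fix t assume "t \<in> X"
    then have "t > 0" "t \<notin> axis_poles f" using X by auto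
    from axis_derivative[OF tame_form_analytic[OF f this]]
    show "isCont (\<lambda>t. f (\<i> * of_real t)) t" by (rule has_vector_derivative_continuous)
  qed
  have "continuous_on X (\<lambda>t. complex_of_real t powr (s - 1))"
    by (intro continuous_intros) (use X(1) in force)+
  from continuous_on_mult[OF c this] show "continuous_on X (mellin_integrand f s)"
    by (simp add: mellin_integrand_def[abs_def])
qed

text \<open>As (1 / t) powr (s - 1) / t^2 = t powr (- s - 1), the substitution exchanges s with - s.
  This is why the piece at 0 lives where Re s is large.\<close>

lemma has_reg_integral_zero_mellin_iff:
  assumes x: "x > 0"
  shows "has_reg_integral_zero \<sigma> (mellin_integrand f s) x v \<longleftrightarrow>
     has_reg_integral_inf \<sigma> (\<lambda>t. f (\<i> / of_real t) * of_real t powr (- s - 1)) (1 / x) v"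
  unfolding has_reg_integral_zero_def
proof (rule has_reg_integral_inf_cong)
  fix t assume t: "t \<ge> 1 / x"
  have "0 < 1 / x" using x by simp
  then have t0: "t > 0" using t by linarith
  have "complex_of_real (1 / t) powr (s - 1) = of_real t powr (- (s - 1))"
  proof -
    have "Ln (complex_of_real (1 / t)) = - Ln (of_real t)"
      using t0 by (simp add: Ln_of_real ln_div del: of_real_divide)
    then show ?thesis using t0 by (simp add: powr_def algebra_simps)
  qed
  also have "\<dots> = of_real t powr (- s - 1) * of_real t ^ 2"
  proof -
    have "complex_of_real t powr (- s - 1) * of_real t ^ 2 = of_real t powr (- s - 1) * of_real t powr of_nat 2"
      using t0 by (subst powr_nat) auto
    also have "\<dots> = of_real t powr ((- s - 1) + of_nat 2)" by (rule powr_add[symmetric])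
    also have "(- s - 1) + of_nat 2 = - (s - 1)" by simp
    finally show ?thesis ..
  qed
  finally have "complex_of_real (1 / t) powr (s - 1) / of_real (t ^ 2) = of_real t powr (- s - 1)"
    using t0 by simp
  moreover have "\<i> * complex_of_real (1 / t) = \<i> / of_real t" by simp
  ultimately show "mellin_integrand f s (1 / t) / of_real (t\<^sup>2) = f (\<i> / of_real t) * of_real t powr (- s - 1)"
    unfolding mellin_integrand_def by (metis times_divide_eq_right)
qed

lemma inverse_not_pole:
  assumes "axis_poles f \<inter> {0<..x} = {}" "x > 0" "t \<ge> 1 / x"
  shows "t > 0" "1 / t \<notin> axis_poles f"
proof -
  have "0 < 1 / x" using assms(2) by simp
  then show t: "t > 0" using assms(3) by linarith
  have "1 / t \<le> x" using assms(2,3) t by (simp add: field_simps)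
  then show "1 / t \<notin> axis_poles f" using assms(1) t by auto
qed

lemma inverse_analytic:
  assumes f: "tame_form f" and p: "axis_poles f \<inter> {0<..x} = {}" "x > 0" "t \<ge> 1 / x"
  shows "f analytic_on {\<i> / of_real t}"
proof -
  have "1 / t > 0" using inverse_not_pole(1)[OF p] by simp
  from tame_form_analytic[OF f this inverse_not_pole(2)[OF p]] show ?thesis by simp
qed

lemma continuous_inverse_axis:
  assumes f: "tame_form f" and p: "axis_poles f \<inter> {0<..x} = {}" "x > 0"
  shows "continuous_on {1 / x..} (\<lambda>t. f (\<i> / of_real t))"
proof (rule continuous_at_imp_continuous_on, rule ballI)
  fix t assume "t \<in> {1 / x..}"
  then have t: "t \<ge> 1 / x" by simp
  have "t \<noteq> 0" using inverse_not_pole(1)[OF p t] by simp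
  from axis_derivative_inverse[OF inverse_analytic[OF f p t] this]
  show "isCont (\<lambda>t. f (\<i> / of_real t)) t" by (rule has_vector_derivative_continuous)
qed

section \<open>End pieces and change of their base points\<close>

lemma inf_piece_exists:
  assumes \<sigma>: "\<sigma> \<in> {1, -1}" and f: "tame_form f" and x: "x > 0" "axis_poles f \<inter> {x..} = {}"
  shows "\<exists>V M. V meromorphic_on UNIV \<and>
     (\<forall>s. Re s < M \<longrightarrow> has_reg_integral_inf \<sigma> (mellin_integrand f s) x (V s))"
proof -
  have "continuous_on {x..} (\<lambda>t. f (\<i> * of_real t))"
    by (rule axis_continuous(1)[OF f]) (use x in auto)
  moreover have "qexp_type (\<lambda>t. f (\<i> * of_real t))" using f by (simp add: tame_form_def)
  ultimately show ?thesis
    using qexp_type_reg_integral[OF \<sigma> _ x(1), of "\<lambda>t. f (\<i> * of_real t)"]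
    by (simp add: mellin_integrand_def[abs_def])
qed

lemma zero_piece_exists:
  assumes \<sigma>: "\<sigma> \<in> {1, -1}" and f: "tame_form f" and x: "x > 0" "axis_poles f \<inter> {0<..x} = {}"
  shows "\<exists>V M. V meromorphic_on UNIV \<and>
     (\<forall>s. Re s > M \<longrightarrow> has_reg_integral_zero \<sigma> (mellin_integrand f s) x (V s))"
proof -
  have c: "continuous_on {1 / x..} (\<lambda>t. f (\<i> / of_real t))"
    by (rule continuous_inverse_axis[OF f x(2,1)])
  have q: "qexp_type (\<lambda>t. f (\<i> / of_real t))" using f by (simp add: tame_form_def)
  have x': "1 / x > 0" using x by simp
  obtain V M where V: "V meromorphic_on UNIV" "\<And>s. Re s < M \<Longrightarrow>
      has_reg_integral_inf \<sigma> (\<lambda>t. f (\<i> / of_real t) * of_real t powr (s - 1)) (1 / x) (V s)"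
    using qexp_type_reg_integral[OF \<sigma> q x' c] by blast
  have "(\<lambda>s. V (- s)) meromorphic_on UNIV"
    by (rule meromorphic_on_compose[OF V(1)]) (auto intro!: analytic_intros)
  moreover have "has_reg_integral_zero \<sigma> (mellin_integrand f s) x (V (- s))" if "Re s > - M" for s
    unfolding has_reg_integral_zero_mellin_iff[OF x(1)] by (rule V(2)) (use that in simp)
  ultimately show ?thesis by blast
qed

text \<open>Substitution t -> 1 / t by way of the primitive - \<Phi> (1 / t); its sign accounts for
  the reversed orientation.\<close>

lemma integral_inversion:
  fixes m :: "real \<Rightarrow> complex"
  assumes m: "continuous_on {x..y} m" and xy: "0 < x" "x \<le> y"
  shows "integral {1 / y..1 / x} (\<lambda>t. m (1 / t) / of_real (t ^ 2)) = integral {x..y} m"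
proof -
  define \<Phi> where "\<Phi> = (\<lambda>u. integral {x..u} m)"
  have "((\<lambda>t. m (1 / t) / of_real (t ^ 2)) has_integral (- \<Phi> (1 / (1 / x)) - - \<Phi> (1 / (1 / y)))) {1 / y..1 / x}"
  proof (rule fundamental_theorem_of_calculus)
    show "1 / y \<le> 1 / x" using xy by (intro divide_left_mono) auto
    fix t assume t: "t \<in> {1 / y..1 / x}"
    have y: "y > 0" using xy by simp
    have "0 < 1 / y" using y by simp
    then have t0: "t > 0" using t by (metis atLeastAtMost_iff less_le_trans)
    have im: "(\<lambda>t. 1 / t) ` {1 / y..1 / x} \<subseteq> {x..y}"
    proof safe
      fix u assume u: "u \<in> {1 / y..1 / x}"
      then have "u > 0" using \<open>0 < 1 / y\<close> by (metis atLeastAtMost_iff less_le_trans)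
      then show "1 / u \<in> {x..y}" using u xy y by (auto simp: field_simps)
    qed
    have "((\<lambda>t. 1 / t) has_vector_derivative (- 1 / t ^ 2)) (at t within {1 / y..1 / x})"
      using t0 by (auto intro!: derivative_eq_intros simp: has_real_derivative_iff_has_vector_derivative[symmetric] power2_eq_square)
    moreover have "(\<Phi> has_vector_derivative m (1 / t)) (at (1 / t) within (\<lambda>t. 1 / t) ` {1 / y..1 / x})"
      unfolding \<Phi>_def
      by (rule has_vector_derivative_within_subset[OF integral_has_vector_derivative[OF m] im]) (use im t in blast)
    ultimately have "((\<Phi> \<circ> (\<lambda>t. 1 / t)) has_vector_derivative ((- 1 / t ^ 2) *\<^sub>R m (1 / t))) (at t within {1 / y..1 / x})"
      by (rule vector_diff_chain_within)
    then have "((\<lambda>t. - \<Phi> (1 / t)) has_vector_derivative - ((- 1 / t ^ 2) *\<^sub>R m (1 / t))) (at t within {1 / y..1 / x})"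
      unfolding o_def by (rule has_vector_derivative_minus)
    then show "((\<lambda>t. - \<Phi> (1 / t)) has_vector_derivative m (1 / t) / of_real (t ^ 2)) (at t within {1 / y..1 / x})"
      by (rule has_vector_derivative_eq_rhs) (simp add: scaleR_conv_of_real)
  qed
  moreover have "\<Phi> x = 0" by (simp add: \<Phi>_def)
  ultimately show ?thesis by (simp add: integral_unique \<Phi>_def)
qed

lemma inf_piece_change:
  assumes \<sigma>: "\<sigma> \<in> {1, -1}" and f: "tame_form f" and x: "0 < x" "x \<le> y" "axis_poles f \<inter> {x..} = {}"
    and u: "has_reg_integral_inf \<sigma> (mellin_integrand f s) x u"
    and v: "has_reg_integral_inf \<sigma> (mellin_integrand f s) y v"
  shows "u = v + integral {x..y} (mellin_integrand f s)"
proof -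
  have "continuous_on {x..y} (mellin_integrand f s)"
    by (rule axis_continuous(2)[OF f]) (use x in auto)
  from has_reg_integral_inf_unique[OF \<sigma> u has_reg_integral_inf_extend[OF v this x(2)]] show ?thesis .
qed

text \<open>In the variable 1 / t a larger base point means a longer ray: passing from x to y adds
  the interval from 1 / y to 1 / x.\<close>

lemma zero_piece_change:
  assumes \<sigma>: "\<sigma> \<in> {1, -1}" and f: "tame_form f" and x: "0 < x" "x \<le> y" "axis_poles f \<inter> {0<..y} = {}"
    and u: "has_reg_integral_zero \<sigma> (mellin_integrand f s) x u"
    and v: "has_reg_integral_zero \<sigma> (mellin_integrand f s) y v"
  shows "v = u + integral {x..y} (mellin_integrand f s)"
proof -
  have y: "y > 0" using x by simp
  have m: "continuous_on {x..y} (mellin_integrand f s)"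
    by (rule axis_continuous(2)[OF f]) (use x in auto)
  have le: "1 / y \<le> 1 / x" using x by (intro divide_left_mono) auto
  have pos: "t > 0" if "t \<in> {1 / y..1 / x}" for t
  proof -
    have "0 < 1 / y" using y by simp
    then show ?thesis using that by (metis atLeastAtMost_iff less_le_trans)
  qed
  have im: "1 / t \<in> {x..y}" if "t \<in> {1 / y..1 / x}" for t
    using pos[OF that] that x y by (auto simp: field_simps)
  have nz: "\<forall>t\<in>{1 / y..1 / x}. t \<noteq> 0" using pos by (metis less_irrefl)
  have "continuous_on {1 / y..1 / x} (\<lambda>t. 1 / t)"
    by (intro continuous_on_divide continuous_on_const continuous_on_id nz)
  from continuous_on_compose2[OF m this]
  have "continuous_on {1 / y..1 / x} (\<lambda>t. mellin_integrand f s (1 / t))" using im by blast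
  then have "continuous_on {1 / y..1 / x} (\<lambda>t. mellin_integrand f s (1 / t) / of_real (t ^ 2))"
    by (intro continuous_on_divide continuous_on_of_real continuous_on_power continuous_on_id)
       (use nz in auto)
  note has_reg_integral_inf_extend[OF u[unfolded has_reg_integral_zero_def] this le]
  from has_reg_integral_inf_unique[OF \<sigma> v[unfolded has_reg_integral_zero_def] this]
  show ?thesis unfolding integral_inversion[OF m x(1,2)] .
qed

text \<open>The coordinate is z = - i \<tau>, so that the axis becomes the positive real line.
  Convexity gives primitives on \<open>U\<close>, the right half-plane makes powers holomorphic
  there, and the corners c + i e and c - i e put both detours inside \<open>U\<close>.\<close>

definition pole_box :: "(complex \<Rightarrow> complex) \<Rightarrow> real \<Rightarrow> real \<Rightarrow> real \<Rightarrow> real \<Rightarrow> complex set \<Rightarrow> bool" where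
  "pole_box f a b c e U \<longleftrightarrow> open U \<and> convex U \<and> of_real a \<in> U \<and> of_real b \<in> U \<and> of_real c \<in> U \<and>
     Complex c e \<in> U \<and> Complex c (- e) \<in> U \<and> 0 < e \<and> a < c \<and> c < b \<and> (\<forall>z\<in>U. Re z > 0) \<and>
     (\<forall>z\<in>U. z \<noteq> of_real c \<longrightarrow> f analytic_on {\<i> * z}) \<and> is_pole f (\<i> * of_real c)"

lemma open_analytic_points: "open {w. f analytic_on {w}}"
proof (subst open_subopen, intro ballI)
  fix w assume "w \<in> {w. f analytic_on {w}}"
  then obtain S where "open S" "w \<in> S" "f holomorphic_on S" by (auto simp: analytic_at)
  then show "\<exists>T. open T \<and> w \<in> T \<and> T \<subseteq> {w. f analytic_on {w}}"
    by (intro exI[of _ S]) (auto simp: analytic_at)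
qed

lemma pole_box_exists:
  assumes f: "tame_form f" and a: "0 < a" "a < c" "c < b" and p: "axis_poles f \<inter> {a..b} = {c}"
  shows "\<exists>e U. pole_box f a b c e U"
proof -
  have c: "c > 0" using a by simp
  have "c \<in> axis_poles f" using p by blast
  then have pole: "is_pole f (\<i> * of_real c)" by (simp add: axis_poles_def)
  have "f meromorphic_on {\<i> * of_real c}"
    by (rule meromorphic_on_subset[OF f[unfolded tame_form_def, THEN conjunct1]]) (use c in simp)
  then have "isolated_singularity_at f (\<i> * of_real c)" by (rule meromorphic_on_isolated_singularity)
  then obtain r where r: "r > 0" "f analytic_on ball (\<i> * of_real c) r - {\<i> * of_real c}"
    unfolding isolated_singularity_at_def by blast
  define A where "A = (\<lambda>z. \<i> * z) -` {w. f analytic_on {w}}"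
  \<comment> \<open>Points where f (i z) is analytic, together with a disc around c that contains no
    singularity but c. The set is open and contains [a, b].\<close>
  define W where "W = {z. Re z > 0} \<inter> (A \<union> ball (of_real c) r)"
  have "open A" unfolding A_def by (intro open_vimage open_analytic_points continuous_intros)
  then have W: "open W" unfolding W_def by (intro open_Int open_Un open_ball open_Collect_less continuous_intros)
  have Wan: "f analytic_on {\<i> * z}" if "z \<in> W" "z \<noteq> of_real c" for z
  proof (cases "z \<in> A")
    case False
    then have "dist (complex_of_real c) z < r" using that by (simp add: W_def)
    then have "\<i> * z \<in> ball (\<i> * of_real c) r - {\<i> * of_real c}"
    proof -
      have "dist (\<i> * complex_of_real c) (\<i> * z) = norm (\<i> * (of_real c - z))"
        by (simp only: dist_norm right_diff_distrib)
      also have "\<dots> = dist (of_real c) z" by (simp only: norm_mult norm_ii mult_1_left dist_norm)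
      finally show ?thesis using \<open>dist (complex_of_real c) z < r\<close> that(2) by simp
    qed
    then show ?thesis by (intro analytic_on_subset[OF r(2)]) simp
  qed (simp add: A_def)
  define K where "K = complex_of_real ` {a..b}"
  have K: "compact K" unfolding K_def by (intro compact_continuous_image continuous_intros) auto
  have KW: "K \<subseteq> W"
  proof
    fix z assume "z \<in> K"
    then obtain t where t: "z = of_real t" "a \<le> t" "t \<le> b" by (auto simp: K_def)
    have tp: "t > 0" using t a by simp
    show "z \<in> W"
    proof (cases "t = c")
      case True
      then show ?thesis using t(1) tp r(1) by (simp add: W_def)
    next
      case False
      have "t \<notin> axis_poles f"
      proof
        assume "t \<in> axis_poles f"
        with t(2,3) have "t \<in> axis_poles f \<inter> {a..b}" by simp
        then show False unfolding p using False by simp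
      qed
      from tame_form_analytic[OF f tp this] show ?thesis using t(1) tp by (simp add: W_def A_def)
    qed
  qed
  obtain d where d: "d > 0" "(\<Union>x\<in>K. ball x d) \<subseteq> W"
    using compact_subset_open_imp_ball_epsilon_subset[OF K W KW] by blast
  \<comment> \<open>A rectangle around [a, b] with margin d / 2: each of its points is at distance
    less than d from the point of [a, b] nearest to its real part, hence lies in W. The later choice
    e = d / 4 fits within the margin.\<close>
  define U where "U = {z. Re z > a - d / 2} \<inter> {z. Re z < b + d / 2} \<inter> {z. Im z > - d / 2} \<inter> {z. Im z < d / 2}"
  have U: "open U" "convex U"
    unfolding U_def
     apply (intro open_Int open_Collect_less continuous_intros)
    apply (intro convex_Int convex_halfspace_Re_gt convex_halfspace_Re_lt convex_halfspace_Im_gt convex_halfspace_Im_lt)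
    done
  have UW: "z \<in> W" if "z \<in> U" for z
  proof -
    define t where "t = max a (min b (Re z))"
    have rz: "a - d / 2 < Re z" "Re z < b + d / 2" "\<bar>Im z\<bar> < d / 2"
      using that by (auto simp: U_def)
    have t: "t \<in> {a..b}" "\<bar>Re z - t\<bar> < d / 2"
      using rz a d(1) unfolding t_def by (auto simp: max_def min_def abs_if)
    have "norm (z - of_real t) \<le> \<bar>Re (z - of_real t)\<bar> + \<bar>Im (z - of_real t)\<bar>" by (rule cmod_le)
    also have "\<dots> < d / 2 + d / 2" using t(2) rz(3) by simp
    finally have "z \<in> ball (of_real t) d" by (simp add: dist_norm norm_minus_commute)
    moreover have "complex_of_real t \<in> K" using t by (simp add: K_def)
    ultimately show ?thesis using d(2) by blast
  qed
  have "Re z > 0" if "z \<in> U" for z using UW[OF that] by (simp add: W_def)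
  moreover have "f analytic_on {\<i> * z}" if "z \<in> U" "z \<noteq> of_real c" for z
    by (rule Wan[OF UW[OF that(1)] that(2)])
  moreover have "of_real a \<in> U" "of_real b \<in> U" "of_real c \<in> U" "Complex c (d / 4) \<in> U" "Complex c (- (d / 4)) \<in> U"
    using a d(1) by (simp_all add: U_def)
  moreover have "0 < d / 4" using d(1) by simp
  ultimately have "pole_box f a b c (d / 4) U"
    unfolding pole_box_def using U pole a(2,3) by (intro conjI ballI impI) simp_all
  then show ?thesis by (intro exI)
qed

lemma pole_box_D_op:
  assumes f: "tame_form f" and B: "pole_box f a b c e U"
  shows "pole_box (D_op f) a b c e U"
proof -
  have D: "D_op f = (\<lambda>z. inverse (2 * of_real pi * \<i>) * deriv f z)"
    by (rule ext) (simp add: D_op_def field_simps)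
  have "D_op f analytic_on {\<i> * z}" if "f analytic_on {\<i> * z}" for z
    using that unfolding D by (intro analytic_on_mult analytic_on_const analytic_deriv)
  moreover have "is_pole (D_op f) (\<i> * of_real c)"
  proof -
    have "c > 0" using B unfolding pole_box_def by (metis Re_complex_of_real)
    then have "f meromorphic_on {\<i> * of_real c}"
      using f by (auto simp: tame_form_def intro: meromorphic_on_subset)
    moreover have "is_pole f (\<i> * of_real c)" using B by (simp add: pole_box_def)
    ultimately show ?thesis unfolding D by (subst is_pole_cmult_iff) (simp_all add: is_pole_deriv_iff)
  qed
  ultimately show ?thesis using B unfolding pole_box_def by blast
qed

lemma pole_box_holomorphic:
  assumes B: "pole_box f a b c e U"
  shows "(\<lambda>z. f (\<i> * z)) holomorphic_on U - {of_real c}"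
proof (rule analytic_imp_holomorphic, subst analytic_on_analytic_at, rule ballI)
  fix z assume "z \<in> U - {of_real c}"
  then have "f analytic_on {\<i> * z}" using B by (auto simp: pole_box_def)
  moreover have "(\<lambda>z. \<i> * z) analytic_on {z}" by (intro analytic_intros)
  ultimately show "(\<lambda>z. f (\<i> * z)) analytic_on {z}"
    using analytic_on_compose_gen[of "\<lambda>z. \<i> * z" "{z}" f "{\<i> * z}"] by (simp add: o_def)
qed

lemma pole_box_bypass:
  assumes B: "pole_box f a b c e U"
  shows "bypass a b c e \<subseteq> U - {of_real c}"
proof -
  have "bypass a b c e \<subseteq> U" by (rule bypass_subset) (use B in \<open>auto simp: pole_box_def\<close>)
  moreover have "z \<noteq> of_real c" if "z \<in> bypass a b c e" for z
    by (rule bypass_cases[OF that]) (use B in \<open>auto simp: pole_box_def\<close>)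
  ultimately show ?thesis by blast
qed

text \<open>Clearing the pole on all of \<open>U\<close>, f (i z) = g(z) / (z - c)^N with g
  holomorphic, reduces the claim to \<open>has_finite_part_pole_avg\<close> for g(z) z powr (s -
  1).\<close>

lemma pole_box_finite_part:
  assumes B: "pole_box f a b c e U"
  shows "has_finite_part (mellin_integrand f s) a b c (pole_avg (\<lambda>z. f (\<i> * z) * z powr (s - 1)) a b c e)"
proof -
  note B' = B[unfolded pole_box_def]
  define h where "h = (\<lambda>z. f (\<i> * z))"
  have U: "open U" "convex U" "of_real a \<in> U" "of_real b \<in> U" "Complex c e \<in> U" "Complex c (- e) \<in> U"
    and cU: "of_real c \<in> U" and ab: "a < c" "c < b" and e: "e > 0" and pole: "is_pole f (\<i> * of_real c)"
    using B' by simp_all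
  have pos: "Re z > 0" if "z \<in> U" for z using B' that by blast
  have hol: "h holomorphic_on U - {of_real c}" unfolding h_def by (rule pole_box_holomorphic[OF B])
  have hp: "is_pole h (of_real c)"
  proof -
    have "filterlim (\<lambda>z. \<i> * z) (at (\<i> * of_real c)) (at (complex_of_real c))"
      unfolding filterlim_at
    proof
      show "((\<lambda>z. \<i> * z) \<longlongrightarrow> \<i> * of_real c) (at (complex_of_real c))" by (intro tendsto_intros)
      show "\<forall>\<^sub>F z in at (complex_of_real c). \<i> * z \<in> UNIV \<and> \<i> * z \<noteq> \<i> * of_real c"
        using eventually_neq_at_within[of "complex_of_real c" "complex_of_real c" UNIV]
        by eventually_elim simp
    qed
    then show ?thesis using pole unfolding is_pole_def h_def by (rule filterlim_compose[rotated])
  qed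
  define N where "N = nat (- zorder h (of_real c))"
  define k where "k = zor_poly h (of_real c)"
  obtain r where r: "r > 0" "cball (of_real c) r \<subseteq> U" "k holomorphic_on cball (of_real c) r"
    "\<And>w. w \<in> cball (of_real c) r - {of_real c} \<Longrightarrow> h w = k w / (w - of_real c) ^ N"
    using zorder_exist_pole[OF hol U(1) cU hp] unfolding N_def k_def by blast
  \<comment> \<open>The local factor at the pole and h (z - c)^N agree near c, so they glue to one
    function on the whole convex set.\<close>
  define g where "g = (\<lambda>z. if z = of_real c then k z else h z * (z - of_real c) ^ N)"
  have "g holomorphic_on ball (of_real c) r \<union> (U - {of_real c})"
  proof (rule holomorphic_on_Un)
    have "k holomorphic_on ball (of_real c) r" by (rule holomorphic_on_subset[OF r(3)]) auto
    then show "g holomorphic_on ball (of_real c) r"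
      by (rule holomorphic_transform) (use r(4) in \<open>auto simp: g_def\<close>)
    have "(\<lambda>z. h z * (z - of_real c) ^ N) holomorphic_on U - {of_real c}"
      by (intro holomorphic_on_mult hol holomorphic_on_power holomorphic_on_diff holomorphic_on_ident holomorphic_on_const)
    then show "g holomorphic_on U - {of_real c}"
      by (rule holomorphic_transform) (auto simp: g_def)
  qed (use U(1) in auto)
  moreover have "ball (of_real c) r \<union> (U - {of_real c}) = U" using r(1,2) by auto
  ultimately have g: "g holomorphic_on U" by simp
  have "(\<lambda>z. z powr (s - 1)) holomorphic_on U"
    by (intro holomorphic_intros) (use pos in \<open>force simp: complex_nonpos_Reals_iff\<close>)
  with g have gs: "(\<lambda>z. g z * z powr (s - 1)) holomorphic_on U" by (rule holomorphic_on_mult)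
  have eq: "g z * z powr (s - 1) / (z - of_real c) ^ N = f (\<i> * z) * z powr (s - 1)" if "z \<noteq> of_real c" for z
    using that by (simp add: g_def h_def)
  have "pole_avg (\<lambda>z. g z * z powr (s - 1) / (z - of_real c) ^ N) a b c e =
     pole_avg (\<lambda>z. f (\<i> * z) * z powr (s - 1)) a b c e"
    by (rule pole_avg_cong[OF eq]) (use pole_box_bypass[OF B] in blast)
  with has_finite_part_pole_avg[OF U ab e gs, of N]
  have "has_finite_part (\<lambda>t. g (of_real t) * of_real t powr (s - 1) / (of_real t - of_real c) ^ N) a b c
    (pole_avg (\<lambda>z. f (\<i> * z) * z powr (s - 1)) a b c e)" by simp
  then show ?thesis
    by (rule has_finite_part_cong) (simp add: mellin_integrand_def eq)
qed

lemma pole_box_continuous: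
  assumes B: "pole_box f a b c e U"
  shows "continuous_on (bypass a b c e) (\<lambda>z. f (\<i> * z))"
    and "continuous_on (bypass a b c e) (\<lambda>z. f (\<i> * z) * z powr s)"
    and "z \<in> bypass a b c e \<Longrightarrow> Re z > 0"
proof -
  show c: "continuous_on (bypass a b c e) (\<lambda>z. f (\<i> * z))"
    by (rule continuous_on_subset[OF holomorphic_on_imp_continuous_on[OF pole_box_holomorphic[OF B]] pole_box_bypass[OF B]])
  show pos: "Re z > 0" if "z \<in> bypass a b c e" for z
    using subsetD[OF pole_box_bypass[OF B] that] B by (auto simp: pole_box_def)
  have "continuous_on (bypass a b c e) (\<lambda>z. z powr s)"
    by (intro continuous_intros) (use pos in force)+
  with c show "continuous_on (bypass a b c e) (\<lambda>z. f (\<i> * z) * z powr s)" by (rule continuous_on_mult)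
qed

lemma pole_box_avg_entire:
  assumes B: "pole_box f a b c e U"
  shows "(\<lambda>s. pole_avg (\<lambda>z. f (\<i> * z) * z powr (s - 1)) a b c e) holomorphic_on UNIV"
  by (rule pole_avg_holomorphic[OF pole_box_continuous(1)[OF B] pole_box_continuous(3)[OF B]])

text \<open>The integrand - 2 pi D f (i z) z powr (s - 1) + (s - 1) f (i z) z powr (s - 2) has the
  single-valued primitive f (i z) z powr (s - 1) around the pole, so the average is a boundary
  difference, whatever the order of the pole.\<close>

lemma pole_box_by_parts:
  assumes f: "tame_form f" and B: "pole_box f a b c e U"
  shows "pole_avg (\<lambda>z. D_op f (\<i> * z) * z powr (s - 1)) a b c e =
     ((s - 1) * pole_avg (\<lambda>z. f (\<i> * z) * z powr (s - 2)) a b c e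
       - (mellin_integrand f s b - mellin_integrand f s a)) / (2 * of_real pi)"
proof -
  let ?P = "complex_of_real (2 * pi)"
  let ?D = "\<lambda>z. D_op f (\<i> * z) * z powr (s - 1)" and ?F = "\<lambda>z. f (\<i> * z) * z powr (s - 2)"
  note cD = pole_box_continuous(2)[OF pole_box_D_op[OF f B], of "s - 1"]
  note cF = pole_box_continuous(2)[OF B, of "s - 2"]
  have "pole_avg (\<lambda>z. - ?P * ?D z + (s - 1) * ?F z) a b c e =
      f (\<i> * of_real b) * of_real b powr (s - 1) - f (\<i> * of_real a) * of_real a powr (s - 1)"
  proof (rule pole_avg_primitive)
    fix z assume z: "z \<in> bypass a b c e"
    have an: "f analytic_on {\<i> * z}" using subsetD[OF pole_box_bypass[OF B] z] B by (auto simp: pole_box_def)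
    have "Re z > 0" by (rule pole_box_continuous(3)[OF B z])
    then have zn: "z \<notin> \<real>\<^sub>\<le>\<^sub>0" by (auto simp: complex_nonpos_Reals_iff)
    have d1: "((\<lambda>z. f (\<i> * z)) has_field_derivative deriv f (\<i> * z) * \<i>) (at z)"
      by (rule DERIV_chain2[where f = f and g = "\<lambda>z. \<i> * z", OF analytic_has_deriv[OF an]])
         (auto intro!: derivative_eq_intros)
    have d2: "((\<lambda>z. z powr (s - 1)) has_field_derivative (s - 1) * z powr (s - 2)) (at z)"
      using zn by (auto intro!: derivative_eq_intros simp: diff_diff_eq)
    show "((\<lambda>z. f (\<i> * z) * z powr (s - 1)) has_field_derivative - ?P * ?D z + (s - 1) * ?F z) (at z)"
      by (rule DERIV_cong[OF DERIV_mult[OF d1 d2]]) (simp add: D_op_def field_simps)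
  qed
  moreover have "pole_avg (\<lambda>z. - ?P * ?D z + (s - 1) * ?F z) a b c e = - ?P * pole_avg ?D a b c e + (s - 1) * pole_avg ?F a b c e"
    by (subst pole_avg_add[OF continuous_on_mult[OF continuous_on_const cD] continuous_on_mult[OF continuous_on_const cF]])
       (simp only: pole_avg_cmult[OF cD] pole_avg_cmult[OF cF])
  ultimately have "- ?P * pole_avg ?D a b c e + (s - 1) * pole_avg ?F a b c e = mellin_integrand f s b - mellin_integrand f s a"
    by (simp only: mellin_integrand_def)
  then have "?P * pole_avg ?D a b c e = (s - 1) * pole_avg ?F a b c e - (mellin_integrand f s b - mellin_integrand f s a)"
    by (simp add: algebra_simps)
  then show ?thesis by (simp add: field_simps)
qed

section \<open>Existence and uniqueness of the complete L-function\<close>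

text \<open>The oriented integral from x to y. With it, corresponding points of two splittings can
  be compared without regard to their order.\<close>

definition signed_integral :: "(real \<Rightarrow> complex) \<Rightarrow> real \<Rightarrow> real \<Rightarrow> complex" where
  "signed_integral m x y = (if x \<le> y then integral {x..y} m else - integral {y..x} m)"

lemma signed_integral_swap: "signed_integral m y x = - signed_integral m x y"
  by (auto simp: signed_integral_def)

section \<open>Comparison of two splittings\<close>

lemma inf_piece_signed:
  assumes \<sigma>: "\<sigma> \<in> {1, -1}" and f: "tame_form f" and x: "0 < x" "0 < y"
    and p: "axis_poles f \<inter> {x..} = {}" "axis_poles f \<inter> {y..} = {}"
    and u: "has_reg_integral_inf \<sigma> (mellin_integrand f s) x u"
    and v: "has_reg_integral_inf \<sigma> (mellin_integrand f s) y v"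
  shows "u - v = signed_integral (mellin_integrand f s) x y"
proof (cases "x \<le> y")
  case True
  from inf_piece_change[OF \<sigma> f x(1) True p(1) u v] True show ?thesis by (simp add: signed_integral_def)
next
  case False
  then have "y \<le> x" by simp
  from inf_piece_change[OF \<sigma> f x(2) this p(2) v u] False show ?thesis by (simp add: signed_integral_def)
qed

lemma zero_piece_signed:
  assumes \<sigma>: "\<sigma> \<in> {1, -1}" and f: "tame_form f" and x: "0 < x" "0 < y"
    and p: "axis_poles f \<inter> {0<..x} = {}" "axis_poles f \<inter> {0<..y} = {}"
    and u: "has_reg_integral_zero \<sigma> (mellin_integrand f s) x u"
    and v: "has_reg_integral_zero \<sigma> (mellin_integrand f s) y v"
  shows "u - v = signed_integral (mellin_integrand f s) y x"
proof (cases "y \<le> x")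
  case True
  from zero_piece_change[OF \<sigma> f x(2) True p(1) v u] True show ?thesis by (simp add: signed_integral_def)
next
  case False
  then have "x \<le> y" by simp
  from zero_piece_change[OF \<sigma> f x(1) this p(2) u v] False show ?thesis by (simp add: signed_integral_def)
qed

text \<open>Both intervals are compared with their intersection, which still contains c in its
  interior; each arises from it by adding pole-free intervals.\<close>

lemma pole_piece_signed:
  assumes f: "tame_form f" and a: "0 < a" "0 < a'" "a < c" "a' < c" "c < b" "c < b'"
    and p: "axis_poles f \<inter> {a..b} = {c}" "axis_poles f \<inter> {a'..b'} = {c}"
    and u: "has_reg_integral_pole (mellin_integrand f s) a b c u"
    and v: "has_reg_integral_pole (mellin_integrand f s) a' b' c v"
  shows "u - v = signed_integral (mellin_integrand f s) a a' + signed_integral (mellin_integrand f s) b' b"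
proof -
  define A where "A = max a a'"
  define B where "B = min b b'"
  have AB: "0 < A" "A < c" "c < B" "a \<le> A" "a' \<le> A" "B \<le> b" "B \<le> b'" using a by (auto simp: A_def B_def)
  let ?m = "mellin_integrand f s"
  have cm: "c \<in> axis_poles f" using p(1) by blast
  have only: "t = c" if "t \<in> axis_poles f" "a \<le> t" "t \<le> b \<or> t \<le> b'" "a' \<le> t" for t
    using that p by (metis IntI atLeastAtMost_iff singletonD)
  have sub: "axis_poles f \<inter> {A..B} = {c}"
  proof (intro equalityI subsetI)
    fix t assume "t \<in> axis_poles f \<inter> {A..B}"
    then show "t \<in> {c}" using only[of t] AB by auto
  qed (use cm AB in auto)
  obtain e U where box: "pole_box f A B c e U" using pole_box_exists[OF f AB(1-3) sub] by blast
  note fp = pole_box_finite_part[OF box, of s]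
  have L: "continuous_on {x..A} ?m" if "0 < x" "axis_poles f \<inter> {x..y} = {c}" "c < y" for x y
  proof (rule axis_continuous(2)[OF f])
    show "{x..A} \<inter> axis_poles f = {}"
    proof -
      have "t \<notin> axis_poles f" if "t \<in> {x..A}" for t
      proof
        assume "t \<in> axis_poles f"
        with that have "t \<in> axis_poles f \<inter> {x..y}" using AB \<open>c < y\<close> by simp
        then show False unfolding \<open>axis_poles f \<inter> {x..y} = {c}\<close> using that AB by simp
      qed
      then show ?thesis by blast
    qed
  qed (use that in auto)
  have R: "continuous_on {B..y} ?m" if "0 < x" "axis_poles f \<inter> {x..y} = {c}" "x < c" for x y
  proof (rule axis_continuous(2)[OF f])
    show "{B..y} \<inter> axis_poles f = {}"
    proof -
      have "t \<notin> axis_poles f" if "t \<in> {B..y}" for t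
      proof
        assume "t \<in> axis_poles f"
        with that have "t \<in> axis_poles f \<inter> {x..y}" using AB \<open>x < c\<close> by simp
        then show False unfolding \<open>axis_poles f \<inter> {x..y} = {c}\<close> using that AB by simp
      qed
      then show ?thesis by blast
    qed
  qed (use AB in auto)
  obtain w where w: "has_finite_part ?m A B c w" using fp by blast
  have "u = w + integral {a..A} ?m + integral {B..b} ?m"
    by (rule has_reg_integral_pole_unique[OF u has_finite_part_imp_reg_integral[OF has_finite_part_extend[OF w
          AB(4) AB(2,3) AB(6) L[OF a(1) p(1) a(5)] R[OF a(1) p(1) a(3)]]]])
  moreover have "v = w + integral {a'..A} ?m + integral {B..b'} ?m"
    by (rule has_reg_integral_pole_unique[OF v has_finite_part_imp_reg_integral[OF has_finite_part_extend[OF w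
          AB(5) AB(2,3) AB(7) L[OF a(2) p(2) a(6)] R[OF a(2) p(2) a(4)]]]])
  moreover have "integral {a..A} ?m - integral {a'..A} ?m = signed_integral ?m a a'"
    by (cases "a \<le> a'") (auto simp: A_def signed_integral_def max_def)
  moreover have "integral {B..b} ?m - integral {B..b'} ?m = signed_integral ?m b' b"
    by (cases "b' \<le> b") (auto simp: B_def signed_integral_def min_def)
  ultimately show ?thesis by (simp add: algebra_simps)
qed

lemma signed_integral_entire:
  assumes f: "tame_form f" and xy: "0 < x" "0 < y" and p: "axis_poles f \<inter> {min x y..max x y} = {}"
  shows "(\<lambda>s. signed_integral (mellin_integrand f s) x y) holomorphic_on UNIV"
proof -
  have h: "(\<lambda>s. integral {u..v} (mellin_integrand f s)) holomorphic_on UNIV"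
    if "0 < u" "axis_poles f \<inter> {u..v} = {}" for u v
  proof -
    have "continuous_on {u..v} (\<lambda>t. f (\<i> * of_real t))"
      by (rule axis_continuous(1)[OF f]) (use that in auto)
    from holomorphic_Mellin_interval[OF that(1) this] show ?thesis
      by (simp add: mellin_integrand_def[abs_def])
  qed
  show ?thesis
  proof (cases "x \<le> y")
    case True
    then show ?thesis using h[of x y] xy p by (simp add: signed_integral_def)
  next
    case False
    then show ?thesis using holomorphic_on_minus[OF h[of y x]] xy p by (simp add: signed_integral_def)
  qed
qed

text \<open>For each j the j-th points of two splittings lie in the same gap of the sequence of
  poles, so the integral between them is an ordinary one.\<close>

lemma splitting_gap:
  assumes 1: "pole_splitting f as cs" and 2: "pole_splitting f as' cs" and j: "j \<le> length cs"
  shows "axis_poles f \<inter> {min (as ! j) (as' ! j)..max (as ! j) (as' ! j)} = {}"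
proof (rule ccontr)
  note p = pole_splittingD[OF 1] and p' = pole_splittingD[OF 2]
  assume "axis_poles f \<inter> {min (as ! j) (as' ! j)..max (as ! j) (as' ! j)} \<noteq> {}"
  then obtain t where t: "t \<in> set cs" "min (as ! j) (as' ! j) \<le> t" "t \<le> max (as ! j) (as' ! j)"
    unfolding p(11) by auto
  then obtain i where i: "i < length cs" "t = cs ! i" by (auto simp: in_set_conv_nth)
  show False
  proof (cases "i < j")
    case True
    have "cs ! i < as ! Suc i" "cs ! i < as' ! Suc i" using p(5) p'(5) i(1) by auto
    moreover have "as ! Suc i \<le> as ! j" "as' ! Suc i \<le> as' ! j" using p(9) p'(9) True j by auto
    ultimately show False using t(2) i(2) by simp
  next
    case False
    have "as ! i < cs ! i" "as' ! i < cs ! i" using p(4) p'(4) i(1) by auto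
    moreover have "as ! j \<le> as ! i" "as' ! j \<le> as' ! i" using p(9) p'(9) False i(1) by auto
    ultimately show False using t(3) i(2) by simp
  qed
qed

text \<open>A nicely meromorphic function is recovered from its values near a point: its value is
  the limit there, or 0 at a pole, which is what \<open>remove_sings\<close> computes.\<close>

lemma nicely_meromorphic_eqI:
  assumes f: "f nicely_meromorphic_on UNIV" and g: "g nicely_meromorphic_on UNIV" and eq: "\<forall>\<^sub>\<approx>s. f s = g s"
  shows "f = g"
proof
  fix z
  have ev: "eventually (\<lambda>s. f s = g s) (at z)"
    using eq by (rule eventually_cosparse_imp_eventually_at) auto
  have rf: "remove_sings h z = h z" if "h nicely_meromorphic_on UNIV" for h
  proof -
    have "(is_pole h z \<and> h z = 0) \<or> h \<midarrow>z\<rightarrow> h z" using that unfolding nicely_meromorphic_on_def by blast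
    then show ?thesis
    proof
      assume "is_pole h z \<and> h z = 0"
      then show ?thesis by simp
    next
      assume "h \<midarrow>z\<rightarrow> h z"
      then show ?thesis by (rule remove_sings_eqI)
    qed
  qed
  have "remove_sings f z = remove_sings g z" by (rule remove_sings_cong[OF ev refl])
  then show "f z = g z" unfolding rf[OF f] rf[OF g] .
qed

lemma is_complete_L_unique:
  assumes \<sigma>: "\<sigma> \<in> {1, -1}" and f: "tame_form f" and L: "is_complete_L \<sigma> f \<Lambda>" and L': "is_complete_L \<sigma> f \<Lambda>'"
  shows "\<Lambda> = \<Lambda>'"
proof -
  from L obtain as cs \<Lambda>\<^sub>0 \<Lambda>\<^sub>1 I M\<^sub>0 M\<^sub>1 where A: "\<Lambda> nicely_meromorphic_on UNIV" "pole_splitting f as cs"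
    "\<Lambda>\<^sub>0 meromorphic_on UNIV" "\<Lambda>\<^sub>1 meromorphic_on UNIV"
    "\<And>s. Re s > M\<^sub>0 \<Longrightarrow> has_reg_integral_zero \<sigma> (mellin_integrand f s) (hd as) (\<Lambda>\<^sub>0 s)"
    "\<And>s. Re s < M\<^sub>1 \<Longrightarrow> has_reg_integral_inf \<sigma> (mellin_integrand f s) (last as) (\<Lambda>\<^sub>1 s)"
    "\<And>j s. j < length cs \<Longrightarrow> has_reg_integral_pole (mellin_integrand f s) (as ! j) (as ! Suc j) (cs ! j) (I j s)"
    "\<forall>\<^sub>\<approx>s. \<Lambda> s = \<Lambda>\<^sub>0 s + (\<Sum>j<length cs. I j s) + \<Lambda>\<^sub>1 s"
    unfolding is_complete_L_def by blast
  from L' obtain as' cs' \<Lambda>\<^sub>0' \<Lambda>\<^sub>1' I' M\<^sub>0' M\<^sub>1' where B: "\<Lambda>' nicely_meromorphic_on UNIV" "pole_splitting f as' cs'"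
    "\<Lambda>\<^sub>0' meromorphic_on UNIV" "\<Lambda>\<^sub>1' meromorphic_on UNIV"
    "\<And>s. Re s > M\<^sub>0' \<Longrightarrow> has_reg_integral_zero \<sigma> (mellin_integrand f s) (hd as') (\<Lambda>\<^sub>0' s)"
    "\<And>s. Re s < M\<^sub>1' \<Longrightarrow> has_reg_integral_inf \<sigma> (mellin_integrand f s) (last as') (\<Lambda>\<^sub>1' s)"
    "\<And>j s. j < length cs' \<Longrightarrow> has_reg_integral_pole (mellin_integrand f s) (as' ! j) (as' ! Suc j) (cs' ! j) (I' j s)"
    "\<forall>\<^sub>\<approx>s. \<Lambda>' s = \<Lambda>\<^sub>0' s + (\<Sum>j<length cs'. I' j s) + \<Lambda>\<^sub>1' s"
    unfolding is_complete_L_def by blast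
  note p = pole_splittingD[OF A(2)] and p' = pole_splittingD[OF B(2)]
  have "set cs' = set cs" unfolding p(11) p'(11) ..
  then have cs: "cs' = cs" using strict_sorted_equal[OF p(12) p'(12)] by simp
  note B = B[unfolded cs] and p' = p'[unfolded cs]
  define n where "n = length cs"
  \<comment> \<open>Passing from the second splitting to the first adds d 0 to the piece at 0 and d
    (j+1) - d j to the j-th inner piece, and subtracts d n from the piece at infinity; the total is
    0.\<close>
  define d where "d = (\<lambda>j s. signed_integral (mellin_integrand f s) (as' ! j) (as ! j))"
  have d: "d j holomorphic_on UNIV" if "j \<le> n" for j
    unfolding d_def using that p(10)[of j] p'(10)[of j] splitting_gap[OF B(2) A(2), of j]
    by (intro signed_integral_entire[OF f]) (auto simp: n_def)
  \<comment> \<open>The end pieces are given by integrals only in a right and in a left half-plane,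
    respectively. Each relation is therefore continued on its own, while the relation between inner
    pieces holds for every s.\<close>
  have "\<forall>\<^sub>\<approx>s. \<Lambda>\<^sub>0 s = \<Lambda>\<^sub>0' s + d 0 s"
  proof (rule meromorphic_identity_right[OF A(3)])
    show "(\<lambda>s. \<Lambda>\<^sub>0' s + d 0 s) meromorphic_on UNIV"
      by (intro meromorphic_on_add B(3) entire_imp_meromorphic d) simp
    show "\<Lambda>\<^sub>0 s = \<Lambda>\<^sub>0' s + d 0 s" if "Re s > max M\<^sub>0 M\<^sub>0'" for s
    proof -
      have "\<Lambda>\<^sub>0 s - \<Lambda>\<^sub>0' s = d 0 s"
        unfolding d_def
        by (rule zero_piece_signed[OF \<sigma> f p(10)[of 0] p'(10)[of 0] p(7) p'(7) A(5)[unfolded p(2)] B(5)[unfolded p'(2)]])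
           (use that in simp_all)
      then have "\<Lambda>\<^sub>0 s = d 0 s + \<Lambda>\<^sub>0' s" by (rule diff_eq_eq[THEN iffD1])
      then show ?thesis by (simp only: add.commute)
    qed
  qed
  moreover have "\<forall>\<^sub>\<approx>s. \<Lambda>\<^sub>1 s = \<Lambda>\<^sub>1' s - d n s"
  proof (rule meromorphic_identity_left[OF A(4)])
    show "(\<lambda>s. \<Lambda>\<^sub>1' s - d n s) meromorphic_on UNIV"
      by (intro meromorphic_on_diff B(4) entire_imp_meromorphic d) simp
    show "\<Lambda>\<^sub>1 s = \<Lambda>\<^sub>1' s - d n s" if "Re s < min M\<^sub>1 M\<^sub>1'" for s
    proof -
      have "\<Lambda>\<^sub>1 s - \<Lambda>\<^sub>1' s = signed_integral (mellin_integrand f s) (as ! n) (as' ! n)"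
        unfolding n_def
        by (rule inf_piece_signed[OF \<sigma> f p(10) p'(10) p(8) p'(8) A(6)[unfolded p(3)] B(6)[unfolded p'(3)]])
           (use that in simp_all)
      also have "\<dots> = - d n s" unfolding d_def by (rule signed_integral_swap)
      finally have "\<Lambda>\<^sub>1 s = - d n s + \<Lambda>\<^sub>1' s" by (rule diff_eq_eq[THEN iffD1])
      then show ?thesis by (simp only: uminus_add_conv_diff)
    qed
  qed
  moreover have I: "I j s - I' j s = d (Suc j) s - d j s" if j: "j < n" for j s
  proof -
    have j': "j < length cs" using j by (simp add: n_def)
    have "I j s - I' j s = signed_integral (mellin_integrand f s) (as ! j) (as' ! j) +
        signed_integral (mellin_integrand f s) (as' ! Suc j) (as ! Suc j)"
      by (rule pole_piece_signed[OF f p(10) p'(10) p(4)[OF j'] p'(4)[OF j'] p(5)[OF j'] p'(5)[OF j']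
           p(6)[OF j'] p'(6)[OF j'] A(7)[OF j'] B(7)[OF j']]) (use j' in simp_all)
    then show ?thesis using signed_integral_swap[of _ "as' ! j" "as ! j"] by (simp add: d_def)
  qed
  have S: "(\<Sum>j<n. I j s) = (\<Sum>j<n. I' j s) + (d n s - d 0 s)" for s
  proof -
    have "(\<Sum>j<n. I j s) - (\<Sum>j<n. I' j s) = (\<Sum>j<n. d (Suc j) s - d j s)"
      unfolding sum_subtractf[symmetric] using I by (intro sum.cong) auto
    also have "\<dots> = d n s - d 0 s" by (rule sum_lessThan_telescope)
    finally show ?thesis by (simp add: algebra_simps)
  qed
  from calculation A(8) B(8) have "\<forall>\<^sub>\<approx>s. \<Lambda> s = \<Lambda>' s"
    unfolding n_def[symmetric] by eventually_elim (simp add: S)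
  then show ?thesis by (rule nicely_meromorphic_eqI[OF A(1) B(1)])
qed

lemma is_complete_L_exists:
  assumes \<sigma>: "\<sigma> \<in> {1, -1}" and f: "tame_form f"
  shows "\<exists>\<Lambda>. is_complete_L \<sigma> f \<Lambda>"
proof -
  obtain as cs where s: "pole_splitting f as cs"
    using pole_splitting_exists[OF finite_axis_poles[OF f]] by blast
  note p = pole_splittingD[OF s]
  have pos: "0 < as ! 0" "0 < as ! length cs" by (simp_all add: p(10))
  obtain \<Lambda>\<^sub>0 M\<^sub>0 where 0: "\<Lambda>\<^sub>0 meromorphic_on UNIV"
    "\<And>s. Re s > M\<^sub>0 \<Longrightarrow> has_reg_integral_zero \<sigma> (mellin_integrand f s) (as ! 0) (\<Lambda>\<^sub>0 s)"
    using zero_piece_exists[OF \<sigma> f pos(1) p(7)] by blast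
  obtain \<Lambda>\<^sub>1 M\<^sub>1 where 1: "\<Lambda>\<^sub>1 meromorphic_on UNIV"
    "\<And>s. Re s < M\<^sub>1 \<Longrightarrow> has_reg_integral_inf \<sigma> (mellin_integrand f s) (as ! length cs) (\<Lambda>\<^sub>1 s)"
    using inf_piece_exists[OF \<sigma> f pos(2) p(8)] by blast
  have "\<exists>e U. pole_box f (as ! j) (as ! Suc j) (cs ! j) e U" if "j < length cs" for j
    by (rule pole_box_exists[OF f p(10) p(4)[OF that] p(5)[OF that] p(6)[OF that]]) (use that in simp)
  then obtain e U where box: "\<And>j. j < length cs \<Longrightarrow> pole_box f (as ! j) (as ! Suc j) (cs ! j) (e j) (U j)"
    by metis
  define I where "I = (\<lambda>j s. pole_avg (\<lambda>z. f (\<i> * z) * z powr (s - 1)) (as ! j) (as ! Suc j) (cs ! j) (e j))"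
  have I: "I j meromorphic_on UNIV" "has_reg_integral_pole (mellin_integrand f s) (as ! j) (as ! Suc j) (cs ! j) (I j s)"
    if "j < length cs" for j s
    unfolding I_def
     apply (rule entire_imp_meromorphic[OF pole_box_avg_entire[OF box[OF that]]])
    apply (rule has_finite_part_imp_reg_integral[OF pole_box_finite_part[OF box[OF that]]])
    done
  \<comment> \<open>The sum of the continued pieces; \<open>remove_sings\<close> then picks its
    nicely meromorphic representative.\<close>
  define Z where "Z = (\<lambda>s. \<Lambda>\<^sub>0 s + (\<Sum>j<length cs. I j s) + \<Lambda>\<^sub>1 s)"
  have Z: "Z meromorphic_on UNIV"
    unfolding Z_def by (intro meromorphic_on_add 0(1) 1(1) meromorphic_on_sum I(1)) simp
  have ev: "\<forall>\<^sub>\<approx>s. remove_sings Z s = \<Lambda>\<^sub>0 s + (\<Sum>j<length cs. I j s) + \<Lambda>\<^sub>1 s"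
    using eventually_remove_sings_eq[OF Z] by eventually_elim (simp only: Z_def)
  have "is_complete_L \<sigma> f (remove_sings Z)"
    by (rule is_complete_LI[OF remove_sings_nicely_meromorphic[OF Z] s 0(1) 1(1) 0(2)[folded p(2)]
          1(2)[folded p(3)] I(2) ev])
  then show ?thesis by blast
qed

lemma complete_L_is_complete_L:
  assumes "\<sigma> \<in> {1, -1}" "tame_form f"
  shows "is_complete_L \<sigma> f (complete_L \<sigma> f)"
proof -
  obtain \<Lambda> where L: "is_complete_L \<sigma> f \<Lambda>" using is_complete_L_exists[OF assms] by blast
  show ?thesis unfolding complete_L_def
    by (rule theI[of "is_complete_L \<sigma> f", OF L]) (rule is_complete_L_unique[OF assms _ L])
qed

section \<open>The effect of D on the complete L-function\<close>

lemma cosparse_shift: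
  fixes c :: complex
  assumes "\<forall>\<^sub>\<approx>s. P s"
  shows "\<forall>\<^sub>\<approx>s. P (s - c)"
  unfolding eventually_cosparse_open_eq[OF open_UNIV]
proof
  fix z :: complex
  have 1: "eventually P (at (z - c))"
    using assms by (rule eventually_cosparse_imp_eventually_at) auto
  have "filterlim (\<lambda>s. s - c) (at (z - c)) (at z)"
    unfolding filterlim_at
  proof
    show "((\<lambda>s. s - c) \<longlongrightarrow> z - c) (at z)" by (intro tendsto_intros)
    show "\<forall>\<^sub>F s in at z. s - c \<in> UNIV \<and> s - c \<noteq> z - c"
      using eventually_neq_at_within[of z z UNIV] by eventually_elim simp
  qed
  with 1 show "eventually (\<lambda>s. P (s - c)) (at z)" by (rule eventually_compose_filterlim)
qed

text \<open>
  Each piece is integrated by parts. The boundary terms telescope, because they are the values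
  of one and the same function \<open>f (\<i> t) * t powr (s - 1)\<close> at the points of the splitting.
\<close>
lemma is_complete_L_D_op:
  assumes \<sigma>: "\<sigma> \<in> {1, -1}" and f: "tame_form f" and L: "is_complete_L \<sigma> f \<Lambda>"
  shows "is_complete_L \<sigma> (D_op f) (remove_sings (\<lambda>s. (s - 1) / (2 * of_real pi) * \<Lambda> (s - 1)))"
proof -
  note f' = tame_form_D_op[OF f]
  let ?P = "2 * complex_of_real pi"
  from L obtain as cs \<Lambda>\<^sub>0 \<Lambda>\<^sub>1 I M\<^sub>0 M\<^sub>1 where A: "\<Lambda> nicely_meromorphic_on UNIV" "pole_splitting f as cs"
    "\<Lambda>\<^sub>0 meromorphic_on UNIV" "\<Lambda>\<^sub>1 meromorphic_on UNIV"
    "\<And>s. Re s > M\<^sub>0 \<Longrightarrow> has_reg_integral_zero \<sigma> (mellin_integrand f s) (hd as) (\<Lambda>\<^sub>0 s)"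
    "\<And>s. Re s < M\<^sub>1 \<Longrightarrow> has_reg_integral_inf \<sigma> (mellin_integrand f s) (last as) (\<Lambda>\<^sub>1 s)"
    "\<And>j s. j < length cs \<Longrightarrow> has_reg_integral_pole (mellin_integrand f s) (as ! j) (as ! Suc j) (cs ! j) (I j s)"
    "\<forall>\<^sub>\<approx>s. \<Lambda> s = \<Lambda>\<^sub>0 s + (\<Sum>j<length cs. I j s) + \<Lambda>\<^sub>1 s"
    unfolding is_complete_L_def by blast
  note p = pole_splittingD[OF A(2)]
  define n where "n = length cs"
  define H where "H = (\<lambda>j s. mellin_integrand f s (as ! j))"
  have pole_iff: "is_pole (D_op f) (\<i> * of_real t) \<longleftrightarrow> is_pole f (\<i> * of_real t)" if "t > 0" for t
  proof -
    have D: "D_op f = (\<lambda>z. inverse (2 * of_real pi * \<i>) * deriv f z)"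
      by (rule ext) (simp add: D_op_def field_simps)
    have "f meromorphic_on {\<i> * of_real t}"
      by (rule meromorphic_on_subset[OF f[unfolded tame_form_def, THEN conjunct1]]) (use that in simp)
    then show ?thesis unfolding D by (subst is_pole_cmult_iff) (simp_all add: is_pole_deriv_iff)
  qed
  have P: "axis_poles (D_op f) = axis_poles f" using pole_iff by (auto simp: axis_poles_def)
  have s': "pole_splitting (D_op f) as cs"
    using A(2) unfolding pole_splitting_def Let_def axis_poles_def[symmetric] P .
  \<comment> \<open>The pieces for D f as integration by parts predicts them. The boundary terms - H
    0, - (H (j+1) - H j) and + H n add up to 0.\<close>
  define \<Lambda>\<^sub>0' where "\<Lambda>\<^sub>0' = (\<lambda>s. ((s - 1) * \<Lambda>\<^sub>0 (s - 1) - H 0 s) / ?P)"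
  define \<Lambda>\<^sub>1' where "\<Lambda>\<^sub>1' = (\<lambda>s. ((s - 1) * \<Lambda>\<^sub>1 (s - 1) + H n s) / ?P)"
  define I' where "I' = (\<lambda>j s. ((s - 1) * I j (s - 1) - (H (Suc j) s - H j s)) / ?P)"
  have Hm: "(\<lambda>s. H j s) meromorphic_on UNIV" if "j \<le> n" for j
  proof -
    have "as ! j > 0" using p(10)[of j] that by (simp add: n_def)
    then have "(\<lambda>s. H j s) holomorphic_on UNIV"
      unfolding H_def mellin_integrand_def by (intro holomorphic_intros) auto
    then show ?thesis by (rule entire_imp_meromorphic)
  qed
  have shift: "(\<lambda>s. V (s - 1)) meromorphic_on UNIV" if "V meromorphic_on UNIV" for V
    using meromorphic_on_UNIV_shift[OF that, of "-1"] by simp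
  have m0: "\<Lambda>\<^sub>0' meromorphic_on UNIV" and m1: "\<Lambda>\<^sub>1' meromorphic_on UNIV"
    unfolding \<Lambda>\<^sub>0'_def \<Lambda>\<^sub>1'_def
    by (intro meromorphic_on_divide meromorphic_on_add meromorphic_on_diff meromorphic_on_mult
         meromorphic_on_const meromorphic_on_id shift A(3,4) Hm; simp)+
  \<comment> \<open>Existence of the piece for D f comes from tameness of D f; integration by parts
    then only identifies its value.\<close>
  obtain V N where V: "\<And>s. Re s < N \<Longrightarrow> has_reg_integral_inf \<sigma> (mellin_integrand (D_op f) s) (as ! n) (V s)"
    using inf_piece_exists[OF \<sigma> f' p(10) p(8)[folded P]] unfolding n_def by blast
  have inf: "has_reg_integral_inf \<sigma> (mellin_integrand (D_op f) s) (as ! n) (\<Lambda>\<^sub>1' s)" if s: "Re s < min N M\<^sub>1" for s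
  proof -
    have pos: "as ! n > 0" using p(10)[of n] by (simp add: n_def)
    have "- ?P * V s = - f (\<i> * of_real (as ! n)) * of_real (as ! n) powr (s - 1) - (s - 1) * \<Lambda>\<^sub>1 (s - 1)"
    proof (rule has_reg_integral_inf_by_parts[OF \<sigma> pos])
      show "((\<lambda>t. f (\<i> * of_real t)) has_vector_derivative (- ?P * D_op f (\<i> * of_real t))) (at t)" if "t \<ge> as ! n" for t
      proof (rule axis_derivative[OF tame_form_analytic[OF f]])
        show "t > 0" using that pos by simp
        have "t \<in> {as ! length cs..}" using that by (simp add: n_def)
        then show "t \<notin> axis_poles f" using p(8) by blast
      qed
      show "has_reg_integral_inf \<sigma> (\<lambda>t. f (\<i> * of_real t) * of_real t powr (s - 1)) (as ! n) (\<Lambda>\<^sub>1 s)"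
        using A(6)[of s] s unfolding p(3) n_def mellin_integrand_def by simp
      have "Re (s - 1) < M\<^sub>1" using s by simp
      from A(6)[OF this] show "has_reg_integral_inf \<sigma> (\<lambda>t. f (\<i> * of_real t) * of_real t powr (s - 2)) (as ! n) (\<Lambda>\<^sub>1 (s - 1))"
        unfolding p(3) n_def mellin_integrand_def by (simp add: diff_diff_eq)
      have "Re s < N" using s by simp
      from has_reg_integral_inf_cmult[OF V[OF this], of "- ?P"]
      show "has_reg_integral_inf \<sigma> (\<lambda>t. - ?P * D_op f (\<i> * of_real t) * of_real t powr (s - 1)) (as ! n) (- ?P * V s)"
        unfolding mellin_integrand_def by (simp only: mult.assoc)
    qed
    then have "?P * V s = H n s + (s - 1) * \<Lambda>\<^sub>1 (s - 1)"
      unfolding H_def mellin_integrand_def by (simp add: algebra_simps)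
    then have "V s = \<Lambda>\<^sub>1' s" unfolding \<Lambda>\<^sub>1'_def by (simp add: field_simps)
    then show ?thesis using V[of s] s by simp
  qed
  obtain W N\<^sub>0 where W: "\<And>s. Re s > N\<^sub>0 \<Longrightarrow> has_reg_integral_zero \<sigma> (mellin_integrand (D_op f) s) (as ! 0) (W s)"
    using zero_piece_exists[OF \<sigma> f' p(10) p(7)[folded P]] by blast
  \<comment> \<open>In the inverted variable integration by parts runs with exponent parameter 2 -
    s. It refers to the piece of f at s - 1 and, for the vanishing term, at s - 2; hence the bound
    \<open>M\<^sub>0 + 2\<close>.\<close>
  have zero: "has_reg_integral_zero \<sigma> (mellin_integrand (D_op f) s) (as ! 0) (\<Lambda>\<^sub>0' s)" if s: "Re s > max N\<^sub>0 (M\<^sub>0 + 2)" for s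
  proof -
    let ?x = "as ! 0"
    have pos: "?x > 0" using p(10)[of 0] by simp
    then have pos': "1 / ?x > 0" by simp
    note iff = has_reg_integral_zero_mellin_iff[OF pos]
    have "?P * W s = - f (\<i> / of_real (1 / ?x)) * of_real (1 / ?x) powr ((2 - s) - 1) - ((2 - s) - 1) * \<Lambda>\<^sub>0 (s - 1)"
    proof (rule has_reg_integral_inf_by_parts[OF \<sigma> pos'])
      show "((\<lambda>t. f (\<i> / of_real t)) has_vector_derivative (?P * D_op f (\<i> / of_real t) / of_real t ^ 2)) (at t)"
        if "t \<ge> 1 / ?x" for t
        by (rule axis_derivative_inverse[OF inverse_analytic[OF f p(7) pos that]])
           (use inverse_not_pole(1)[OF p(7) pos that] in simp)
      have "Re (s - 2) > M\<^sub>0" using s by simp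
      from A(5)[OF this] show "has_reg_integral_inf \<sigma> (\<lambda>t. f (\<i> / of_real t) * of_real t powr ((2 - s) - 1)) (1 / ?x) (\<Lambda>\<^sub>0 (s - 2))"
        unfolding p(2) iff by (simp add: algebra_simps)
      have "Re (s - 1) > M\<^sub>0" using s by simp
      from A(5)[OF this] show "has_reg_integral_inf \<sigma> (\<lambda>t. f (\<i> / of_real t) * of_real t powr ((2 - s) - 2)) (1 / ?x) (\<Lambda>\<^sub>0 (s - 1))"
        unfolding p(2) iff by (simp add: algebra_simps)
      have "Re s > N\<^sub>0" using s by simp
      note h = has_reg_integral_inf_cmult[OF W[OF this, unfolded iff], of ?P]
      have e: "?P * (D_op f (\<i> / of_real t) * of_real t powr (- s - 1)) =
         ?P * D_op f (\<i> / of_real t) / of_real t ^ 2 * of_real t powr ((2 - s) - 1)" if "t \<ge> 1 / ?x" for t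
      proof -
        have t: "complex_of_real t \<noteq> 0" using inverse_not_pole(1)[OF p(7) pos that] by simp
        have "of_real t powr ((- s - 1) + of_nat 2) = of_real t powr (- s - 1) * (of_real t powr of_nat 2 :: complex)"
          by (rule powr_add)
        also have "of_real t powr of_nat 2 = (of_real t ^ 2 :: complex)" by (rule powr_nat') (simp add: t)
        also have "(- s - 1) + of_nat 2 = (2 - s) - 1" by simp
        finally show ?thesis using t by simp
      qed
      show "has_reg_integral_inf \<sigma> (\<lambda>t. ?P * D_op f (\<i> / of_real t) / of_real t ^ 2 * of_real t powr ((2 - s) - 1)) (1 / ?x) (?P * W s)"
        by (rule iffD1[OF has_reg_integral_inf_cong[OF e] h])
    qed
    moreover have "f (\<i> / of_real (1 / ?x)) * of_real (1 / ?x) powr ((2 - s) - 1) = H 0 s"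
    proof -
      have "Ln (complex_of_real (1 / ?x)) = - Ln (of_real ?x)"
        using pos by (simp add: Ln_of_real ln_div del: of_real_divide)
      then have "complex_of_real (1 / ?x) powr ((2 - s) - 1) = of_real ?x powr (s - 1)"
        using pos by (simp add: powr_def algebra_simps)
      moreover have "\<i> / complex_of_real (1 / ?x) = \<i> * of_real ?x" by simp
      ultimately show ?thesis unfolding H_def mellin_integrand_def by (simp only:)
    qed
    ultimately have "?P * W s = - H 0 s - ((2 - s) - 1) * \<Lambda>\<^sub>0 (s - 1)" by simp
    then have "W s = \<Lambda>\<^sub>0' s" unfolding \<Lambda>\<^sub>0'_def by (simp add: field_simps)
    then show ?thesis using W[of s] s by simp
  qed
  have pole: "has_reg_integral_pole (mellin_integrand (D_op f) s) (as ! j) (as ! Suc j) (cs ! j) (I' j s)"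
    if j: "j < length cs" for j s
  proof -
    obtain e U where box: "pole_box f (as ! j) (as ! Suc j) (cs ! j) e U"
      using pole_box_exists[OF f p(10) p(4)[OF j] p(5)[OF j] p(6)[OF j]] j by auto
    have "I j (s - 1) = pole_avg (\<lambda>z. f (\<i> * z) * z powr ((s - 1) - 1)) (as ! j) (as ! Suc j) (cs ! j) e"
      by (rule has_reg_integral_pole_unique[OF A(7)[OF j] has_finite_part_imp_reg_integral[OF pole_box_finite_part[OF box]]])
    then have "pole_avg (\<lambda>z. D_op f (\<i> * z) * z powr (s - 1)) (as ! j) (as ! Suc j) (cs ! j) e = I' j s"
      using pole_box_by_parts[OF f box, of s] by (simp add: I'_def H_def diff_diff_eq)
    with has_finite_part_imp_reg_integral[OF pole_box_finite_part[OF pole_box_D_op[OF f box], of s]]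
    show ?thesis by simp
  qed
  define Z where "Z = (\<lambda>s. (s - 1) / ?P * \<Lambda> (s - 1))"
  have Z: "Z meromorphic_on UNIV"
    unfolding Z_def using A(1)
    by (intro meromorphic_on_divide meromorphic_on_diff meromorphic_on_mult
         meromorphic_on_const meromorphic_on_id shift) (simp add: nicely_meromorphic_on_def)
  have sum: "\<Lambda>\<^sub>0' s + (\<Sum>j<n. I' j s) + \<Lambda>\<^sub>1' s = (s - 1) / ?P * (\<Lambda>\<^sub>0 (s - 1) + (\<Sum>j<n. I j (s - 1)) + \<Lambda>\<^sub>1 (s - 1))" for s
  proof -
    have "(\<Sum>j<n. I' j s) = ((s - 1) * (\<Sum>j<n. I j (s - 1)) - (\<Sum>j<n. H (Suc j) s - H j s)) / ?P"
      unfolding I'_def sum_distrib_left sum_subtractf[symmetric] sum_divide_distrib ..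
    also have "(\<Sum>j<n. H (Suc j) s - H j s) = H n s - H 0 s" by (rule sum_lessThan_telescope)
    finally have X: "(\<Sum>j<n. I' j s) = ((s - 1) * (\<Sum>j<n. I j (s - 1)) - (H n s - H 0 s)) / ?P" .
    have "(u - a) / c + (v - (b - a)) / c + (w + b) / c = (u + v + w) / c" for u v w a b c :: complex
      by (simp flip: add_divide_distrib)
    then have "\<Lambda>\<^sub>0' s + (\<Sum>j<n. I' j s) + \<Lambda>\<^sub>1' s =
        ((s - 1) * \<Lambda>\<^sub>0 (s - 1) + (s - 1) * (\<Sum>j<n. I j (s - 1)) + (s - 1) * \<Lambda>\<^sub>1 (s - 1)) / ?P"
      unfolding \<Lambda>\<^sub>0'_def \<Lambda>\<^sub>1'_def X by blast
    then show ?thesis by (simp only: distrib_left times_divide_eq_left add_divide_distrib)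
  qed
  from cosparse_shift[OF A(8), of 1] eventually_remove_sings_eq[OF Z]
  have rel: "\<forall>\<^sub>\<approx>s. remove_sings Z s = \<Lambda>\<^sub>0' s + (\<Sum>j<length cs. I' j s) + \<Lambda>\<^sub>1' s"
    unfolding n_def[symmetric]
  proof eventually_elim
    case (elim s)
    have "remove_sings Z s = (s - 1) / ?P * \<Lambda> (s - 1)" using elim(2) by (simp only: Z_def)
    then show ?case unfolding sum elim(1) .
  qed
  have "is_complete_L \<sigma> (D_op f) (remove_sings Z)"
    by (rule is_complete_LI[OF remove_sings_nicely_meromorphic[OF Z] s' m0 m1 zero[folded p(2)]
          inf[unfolded n_def, folded p(3)] pole rel])
  then show ?thesis unfolding Z_def .
qed

lemma complete_L_D_op:
  assumes \<sigma>: "\<sigma> \<in> {1, -1}" and f: "tame_form f"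
  shows "\<forall>\<^sub>\<approx>s. complete_L \<sigma> (D_op f) s = (s - 1) / (2 * of_real pi) * complete_L \<sigma> f (s - 1)"
proof -
  let ?Z = "\<lambda>s. (s - 1) / (2 * of_real pi) * complete_L \<sigma> f (s - 1)"
  have L: "is_complete_L \<sigma> f (complete_L \<sigma> f)" by (rule complete_L_is_complete_L[OF \<sigma> f])
  have eq: "complete_L \<sigma> (D_op f) = remove_sings ?Z"
    by (rule is_complete_L_unique[OF \<sigma> tame_form_D_op[OF f] complete_L_is_complete_L[OF \<sigma> tame_form_D_op[OF f]]
         is_complete_L_D_op[OF \<sigma> f L]])
  have "complete_L \<sigma> f meromorphic_on UNIV"
    using L by (simp add: is_complete_L_def nicely_meromorphic_on_def)
  from meromorphic_on_UNIV_shift[OF this, of "-1"]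
  have "(\<lambda>s. complete_L \<sigma> f (s - 1)) meromorphic_on UNIV" by simp
  then have "?Z meromorphic_on UNIV"
    by (intro meromorphic_on_divide meromorphic_on_diff meromorphic_on_mult meromorphic_on_const meromorphic_on_id)
  from eventually_remove_sings_eq[OF this] show ?thesis unfolding eq .
qed

section \<open>Iteration of D and the Dirichlet L-function\<close>

lemma D_op_funpow_cong:
  assumes "\<forall>\<^sub>\<approx>\<tau>\<in>\<H>. f \<tau> = g \<tau>"
  shows "\<forall>\<^sub>\<approx>\<tau>\<in>\<H>. (D_op ^^ l) f \<tau> = (D_op ^^ l) g \<tau>"
  by (induction l) (use assms in \<open>simp_all add: D_op_cong\<close>)

lemma tame_form_funpow: "tame_form f \<Longrightarrow> tame_form ((D_op ^^ l) f)"
  by (induction l) (simp_all add: tame_form_D_op)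

lemma complete_L_funpow:
  assumes \<sigma>: "\<sigma> \<in> {1, -1}" and f: "tame_form f"
  shows "\<forall>\<^sub>\<approx>s. complete_L \<sigma> ((D_op ^^ l) f) s =
     pochhammer (s - of_nat l) l / of_real (2 * pi) ^ l * complete_L \<sigma> f (s - of_nat l)"
proof (induction l)
  case 0
  then show ?case by simp
next
  case (Suc l)
  from complete_L_D_op[OF \<sigma> tame_form_funpow[OF f, of l]] cosparse_shift[OF Suc.IH, of 1]
  show ?case
  proof eventually_elim
    case (elim s)
    have 1: "s - 1 - of_nat l = s - of_nat (Suc l)" by simp
    \<comment> \<open>The new factor s - 1 is the top factor of the longer product, and the shifted
      induction hypothesis supplies the others.\<close>
    have "pochhammer (s - of_nat (Suc l)) (Suc l) = pochhammer (s - of_nat (Suc l)) l * (s - 1)"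
      by (subst pochhammer_rec') simp
    with elim show ?case unfolding 1 by simp
  qed
qed

text \<open>The entire function \<open>rGamma\<close> replaces the quotient by Gamma. Where Gamma
  has poles, its value 0 and division by 0 give 0, which is also the value of
  \<open>rGamma\<close>.\<close>

lemma dirichlet_L_conv_rGamma:
  "dirichlet_L \<sigma> f s = of_real (2 * pi) powr s * rGamma s * complete_L \<sigma> f s"
  by (simp add: dirichlet_L_def rGamma_inverse_Gamma divide_inverse)

lemma dirichlet_L_meromorphic:
  assumes "complete_L \<sigma> f meromorphic_on UNIV"
  shows "dirichlet_L \<sigma> f meromorphic_on UNIV"
proof -
  have "(\<lambda>s. of_real (2 * pi) powr s) holomorphic_on UNIV"
    by (intro holomorphic_intros)
  moreover have "(rGamma :: complex \<Rightarrow> complex) holomorphic_on UNIV" by (intro holomorphic_intros)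
  ultimately have "(\<lambda>s. of_real (2 * pi) powr s * rGamma s) holomorphic_on UNIV" by (rule holomorphic_on_mult)
  then show ?thesis
    unfolding dirichlet_L_conv_rGamma[abs_def] by (intro meromorphic_on_mult entire_imp_meromorphic assms)
qed

theorem theorem8p7:
  fixes f :: "complex \<Rightarrow> complex" and k :: int and l :: nat and \<sigma> :: real
  assumes "meromorphic_quasimodular_form k f"
    and "\<sigma> \<in> {1, -1}"
  shows "complete_L \<sigma> f meromorphic_on UNIV \<and>
         complete_L \<sigma> ((D_op ^^ l) f) meromorphic_on UNIV \<and>
         dirichlet_L \<sigma> f meromorphic_on UNIV \<and>
         dirichlet_L \<sigma> ((D_op ^^ l) f) meromorphic_on UNIV \<and>
         (\<forall>\<^sub>\<approx>s. complete_L \<sigma> ((D_op ^^ l) f) s =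
                 pochhammer (s - of_nat l) l / of_real (2 * pi) ^ l * complete_L \<sigma> f (s - of_nat l)) \<and>
         (\<forall>\<^sub>\<approx>s. dirichlet_L \<sigma> ((D_op ^^ l) f) s = dirichlet_L \<sigma> f (s - of_nat l))"
proof -
  \<comment> \<open>g is tame and equals f off a sparse set. By the congruence lemmas all D^m f and
    D^m g have the same complete L-functions.\<close>
  define g where "g = remove_sings f"
  have g: "tame_form g" unfolding g_def by (rule tame_form_of_quasimodular[OF assms(1)])
  have "f meromorphic_on \<H>" using assms(1) by (simp add: meromorphic_quasimodular_form_def)
  from eventually_remove_sings_eq[OF this] have eq: "\<forall>\<^sub>\<approx>\<tau>\<in>\<H>. f \<tau> = g \<tau>"
    unfolding g_def by eventually_elim simp
  have c: "complete_L \<sigma> ((D_op ^^ m) f) = complete_L \<sigma> ((D_op ^^ m) g)" for m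
    by (rule complete_L_cong[OF D_op_funpow_cong[OF eq]])
  have m: "complete_L \<sigma> ((D_op ^^ m) f) meromorphic_on UNIV" for m
    unfolding c using complete_L_is_complete_L[OF assms(2) tame_form_funpow[OF g, of m]]
    by (simp add: is_complete_L_def nicely_meromorphic_on_def)
  have rel: "\<forall>\<^sub>\<approx>s. complete_L \<sigma> ((D_op ^^ l) f) s =
      pochhammer (s - of_nat l) l / of_real (2 * pi) ^ l * complete_L \<sigma> f (s - of_nat l)"
    using complete_L_funpow[OF assms(2) g, of l] c[of l] c[of 0] by simp
  have "\<forall>\<^sub>\<approx>s. dirichlet_L \<sigma> ((D_op ^^ l) f) s = dirichlet_L \<sigma> f (s - of_nat l)"
    using rel
  proof eventually_elim
    case (elim s)
    \<comment> \<open>Gamma (s) = (s - l)_l Gamma (s - l) absorbs the Pochhammer factor, and the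
      power of 2 pi is absorbed by (2 pi) powr s.\<close>
    have G: "rGamma (s - of_nat l) = pochhammer (s - of_nat l) l * rGamma s"
      using pochhammer_rGamma[of "s - of_nat l" l] by simp
    have w: "complex_of_real (2 * pi) powr (s - of_nat l) = of_real (2 * pi) powr s / of_real (2 * pi) ^ l"
      using powr_nat'[of "complex_of_real (2 * pi)" l] by (simp add: powr_diff)
    show ?case unfolding dirichlet_L_conv_rGamma elim G w by (simp add: mult_ac)
  qed
  with rel m[of 0] m[of l] show ?thesis
    by (simp add: dirichlet_L_meromorphic)
qed

end
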